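(* Let $S\subset\mathbb{R}$ be a finite union of bounded intervals of positive length. Then there exists a set $\Lambda\subset\mathbb{R}$ such that the system $\{e^{i\lambda t}\}_{\lambda\in\Lambda}$ is a Riesz basis of $L^2(S)$. Moreover, if $S\subseteq[0,2\pi]$, then $\Lambda$ may be chosen so that $\Lambda\subseteq\mathbb{Z}$.
   Context: A system $\{f_n\}$ in a separable Hilbert space $H$ is a Riesz basis if it is the image of an orthonormal basis under a bounded invertible operator. Equivalently, it is complete in $H$ and there exist constants $0<c\le C$ such that $c\sum|a_n|^2\le\|\sum a_nf_n\|^2\le C\sum|a_n|^2$ for all $\{a_n\}\in\ell^2$. *)

theory Defs
  imports "HOL-Analysis.Analysis"
begin

text \<open>L^2(S): complex-valued, Lebesgue measurable, square-integrable functions on S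
  (elements identified a.e. only implicitly, via the L^2 seminorm).\<close>
definition L2 :: "real set \<Rightarrow> (real \<Rightarrow> complex) set" where
  "L2 S = {f. f \<in> borel_measurable (lebesgue_on S) \<and>
              integrable (lebesgue_on S) (\<lambda>t. (cmod (f t))\<^sup>2)}"

definition L2norm :: "real set \<Rightarrow> (real \<Rightarrow> complex) \<Rightarrow> real" where
  "L2norm S f = sqrt (\<integral>t. (cmod (f t))\<^sup>2 \<partial>lebesgue_on S)"

definition expo :: "real \<Rightarrow> real \<Rightarrow> complex" where
  "expo l t = exp (\<i> * complex_of_real (l * t))"

definition exp_series_converges ::
  "real set \<Rightarrow> real set \<Rightarrow> (real \<Rightarrow> complex) \<Rightarrow> (real \<Rightarrow> complex) \<Rightarrow> bool" where
  "exp_series_converges S \<Lambda> a g \<longleftrightarrow>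
     (\<forall>\<epsilon>>0. \<exists>F0. finite F0 \<and> F0 \<subseteq> \<Lambda> \<and>
        (\<forall>F. finite F \<and> F0 \<subseteq> F \<and> F \<subseteq> \<Lambda> \<longrightarrow>
           L2norm S (\<lambda>t. g t - (\<Sum>l\<in>F. a l * expo l t)) < \<epsilon>))"

definition exp_riesz_basis :: "real set \<Rightarrow> real set \<Rightarrow> bool" where
  "exp_riesz_basis S \<Lambda> \<longleftrightarrow>
     (\<forall>f\<in>L2 S. \<forall>\<epsilon>>0. \<exists>F a. finite F \<and> F \<subseteq> \<Lambda> \<and>
          L2norm S (\<lambda>t. f t - (\<Sum>l\<in>F. a l * expo l t)) < \<epsilon>) \<and>
     (\<exists>c C. 0 < c \<and> c \<le> C \<and>
        (\<forall>a :: real \<Rightarrow> complex. (\<lambda>l. (cmod (a l))\<^sup>2) summable_on \<Lambda> \<longrightarrow>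
           (\<exists>g\<in>L2 S. exp_series_converges S \<Lambda> a g \<and>
              c * (\<Sum>\<^sub>\<infinity>l\<in>\<Lambda>. (cmod (a l))\<^sup>2) \<le> (L2norm S g)\<^sup>2 \<and>
              (L2norm S g)\<^sup>2 \<le> C * (\<Sum>\<^sub>\<infinity>l\<in>\<Lambda>. (cmod (a l))\<^sup>2))))"

text \<open>A bounded interval of positive length (open, closed or half-open).\<close>
definition bounded_interval_pos :: "real set \<Rightarrow> bool" where
  "bounded_interval_pos I \<longleftrightarrow> (\<exists>a b. a < b \<and> {a<..<b} \<subseteq> I \<and> I \<subseteq> {a..b})"

end

theory Submission
  imports Defs "HOL-Analysis.Kronecker_Approximation_Theorem"
begin

text \<open>After an affine change of variables, \<open>S\<close> is a union of arcs of a circle of length one and the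
frequencies are integers. Following Kozma and Nitzan, fold the circle \<open>N\<close> times onto itself and let
\<open>B\<^sub>n\<close> be the set of points with at least \<open>n\<close> preimages in \<open>S\<close>: frequency sets for \<open>B\<^sub>1, \<dots>, B\<^sub>N\<close>,
placed in the residue classes \<open>1, \<dots>, N\<close> modulo \<open>N\<close>, combine to one for \<open>S\<close>, because the resulting
linear systems are triangular with invertible Vandermonde blocks. Every \<open>B\<^sub>n\<close> has at most as many jump
points as \<open>S\<close>, so one can induct on this number. If two jumps differ by a rational, some \<open>N\<close> merges them.
Otherwise, for three or more jumps, the mean over \<open>N\<close> of two Fourier coefficients of the
multiplicity function exceeds what Bessel's inequality allows for a function with two values; hence for
some \<open>N\<close> it has more values and no \<open>B\<^sub>n\<close> has all the jumps. For two jumps, \<open>N\<close> can be chosen such that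
every \<open>B\<^sub>n\<close> is everything, empty, or a short arc of length \<open>\<tau>\<close>; there, rounding the frequencies \<open>n / \<tau>\<close>
of an orthogonal basis to integers is a small perturbation.\<close>

subsection \<open>The seminorm of \<open>L2\<close>\<close>

text \<open>Unit jumps with total 0 come in an even number, so after two jumps the next case is
  four. This is what makes the averaging argument win. If all frequencies k were used with their
  weights 1/k^2, the mean over \<open>N\<close> would be n pi^2/6 for n jumps, while a two-valued
  function admits at most pi^2/2: three jumps would tie, and two must lose, because a folded arc
  never has more than two multiplicities. For four jumps, frequencies 1 and 2 already give 4 + 1 = 5
  > pi^2/2, whereas frequency 1 alone gives only 4.

  Arcs therefore form a base case outside the induction. Folding serves there only to make the arc
  so short that rounding is harmless relative to its length.

  The other obstacle is completeness, which is not an inequality that a triangular system could hand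
  on. It is traded for a lower bound for the complementary frequencies on the complementary set. The
  property is then symmetric under complements, one combination lemma serves both halves, and
  completeness is recovered only at the end.\<close>

lemma L2_I:
  "f \<in> borel_measurable (lebesgue_on S) \<Longrightarrow> integrable (lebesgue_on S) (\<lambda>t. (cmod (f t))^2) \<Longrightarrow> f \<in> L2 S"
  by (simp add: L2_def)

lemma L2_measurable: "f \<in> L2 S \<Longrightarrow> f \<in> borel_measurable (lebesgue_on S)"
  by (simp add: L2_def)

lemma L2_integrable: "f \<in> L2 S \<Longrightarrow> integrable (lebesgue_on S) (\<lambda>t. (cmod (f t))^2)"
  by (simp add: L2_def)

lemma L2norm_nonneg [simp]: "0 \<le> L2norm S f"
  by (simp add: L2norm_def)

lemma L2norm_sq: "(L2norm S f)^2 = (\<integral>t. (cmod (f t))^2 \<partial>lebesgue_on S)"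
  by (simp add: L2norm_def)

lemma L2norm_cong:
  assumes "\<And>t. t \<in> S \<Longrightarrow> cmod (f t) = cmod (g t)"
  shows "L2norm S f = L2norm S g"
  unfolding L2norm_def using assms by (intro arg_cong[where f=sqrt] Bochner_Integration.integral_cong) auto

text \<open>The free weight \<open>s\<close> stands in for the Cauchy-Schwarz inequality: for
  nonzero x and y, the choice s = |y|/|x| turns the right-hand side into (|x| + |y|)^2.\<close>

lemma cmod_add_sq_le:
  assumes "0 < s"
  shows "(cmod (x + y))^2 \<le> (1 + s) * (cmod x)^2 + (1 + 1/s) * (cmod y)^2"
proof -
  have "(cmod (x + y))^2 \<le> (cmod x + cmod y)^2"
    by (intro power_mono norm_triangle_ineq) auto
  also have "\<dots> = (1 + s) * (cmod x)^2 + (1 + 1/s) * (cmod y)^2 - (s * cmod x - cmod y)^2 / s"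
    using assms by (simp add: field_simps power2_eq_square)
  also have "\<dots> \<le> (1 + s) * (cmod x)^2 + (1 + 1/s) * (cmod y)^2"
    using assms by simp
  finally show ?thesis .
qed

lemma L2_dominated:
  assumes "g \<in> L2 S" "f \<in> borel_measurable (lebesgue_on S)" "\<And>t. t \<in> S \<Longrightarrow> cmod (f t) \<le> cmod (g t)"
  shows "f \<in> L2 S" "L2norm S f \<le> L2norm S g"
proof -
  have *: "(cmod (f t))^2 \<le> (cmod (g t))^2" if "t \<in> S" for t
    using assms(3)[OF that] by (intro power_mono) auto
  have m: "(\<lambda>t. (cmod (f t))^2) \<in> borel_measurable (lebesgue_on S)"
    using assms(2) by measurable
  show f: "f \<in> L2 S"
    by (rule L2_I[OF assms(2)], rule Bochner_Integration.integrable_bound[OF L2_integrable[OF assms(1)] m])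
       (auto intro!: AE_I2 assms(3))
  show "L2norm S f \<le> L2norm S g"
    unfolding L2norm_def
    using * by (intro real_sqrt_le_mono integral_mono L2_integrable f assms(1)) simp
qed

lemma L2_zero [simp]: "(\<lambda>t. 0) \<in> L2 S"
  by (auto intro!: L2_I)

lemma L2_add:
  assumes "f \<in> L2 S" "g \<in> L2 S"
  shows "(\<lambda>t. f t + g t) \<in> L2 S"
proof (rule L2_I)
  have [measurable]: "f \<in> borel_measurable (lebesgue_on S)" "g \<in> borel_measurable (lebesgue_on S)"
    using assms by (auto simp: L2_measurable)
  show "(\<lambda>t. f t + g t) \<in> borel_measurable (lebesgue_on S)" by measurable
  show "integrable (lebesgue_on S) (\<lambda>t. (cmod (f t + g t))^2)"
  proof (rule Bochner_Integration.integrable_bound)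
    show "integrable (lebesgue_on S) (\<lambda>t. 2 * (cmod (f t))^2 + 2 * (cmod (g t))^2)"
      using assms by (auto simp: L2_integrable)
    show "AE t in lebesgue_on S. norm ((cmod (f t + g t))^2) \<le> norm (2 * (cmod (f t))^2 + 2 * (cmod (g t))^2)"
      using cmod_add_sq_le[of 1] by (intro AE_I2) simp
  qed measurable
qed

lemma L2_cmult:
  assumes "f \<in> L2 S"
  shows "(\<lambda>t. c * f t) \<in> L2 S"
proof (rule L2_I)
  have [measurable]: "f \<in> borel_measurable (lebesgue_on S)"
    using assms by (auto simp: L2_measurable)
  show "(\<lambda>t. c * f t) \<in> borel_measurable (lebesgue_on S)" by measurable
  show "integrable (lebesgue_on S) (\<lambda>t. (cmod (c * f t))^2)"
    using L2_integrable[OF assms] by (simp add: norm_mult power_mult_distrib)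
qed

lemma L2_diff:
  assumes "f \<in> L2 S" "g \<in> L2 S"
  shows "(\<lambda>t. f t - g t) \<in> L2 S"
  using L2_add[OF assms(1) L2_cmult[OF assms(2), of "-1"]] by simp

lemma L2_sum:
  assumes "\<And>i. i \<in> A \<Longrightarrow> f i \<in> L2 S"
  shows "(\<lambda>t. \<Sum>i\<in>A. f i t) \<in> L2 S"
  using assms by (induction A rule: infinite_finite_induct) (auto intro: L2_add)

lemma L2norm_cmult: "L2norm S (\<lambda>t. c * f t) = cmod c * L2norm S f"
  by (simp add: L2norm_def norm_mult power_mult_distrib real_sqrt_mult)

lemma L2norm_zero [simp]: "L2norm S (\<lambda>t. 0) = 0"
  by (simp add: L2norm_def)

text \<open>Integrating the pointwise inequality gives one bound for every weight \<open>s\<close>;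
  the ratio of the two norms is the optimal weight.\<close>

lemma L2norm_triangle:
  assumes "f \<in> L2 S" "g \<in> L2 S"
  shows "L2norm S (\<lambda>t. f t + g t) \<le> L2norm S f + L2norm S g"
proof -
  let ?A = "L2norm S f" and ?B = "L2norm S g"
  have *: "(L2norm S (\<lambda>t. f t + g t))^2 \<le> (1 + s) * ?A^2 + (1 + 1/s) * ?B^2" if "0 < s" for s
  proof -
    note i = L2_integrable[OF assms(1)] L2_integrable[OF assms(2)]
    have "(L2norm S (\<lambda>t. f t + g t))^2 \<le>
        (\<integral>t. (1 + s) * (cmod (f t))^2 + (1 + 1/s) * (cmod (g t))^2 \<partial>lebesgue_on S)"
      unfolding L2norm_sq
    proof (rule integral_mono)
      show "integrable (lebesgue_on S) (\<lambda>t. (cmod (f t + g t))^2)"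
        by (rule L2_integrable[OF L2_add[OF assms]])
      show "integrable (lebesgue_on S) (\<lambda>t. (1 + s) * (cmod (f t))^2 + (1 + 1/s) * (cmod (g t))^2)"
        by (intro Bochner_Integration.integrable_add integrable_mult_right i)
    qed (rule cmod_add_sq_le[OF that])
    also have "\<dots> = (1 + s) * ?A^2 + (1 + 1/s) * ?B^2"
      unfolding L2norm_sq using i by (subst Bochner_Integration.integral_add) simp_all
    finally show ?thesis .
  qed
  show ?thesis
  proof (rule field_le_epsilon)
    fix e :: real assume e: "0 < e"
    \<comment> \<open>Enlarging both norms by e/2 keeps the optimal weight defined when a norm is
      0.\<close>
    let ?a = "?A + e/2" and ?b = "?B + e/2"
    have pos: "?a > 0" "?b > 0" using e L2norm_nonneg[of S f] L2norm_nonneg[of S g] by linarith+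
    have "(L2norm S (\<lambda>t. f t + g t))^2 \<le> (1 + ?b/?a) * ?A^2 + (1 + 1/(?b/?a)) * ?B^2"
      by (rule *[OF divide_pos_pos[OF pos(2,1)]])
    also have "\<dots> \<le> (1 + ?b/?a) * ?a^2 + (1 + 1/(?b/?a)) * ?b^2"
    proof (rule add_mono)
      have "0 \<le> ?b/?a" "0 \<le> 1/(?b/?a)"
        by (intro divide_nonneg_nonneg less_imp_le[OF pos(1)] less_imp_le[OF pos(2)] zero_le_one)+
      then have n: "0 \<le> 1 + ?b/?a" "0 \<le> 1 + 1/(?b/?a)" by linarith+
      have l: "?A^2 \<le> ?a^2" "?B^2 \<le> ?b^2"
        by (rule power_mono, use e in simp, simp)+
      show "(1 + ?b/?a) * ?A^2 \<le> (1 + ?b/?a) * ?a^2"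
        by (rule mult_left_mono[OF l(1) n(1)])
      show "(1 + 1/(?b/?a)) * ?B^2 \<le> (1 + 1/(?b/?a)) * ?b^2"
        by (rule mult_left_mono[OF l(2) n(2)])
    qed
    also have "\<dots> = (?a + ?b)^2"
    proof -
      have "(1 + b/a) * a^2 + (1 + 1/(b/a)) * b^2 = (a + b)^2" if "a > 0" "b > 0" for a b :: real
      proof -
        have "b/a * a^2 = a * b" "1/(b/a) * b^2 = a * b"
          using that by (simp_all add: power2_eq_square)
        then show ?thesis unfolding distrib_right by (simp add: power2_sum)
      qed
      from this[OF pos] show ?thesis .
    qed
    finally have "L2norm S (\<lambda>t. f t + g t) \<le> ?a + ?b"
      by (rule power2_le_imp_le) (rule add_nonneg_nonneg[OF less_imp_le[OF pos(1)] less_imp_le[OF pos(2)]])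
    then show "L2norm S (\<lambda>t. f t + g t) \<le> ?A + ?B + e" by simp
  qed
qed

lemma L2norm_triangle_diff:
  assumes "f \<in> L2 S" "g \<in> L2 S"
  shows "L2norm S (\<lambda>t. f t - g t) \<le> L2norm S f + L2norm S g"
  using L2norm_triangle[OF assms(1) L2_cmult[OF assms(2), of "-1"]] L2norm_cmult[of S "-1" g] by simp

lemma L2norm_minus_commute: "L2norm S (\<lambda>t. f t - g t) = L2norm S (\<lambda>t. g t - f t)"
  by (rule L2norm_cong) (simp add: norm_minus_commute)

lemma L2norm_triangle_mid:
  assumes "f \<in> L2 S" "g \<in> L2 S" "h \<in> L2 S"
  shows "L2norm S (\<lambda>t. f t - h t) \<le> L2norm S (\<lambda>t. f t - g t) + L2norm S (\<lambda>t. g t - h t)"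
  using L2norm_triangle[OF L2_diff[OF assms(1,2)] L2_diff[OF assms(2,3)]] by simp

lemma L2norm_le_add_diff:
  assumes "f \<in> L2 S" "g \<in> L2 S"
  shows "L2norm S f \<le> L2norm S g + L2norm S (\<lambda>t. f t - g t)"
  using L2norm_triangle[OF assms(2) L2_diff[OF assms]] by simp

lemma L2norm_sum_le:
  assumes "\<And>i. i \<in> A \<Longrightarrow> f i \<in> L2 S"
  shows "L2norm S (\<lambda>t. \<Sum>i\<in>A. f i t) \<le> (\<Sum>i\<in>A. L2norm S (f i))"
  using assms
proof (induction A rule: infinite_finite_induct)
  case (insert x F)
  have "L2norm S (\<lambda>t. f x t + (\<Sum>i\<in>F. f i t)) \<le> L2norm S (f x) + L2norm S (\<lambda>t. \<Sum>i\<in>F. f i t)"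
    using insert by (intro L2norm_triangle L2_sum) auto
  then show ?case using insert by fastforce
qed auto

lemma L2_bounded:
  assumes "S \<in> lmeasurable" "f \<in> borel_measurable (lebesgue_on S)" "\<And>t. t \<in> S \<Longrightarrow> cmod (f t) \<le> B"
  shows "f \<in> L2 S"
proof (rule L2_I[OF assms(2)])
  interpret finite_measure "lebesgue_on S" using assms(1) by (rule finite_measure_lebesgue_on)
  have "(cmod (f t))^2 \<le> B^2" if "t \<in> S" for t
    using assms(3)[OF that] by (intro power_mono) auto
  then show "integrable (lebesgue_on S) (\<lambda>t. (cmod (f t))^2)"
    using assms(2) by (intro integrable_const_bound[where B="B^2"]) (auto intro!: AE_I2)
qed

lemma L2_subset:
  assumes "f \<in> L2 T" "S \<subseteq> T" "S \<in> sets lebesgue" "T \<in> sets lebesgue"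
  shows "f \<in> L2 S"
proof (rule L2_I)
  show "f \<in> borel_measurable (lebesgue_on S)"
    using L2_measurable[OF assms(1)] assms(2) measurable_restrict_mono by blast
  have "integrable lebesgue (\<lambda>t. indicator T t *\<^sub>R (cmod (f t))^2)"
    using L2_integrable[OF assms(1)] assms by (simp add: integrable_restrict_space)
  then have "integrable lebesgue (\<lambda>t. indicator S t *\<^sub>R (indicator T t *\<^sub>R (cmod (f t))^2))"
    by (rule integrable_mult_indicator[rotated]) (use assms(3) in simp)
  also have "(\<lambda>t. indicator S t *\<^sub>R (indicator T t *\<^sub>R (cmod (f t))^2)) = (\<lambda>t. indicator S t *\<^sub>R (cmod (f t))^2)"
    using assms(2) by (auto simp: indicator_def fun_eq_iff)
  finally show "integrable (lebesgue_on S) (\<lambda>t. (cmod (f t))^2)"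
    using assms by (simp add: integrable_restrict_space)
qed

lemma L2norm_sq_Un:
  assumes "f \<in> L2 (A \<union> B)" "A \<inter> B = {}" "A \<in> sets lebesgue" "B \<in> sets lebesgue"
  shows "(L2norm (A \<union> B) f)^2 = (L2norm A f)^2 + (L2norm B f)^2"
proof -
  have "integrable (lebesgue_on A) (\<lambda>t. (cmod (f t))^2)" "integrable (lebesgue_on B) (\<lambda>t. (cmod (f t))^2)"
    using assms by (auto intro!: L2_integrable L2_subset[OF assms(1)])
  then have i: "integrable lebesgue (\<lambda>t. indicator A t *\<^sub>R (cmod (f t))^2)"
               "integrable lebesgue (\<lambda>t. indicator B t *\<^sub>R (cmod (f t))^2)"
    using assms by (simp_all add: integrable_restrict_space)
  have "(L2norm (A \<union> B) f)^2 = (\<integral>t. indicator A t *\<^sub>R (cmod (f t))^2 + indicator B t *\<^sub>R (cmod (f t))^2 \<partial>lebesgue)"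
    unfolding L2norm_sq using assms
    by (subst integral_restrict_space) (auto simp: indicator_def intro!: Bochner_Integration.integral_cong)
  also have "\<dots> = (L2norm A f)^2 + (L2norm B f)^2"
    unfolding L2norm_sq using assms i
    by (subst Bochner_Integration.integral_add) (auto simp: integral_restrict_space)
  finally show ?thesis .
qed

subsection \<open>Completeness of \<open>L2\<close>\<close>

text \<open>Pointwise, |f| \<le> d + |f|^2/d. With d of the size of the norm of f the bound becomes
  linear in that norm, which is how it is applied to geometrically small differences.\<close>

lemma L2_integral_le:
  assumes S: "S \<in> lmeasurable" and f: "f \<in> L2 S" and d: "0 < d"
  shows "integrable (lebesgue_on S) (\<lambda>t. cmod (f t))"
    and "(\<integral>t. cmod (f t) \<partial>lebesgue_on S) \<le> d * measure lebesgue S + (L2norm S f)^2 / d"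
proof -
  interpret finite_measure "lebesgue_on S" using S by (rule finite_measure_lebesgue_on)
  have [measurable]: "f \<in> borel_measurable (lebesgue_on S)" using f by (rule L2_measurable)
  have le: "cmod (f t) \<le> d + (cmod (f t))^2 / d" for t
  proof -
    have "0 \<le> (cmod (f t) - d)^2" by simp
    then have "2 * (cmod (f t) * d) \<le> d * d + (cmod (f t))^2"
      by (simp add: power2_eq_square algebra_simps)
    moreover have "0 \<le> cmod (f t) * d" using d by simp
    ultimately have "cmod (f t) * d \<le> d * d + (cmod (f t))^2" by linarith
    then show ?thesis using d by (simp add: field_simps power2_eq_square)
  qed
  have i: "integrable (lebesgue_on S) (\<lambda>t. d + (cmod (f t))^2 / d)"
    using L2_integrable[OF f] by auto
  show I: "integrable (lebesgue_on S) (\<lambda>t. cmod (f t))"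
    using le order.trans[OF le abs_ge_self] by (intro Bochner_Integration.integrable_bound[OF i]) (auto intro!: AE_I2)
  have "(\<integral>t. cmod (f t) \<partial>lebesgue_on S) \<le> (\<integral>t. d + (cmod (f t))^2 / d \<partial>lebesgue_on S)"
    by (intro integral_mono I i le)
  also have "\<dots> = d * measure lebesgue S + (L2norm S f)^2 / d"
    using L2_integrable[OF f] S by (subst Bochner_Integration.integral_add)
      (auto simp: L2norm_sq measure_restrict_space fmeasurableD)
  finally show "(\<integral>t. cmod (f t) \<partial>lebesgue_on S) \<le> d * measure lebesgue S + (L2norm S f)^2 / d" .
qed

text \<open>Geometric decay makes the increments summable in L1, so the sequence converges almost
  everywhere; Fatou's lemma carries the norm estimate over to the limit. This rate is no restriction
  later, because the finite sections of a series can be chosen freely.\<close>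

lemma Riesz_Fischer_fast:
  fixes f :: "nat \<Rightarrow> real \<Rightarrow> complex"
  assumes S: "S \<in> lmeasurable" and f: "\<And>n. f n \<in> L2 S"
    and fast: "\<And>m n. m \<le> n \<Longrightarrow> L2norm S (\<lambda>t. f n t - f m t) \<le> (1/2)^m"
  obtains g where "g \<in> L2 S" "\<And>m. L2norm S (\<lambda>t. g t - f m t) \<le> (1/2)^m"
proof -
  let ?M = "lebesgue_on S"
  have [measurable]: "f n \<in> borel_measurable ?M" for n using f by (rule L2_measurable)
  define K where "K = measure lebesgue S + 1"
  have int: "integrable ?M (\<lambda>t. cmod (f (Suc n) t - f n t))" for n
    by (rule L2_integral_le(1)[OF S L2_diff[OF f f] zero_less_one])
  have le: "(\<integral>t. cmod (f (Suc n) t - f n t) \<partial>?M) \<le> K * (1/2)^n" for n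
  proof -
    have "(\<integral>t. cmod (f (Suc n) t - f n t) \<partial>?M) \<le> (1/2)^n * measure lebesgue S + (L2norm S (\<lambda>t. f (Suc n) t - f n t))^2 / (1/2)^n"
      by (rule L2_integral_le(2)[OF S L2_diff[OF f f]]) simp
    also have "\<dots> \<le> (1/2)^n * measure lebesgue S + ((1/2)^n)^2 / (1/2)^n"
      by (intro add_left_mono divide_right_mono power_mono fast) auto
    also have "\<dots> = K * (1/2)^n"
      by (simp add: K_def field_simps power2_eq_square)
    finally show ?thesis .
  qed
  have "(\<integral>\<^sup>+t. (\<Sum>n. ennreal (cmod (f (Suc n) t - f n t))) \<partial>?M) = (\<Sum>n. \<integral>\<^sup>+t. ennreal (cmod (f (Suc n) t - f n t)) \<partial>?M)"
    by (rule nn_integral_suminf) measurable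
  also have "\<dots> = (\<Sum>n. ennreal (\<integral>t. cmod (f (Suc n) t - f n t) \<partial>?M))"
    by (intro arg_cong[where f=suminf] ext nn_integral_eq_integral int) auto
  also have "\<dots> \<le> (\<Sum>n. ennreal (K * (1/2)^n))"
    by (intro suminf_le ennreal_leI le) auto
  also have "\<dots> < \<infinity>"
  proof -
    have "summable (\<lambda>n. K * (1/2)^n :: real)" by (intro summable_mult summable_geometric) auto
    then show ?thesis
      by (subst suminf_ennreal2) (auto simp: K_def)
  qed
  finally have "AE t in ?M. (\<Sum>n. ennreal (cmod (f (Suc n) t - f n t))) \<noteq> \<infinity>"
    by (intro nn_integral_PInf_AE) auto
  then have AE: "AE t in ?M. convergent (\<lambda>n. f n t)"
  proof eventually_elim
    case (elim t)
    then have "summable (\<lambda>n. cmod (f (Suc n) t - f n t))"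
      by (intro summable_suminf_not_top) (auto simp: top.not_eq_extremum)
    then have "summable (\<lambda>n. f (Suc n) t - f n t)" by (rule summable_norm_cancel)
    then have "convergent (\<lambda>n. \<Sum>i<n. f (Suc i) t - f i t)" by (simp only: summable_iff_convergent)
    then have "convergent (\<lambda>n. (f n t - f 0 t) + f 0 t)"
      by (intro convergent_add convergent_const) (simp only: sum_lessThan_telescope[of "\<lambda>i. f i t"])
    then show ?case by simp
  qed
  define g where "g t = lim (\<lambda>n. f n t)" for t
  have gm [measurable]: "g \<in> borel_measurable ?M" unfolding g_def by measurable
  have lim: "AE t in ?M. (\<lambda>n. f n t) \<longlonglongrightarrow> g t"
    using AE by eventually_elim (simp add: g_def convergent_LIMSEQ_iff)
  have nn: "(\<integral>\<^sup>+t. ennreal ((cmod (g t - f m t))^2) \<partial>?M) \<le> ennreal (((1/2)^m)^2)" for m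
  proof -
    have "(\<integral>\<^sup>+t. ennreal ((cmod (g t - f m t))^2) \<partial>?M) = (\<integral>\<^sup>+t. liminf (\<lambda>n. ennreal ((cmod (f n t - f m t))^2)) \<partial>?M)"
    proof (rule nn_integral_cong_AE, use lim in eventually_elim)
      case (elim t)
      then have "(\<lambda>n. ennreal ((cmod (f n t - f m t))^2)) \<longlonglongrightarrow> ennreal ((cmod (g t - f m t))^2)"
        by (intro tendsto_ennrealI tendsto_intros)
      then show ?case by (intro lim_imp_Liminf[symmetric]) auto
    qed
    also have "\<dots> \<le> liminf (\<lambda>n. \<integral>\<^sup>+t. ennreal ((cmod (f n t - f m t))^2) \<partial>?M)"
      by (rule nn_integral_liminf) measurable
    also have "\<dots> \<le> ennreal (((1/2)^m)^2)"
    proof (rule Liminf_le, simp)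
      show "\<forall>\<^sub>F n in sequentially. (\<integral>\<^sup>+t. ennreal ((cmod (f n t - f m t))^2) \<partial>?M) \<le> ennreal (((1/2)^m)^2)"
      proof (rule eventually_sequentiallyI[of m])
        fix n assume "m \<le> n"
        have "(\<integral>\<^sup>+t. ennreal ((cmod (f n t - f m t))^2) \<partial>?M) = ennreal ((L2norm S (\<lambda>t. f n t - f m t))^2)"
          unfolding L2norm_sq using L2_integrable[OF L2_diff[OF f f]] by (intro nn_integral_eq_integral) auto
        also have "\<dots> \<le> ennreal (((1/2)^m)^2)"
          using fast[OF \<open>m \<le> n\<close>] by (intro ennreal_leI power_mono) auto
        finally show "(\<integral>\<^sup>+t. ennreal ((cmod (f n t - f m t))^2) \<partial>?M) \<le> ennreal (((1/2)^m)^2)" .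
      qed
    qed
    finally show ?thesis .
  qed
  have d: "(\<lambda>t. g t - f m t) \<in> L2 S" for m
  proof (rule L2_I)
    show "integrable ?M (\<lambda>t. (cmod (g t - f m t))^2)"
      using le_less_trans[OF nn[of m]] by (intro integrableI_bounded) auto
  qed measurable
  show thesis
  proof (rule that)
    show "g \<in> L2 S" using L2_add[OF d[of 0] f[of 0]] by simp
    show "L2norm S (\<lambda>t. g t - f m t) \<le> (1/2)^m" for m
    proof -
      have "ennreal ((L2norm S (\<lambda>t. g t - f m t))^2) = (\<integral>\<^sup>+t. ennreal ((cmod (g t - f m t))^2) \<partial>?M)"
        unfolding L2norm_sq using L2_integrable[OF d] by (intro nn_integral_eq_integral[symmetric]) auto
      also note nn[of m]
      finally have "(L2norm S (\<lambda>t. g t - f m t))^2 \<le> ((1/2)^m)^2" by (subst (asm) ennreal_le_iff) auto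
      then show ?thesis by (rule power2_le_imp_le) simp
    qed
  qed
qed

subsection \<open>Exponentials of period one\<close>

definition e1 :: "real \<Rightarrow> complex" where
  "e1 x = cis (2 * pi * x)"

lemma e1_add: "e1 (x + y) = e1 x * e1 y"
  by (simp add: e1_def cis_mult algebra_simps)

lemma e1_0 [simp]: "e1 0 = 1"
  by (simp add: e1_def)

lemma norm_e1 [simp]: "cmod (e1 x) = 1"
  by (simp add: e1_def)

lemma e1_eq_1_iff: "e1 x = 1 \<longleftrightarrow> x \<in> \<int>"
proof
  assume "e1 x = 1"
  then have "cos (2 * pi * x) = 1" by (simp add: e1_def complex_eq_iff)
  then obtain n :: int where "2 * pi * x = of_int n * 2 * pi" by (auto simp: cos_one_2pi_int)
  then have "x = of_int n" by simp
  then show "x \<in> \<int>" by simp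
next
  assume "x \<in> \<int>"
  then show "e1 x = 1" by (simp add: e1_def cis_multiple_2pi)
qed

lemma e1_Ints [simp]: "x \<in> \<int> \<Longrightarrow> e1 x = 1"
  by (simp add: e1_eq_1_iff)

lemma e1_minus: "e1 (- x) = cnj (e1 x)"
  by (simp add: e1_def cis_cnj)

lemma e1_diff: "e1 (x - y) = e1 x * cnj (e1 y)"
  using e1_add[of x "-y"] by (simp add: e1_minus)

lemma e1_power: "e1 x ^ n = e1 (of_nat n * x)"
  by (induction n) (auto simp: e1_add distrib_right)

lemma e1_add_Ints: "y \<in> \<int> \<Longrightarrow> e1 (x + y) = e1 x"
  by (simp add: e1_add)

lemma continuous_on_e1 [continuous_intros]: "continuous_on A f \<Longrightarrow> continuous_on A (\<lambda>x. e1 (f x))"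
  unfolding e1_def by (intro continuous_intros)

lemma borel_measurable_e1 [measurable]: "e1 \<in> borel_measurable borel"
  by (intro borel_measurable_continuous_onI continuous_intros)

subsection \<open>Integration over a period\<close>

lemma borel_measurable_lebesgue_on:
  "f \<in> borel_measurable borel \<Longrightarrow> f \<in> borel_measurable (lebesgue_on S)"
  by (intro measurable_restrict_space1 measurable_completion) simp

lemma integral_lebesgue_on_borel:
  fixes f :: "real \<Rightarrow> 'b::{banach, second_countable_topology}"
  assumes "S \<in> sets borel" "f \<in> borel_measurable borel"
  shows "integral\<^sup>L (lebesgue_on S) f = (\<integral>x. indicator S x *\<^sub>R f x \<partial>lborel)"
  using assms by (subst integral_restrict_space) (auto intro!: integral_completion)

lemma integrable_bounded_borel:
  fixes f :: "real \<Rightarrow> 'b::{banach, second_countable_topology}"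
  assumes "f \<in> borel_measurable borel" "\<And>x. norm (f x) \<le> B"
  shows "integrable lborel (\<lambda>x. indicator {a..<b} x *\<^sub>R f x)"
proof (rule integrableI_bounded_set_indicator[where B=B])
  show "emeasure lborel {a..<b} < \<infinity>" by (cases "a \<le> b") auto
qed (use assms in auto)

lemma lmeasurable_Ico [simp]: "{a..<b::real} \<in> lmeasurable"
  by (rule bounded_set_imp_lmeasurable) auto

lemma measure_lebesgue_on_unit [simp]: "measure (lebesgue_on {0..<1::real}) {0..<1} = 1"
  by (subst measure_restrict_space) auto

lemma integrable_lebesgue_on_bounded:
  fixes f :: "real \<Rightarrow> 'b::{banach, second_countable_topology}"
  assumes "f \<in> borel_measurable borel" "\<And>x. norm (f x) \<le> B"
  shows "integrable (lebesgue_on {0..<1}) f"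
proof -
  interpret finite_measure "lebesgue_on {0..<1::real}" by (rule finite_measure_lebesgue_on[OF lmeasurable_Ico])
  show ?thesis using assms by (intro integrable_const_bound[where B=B] AE_I2 borel_measurable_lebesgue_on)
qed

text \<open>The substitution x = y/N spreads the circle over [0, N), which is cut into unit pieces.
  In this way the energy on the circle becomes an integral over y of the values at the
  \<open>N\<close> preimages of y.\<close>

lemma integral_unfold:
  fixes f :: "real \<Rightarrow> real"
  assumes [measurable]: "f \<in> borel_measurable borel" and B: "\<And>x. \<bar>f x\<bar> \<le> B" and N: "N > 0"
  shows "(\<integral>x. f x \<partial>lebesgue_on {0..<1}) = (1/real N) * (\<integral>y. (\<Sum>j<N. f ((y + real j)/real N)) \<partial>lebesgue_on {0..<1})"
proof -
  have "(\<integral>x. f x \<partial>lebesgue_on {0..<1}) = (\<integral>x. indicator {0..<1} x * f x \<partial>lborel)"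
    by (subst integral_lebesgue_on_borel) auto
  also have "\<dots> = (1/real N) * (\<integral>y. indicator {0..<1} (y/real N) * f (y/real N) \<partial>lborel)"
    using N by (subst lborel_integral_real_affine[where c="1/real N" and t=0]) auto
  also have "(\<integral>y. indicator {0..<1} (y/real N) * f (y/real N) \<partial>lborel) =
     (\<integral>y. (\<Sum>j<N. indicator {real j..<real j + 1} y * f (y/real N)) \<partial>lborel)"
  proof (rule Bochner_Integration.integral_cong)
    fix y :: real
    have "(\<Sum>j<N. indicator {real j..<real j + 1} y :: real) = indicator {0..<1} (y/real N)"
    proof (cases "0 \<le> y \<and> y < real N")
      case True
      have "indicator {real j..<real j + 1} y = (if j = nat \<lfloor>y\<rfloor> then 1 else 0 :: real)" for j
        using True by (auto simp: indicator_def nat_eq_iff floor_eq_iff le_floor_iff) linarith+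
      moreover have "nat \<lfloor>y\<rfloor> < N" using True by linarith
      ultimately show ?thesis using True N by (simp add: sum.delta)
    next
      case False
      have "indicator {real j..<real j + 1} y = (0::real)" if "j < N" for j
        using False that by (auto simp: indicator_def)
      then have "(\<Sum>j<N. indicator {real j..<real j + 1} y :: real) = 0" by (intro sum.neutral) auto
      then show ?thesis using False N by (auto simp: indicator_def field_simps)
    qed
    then show "indicator {0..<1} (y/real N) * f (y/real N) = (\<Sum>j<N. indicator {real j..<real j + 1} y * f (y/real N))"
      by (simp flip: sum_distrib_right)
  qed simp
  also have "\<dots> = (\<Sum>j<N. \<integral>y. indicator {real j..<real j + 1} y * f (y/real N) \<partial>lborel)"
    using integrable_bounded_borel[of "\<lambda>y. f (y/real N)" B] B
    by (intro Bochner_Integration.integral_sum) auto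
  also have "\<dots> = (\<Sum>j<N. \<integral>y. indicator {0..<1} y * f ((y + real j)/real N) \<partial>lborel)"
  proof (rule sum.cong[OF refl])
    fix j
    show "(\<integral>y. indicator {real j..<real j + 1} y * f (y/real N) \<partial>lborel) = (\<integral>y. indicator {0..<1} y * f ((y + real j)/real N) \<partial>lborel)"
      by (subst lborel_integral_real_affine[where c=1 and t="real j"])
         (auto intro!: Bochner_Integration.integral_cong simp: indicator_def add_ac)
  qed
  also have "\<dots> = (\<Sum>j<N. \<integral>y. f ((y + real j)/real N) \<partial>lebesgue_on {0..<1})"
    by (intro sum.cong refl, subst integral_lebesgue_on_borel) auto
  also have "\<dots> = (\<integral>y. (\<Sum>j<N. f ((y + real j)/real N)) \<partial>lebesgue_on {0..<1})"
    using B by (intro Bochner_Integration.integral_sum[symmetric] integrable_lebesgue_on_bounded[where B=B]) auto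
  finally show ?thesis .
qed

text \<open>Only the fractional part r of \<open>s\<close> matters; the piece of the shifted window
  beyond 1 wraps around to [0, r).\<close>

lemma integral_periodic_shift:
  fixes f :: "real \<Rightarrow> real"
  assumes [measurable]: "f \<in> borel_measurable borel" and B: "\<And>x. \<bar>f x\<bar> \<le> B" and per: "\<And>x. f (x + 1) = f x"
  shows "(\<integral>x. f (x + s) \<partial>lebesgue_on {0..<1}) = (\<integral>x. f x \<partial>lebesgue_on {0..<1})"
proof -
  have pern: "f (x + real n) = f x" for x n
  proof (induction n)
    case (Suc n)
    then show ?case using per[of "x + real n"] by (simp add: add_ac)
  qed simp
  have peri: "f (x + of_int k) = f x" for x k
  proof (cases k)
    case (nonneg n) then show ?thesis by (simp add: pern)
  next
    case (neg n)
    then show ?thesis using pern[of "x + of_int k" "Suc n"] by simp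
  qed
  define r where "r = frac s"
  have r: "0 \<le> r" "r < 1" by (auto simp: r_def frac_lt_1)
  have "f (x + s) = f (x + r)" for x
    using peri[of "x + r" "\<lfloor>s\<rfloor>"] by (simp add: r_def frac_def algebra_simps)
  then have "(\<integral>x. f (x + s) \<partial>lebesgue_on {0..<1}) = (\<integral>x. indicator {0..<1} x * f (x + r) \<partial>lborel)"
    by (subst integral_lebesgue_on_borel) auto
  also have "\<dots> = (\<integral>x. indicator {r..<1 + r} x * f x \<partial>lborel)"
    by (subst lborel_integral_real_affine[where c=1 and t="-r"])
       (auto intro!: Bochner_Integration.integral_cong simp: indicator_def)
  also have "\<dots> = (\<integral>x. indicator {r..<1} x * f x + indicator {1..<1 + r} x * f x \<partial>lborel)"
    using r by (intro Bochner_Integration.integral_cong) (auto simp: indicator_def)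
  also have "\<dots> = (\<integral>x. indicator {r..<1} x * f x \<partial>lborel) + (\<integral>x. indicator {1..<1 + r} x * f x \<partial>lborel)"
    using integrable_bounded_borel[of f B] B by (intro Bochner_Integration.integral_add) auto
  also have "(\<integral>x. indicator {1..<1 + r} x * f x \<partial>lborel) = (\<integral>x. indicator {0..<r} x * f x \<partial>lborel)"
    using per by (subst lborel_integral_real_affine[where c=1 and t="1"])
       (auto intro!: Bochner_Integration.integral_cong simp: indicator_def add_ac)
  also have "(\<integral>x. indicator {r..<1} x * f x \<partial>lborel) + (\<integral>x. indicator {0..<r} x * f x \<partial>lborel) =
     (\<integral>x. indicator {r..<1} x * f x + indicator {0..<r} x * f x \<partial>lborel)"
    using integrable_bounded_borel[of f B] B by (intro Bochner_Integration.integral_add[symmetric]) auto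
  also have "\<dots> = (\<integral>x. indicator {0..<1} x * f x \<partial>lborel)"
    using r by (intro Bochner_Integration.integral_cong) (auto simp: indicator_def)
  also have "\<dots> = (\<integral>x. f x \<partial>lebesgue_on {0..<1})"
    by (subst integral_lebesgue_on_borel) auto
  finally show ?thesis .
qed

lemma integral_e1:
  assumes "k \<noteq> 0" "0 \<le> p"
  shows "(\<integral>x. e1 (k * x) \<partial>lebesgue_on {0..<p}) = (e1 (k * p) - 1) / (2 * pi * k * \<i>)"
proof -
  let ?F = "\<lambda>x. e1 (k * x) / (2 * pi * k * \<i>)"
  have "(\<integral>x. e1 (k * x) \<partial>lebesgue_on {0..<p}) = (\<integral>x. indicator {0..<p} x *\<^sub>R e1 (k * x) \<partial>lborel)"
    by (rule integral_lebesgue_on_borel) auto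
  also have "\<dots> = (\<integral>x. indicator {0..p} x *\<^sub>R e1 (k * x) \<partial>lborel)"
    using AE_lborel_singleton[of p] by (intro integral_cong_AE) (auto simp: indicator_def)
  also have "\<dots> = ?F p - ?F 0"
  proof (rule integral_FTC_atLeastAtMost)
    show "(?F has_vector_derivative e1 (k * x)) (at x within {0..p})" for x
    proof -
      have "((\<lambda>x. exp (\<i> * (2 * pi * k) * of_real x) / (2 * pi * k * \<i>)) has_vector_derivative
         exp (\<i> * (2 * pi * k) * of_real x)) (at x within {0..p})"
        by (rule has_vector_derivative_real_field) (use assms in \<open>auto intro!: derivative_eq_intros\<close>)
      then show ?thesis by (simp add: e1_def cis_conv_exp mult_ac)
    qed
  qed (use assms in \<open>auto intro!: continuous_intros\<close>)
  finally show ?thesis by (simp add: diff_divide_distrib)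
qed

lemma integral_e1_period:
  "(\<integral>x. e1 (of_int k * x) \<partial>lebesgue_on {0..<1}) = (if k = 0 then 1 else 0)"
proof (cases "k = 0")
  case False
  then show ?thesis using integral_e1[of "of_int k" 1] by simp
qed simp

subsection \<open>Trigonometric polynomials\<close>

definition trig_poly :: "int set \<Rightarrow> (int \<Rightarrow> complex) \<Rightarrow> real \<Rightarrow> complex" where
  "trig_poly F a x = (\<Sum>n\<in>F. a n * e1 (of_int n * x))"

lemma trig_poly_measurable [measurable]: "trig_poly F a \<in> borel_measurable borel"
  unfolding trig_poly_def by measurable

lemma norm_trig_poly_le: "cmod (trig_poly F a x) \<le> (\<Sum>n\<in>F. cmod (a n))"
  unfolding trig_poly_def by (rule order.trans[OF norm_sum]) (simp add: norm_mult)

lemma trig_poly_L2: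
  assumes "S \<in> lmeasurable" shows "trig_poly F a \<in> L2 S"
  using assms by (rule L2_bounded) (auto intro: borel_measurable_lebesgue_on norm_trig_poly_le)

lemma trig_poly_periodic: "trig_poly F a (x + 1) = trig_poly F a x"
  by (simp add: trig_poly_def distrib_left e1_add)

lemma L2norm_trig_poly:
  assumes "finite F"
  shows "(L2norm {0..<1} (trig_poly F a))^2 = (\<Sum>n\<in>F. (cmod (a n))^2)"
proof -
  let ?U = "lebesgue_on {0..<1::real}"
  have int: "integrable ?U (\<lambda>x. a n * cnj (a m) * e1 (of_int (n - m) * x))" for n m
    by (intro integrable_mult_right integrable_lebesgue_on_bounded[where B=1]) auto
  have "complex_of_real ((L2norm {0..<1} (trig_poly F a))^2) = (\<integral>x. complex_of_real ((cmod (trig_poly F a x))^2) \<partial>?U)"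
    unfolding L2norm_sq by (rule integral_complex_of_real[symmetric])
  also have "\<dots> = (\<integral>x. (\<Sum>n\<in>F. \<Sum>m\<in>F. a n * cnj (a m) * e1 (of_int (n - m) * x)) \<partial>?U)"
    unfolding complex_norm_square trig_poly_def cnj_sum sum_product of_int_diff left_diff_distrib e1_diff
    by (intro Bochner_Integration.integral_cong refl sum.cong) (simp only: complex_cnj_mult mult_ac)
  also have "\<dots> = (\<Sum>n\<in>F. \<Sum>m\<in>F. a n * cnj (a m) * (\<integral>x. e1 (of_int (n - m) * x) \<partial>?U))"
    using int by (simp add: Bochner_Integration.integral_sum Bochner_Integration.integrable_sum)
  also have "\<dots> = (\<Sum>n\<in>F. \<Sum>m\<in>F. if n = m then a n * cnj (a m) else 0)"
    by (intro sum.cong refl) (auto simp only: integral_e1_period, auto)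
  also have "\<dots> = (\<Sum>n\<in>F. a n * cnj (a n))"
    using assms by (simp add: sum.delta)
  also have "\<dots> = complex_of_real (\<Sum>n\<in>F. (cmod (a n))^2)"
    by (simp add: complex_norm_square flip: of_real_power)
  finally show ?thesis using of_real_eq_iff by blast
qed

text \<open>Expand the squared distance from \<open>v\<close> to the polynomial with the
  coefficients \<open>c\<close> of \<open>v\<close> itself: the cross term contributes -2 and the
  norm of the polynomial +1 times the sum of |c_n|^2.\<close>

lemma Bessel_real:
  fixes v :: "real \<Rightarrow> real"
  assumes [measurable]: "v \<in> borel_measurable borel" and B: "\<And>x. \<bar>v x\<bar> \<le> B" and F: "finite F"
  shows "(\<Sum>n\<in>F. (cmod (\<integral>x. v x * e1 (- of_int n * x) \<partial>lebesgue_on {0..<1}))^2)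
    \<le> (\<integral>x. (v x)^2 \<partial>lebesgue_on {0..<1})"
proof -
  let ?U = "lebesgue_on {0..<1::real}"
  define c where "c n = (\<integral>x. v x * e1 (- of_int n * x) \<partial>?U)" for n
  have iv: "integrable ?U (\<lambda>x. v x * e1 (- of_int n * x))" for n
    using B by (intro integrable_lebesgue_on_bounded[where B=B]) (auto simp: norm_mult)
  have iv2: "integrable ?U (\<lambda>x. (v x)^2)"
    using B by (intro integrable_lebesgue_on_bounded[where B="B^2"]) (auto simp: abs_le_square_iff[symmetric] intro: order.trans[OF B abs_ge_self])
  have it: "integrable ?U (\<lambda>x. (cmod (trig_poly F c x))^2)"
    by (rule L2_integrable[OF trig_poly_L2]) simp
  have c: "cnj (c n) = (\<integral>x. v x * e1 (of_int n * x) \<partial>?U)" for n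
  proof -
    have "cnj (c n) = (\<integral>x. cnj (v x * e1 (- of_int n * x)) \<partial>?U)"
      unfolding c_def by (rule integral_bounded_linear[OF bounded_linear_cnj iv, symmetric])
    also have "\<dots> = (\<integral>x. v x * e1 (of_int n * x) \<partial>?U)"
      by (intro Bochner_Integration.integral_cong refl) (simp add: e1_minus)
    finally show ?thesis .
  qed
  have iw: "integrable ?U (\<lambda>x. v x * trig_poly F c x)"
  proof (rule integrable_lebesgue_on_bounded)
    show "cmod (v x * trig_poly F c x) \<le> B * (\<Sum>n\<in>F. cmod (c n))" for x
      unfolding norm_mult norm_of_real using B[of x] by (intro mult_mono norm_trig_poly_le) (auto intro: order.trans)
  qed auto
  have "(\<integral>x. v x * trig_poly F c x \<partial>?U) = (\<Sum>n\<in>F. c n * cnj (c n))"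
  proof -
    have i: "integrable ?U (\<lambda>x. c n * (v x * e1 (of_int n * x)))" for n
      using iv[of "-n"] by simp
    have "(\<integral>x. v x * trig_poly F c x \<partial>?U) = (\<integral>x. (\<Sum>n\<in>F. c n * (v x * e1 (of_int n * x))) \<partial>?U)"
      by (simp add: trig_poly_def sum_distrib_left mult_ac)
    also have "\<dots> = (\<Sum>n\<in>F. c n * cnj (c n))"
      unfolding c using i by (subst Bochner_Integration.integral_sum) auto
    finally show ?thesis .
  qed
  then have R: "Re (\<integral>x. v x * trig_poly F c x \<partial>?U) = (\<Sum>n\<in>F. (cmod (c n))^2)"
    by (simp flip: complex_norm_square)
  have "0 \<le> (\<integral>x. (cmod (v x - trig_poly F c x))^2 \<partial>?U)" by simp
  also have "\<dots> = (\<integral>x. ((v x)^2 - 2 * Re (v x * trig_poly F c x)) + (cmod (trig_poly F c x))^2 \<partial>?U)"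
    unfolding cmod_power2 by (intro Bochner_Integration.integral_cong refl) (simp add: power2_eq_square algebra_simps)
  also have "\<dots> = (\<integral>x. (v x)^2 \<partial>?U) - 2 * (\<integral>x. Re (v x * trig_poly F c x) \<partial>?U) + (\<integral>x. (cmod (trig_poly F c x))^2 \<partial>?U)"
  proof -
    have r: "integrable ?U (\<lambda>x. 2 * Re (v x * trig_poly F c x))"
      by (intro integrable_mult_right integrable_Re iw)
    show ?thesis
      unfolding Bochner_Integration.integral_add[OF Bochner_Integration.integrable_diff[OF iv2 r] it]
        Bochner_Integration.integral_diff[OF iv2 r] by simp
  qed
  also have "\<dots> = (\<integral>x. (v x)^2 \<partial>?U) - 2 * Re (\<integral>x. v x * trig_poly F c x \<partial>?U) + (\<integral>x. (cmod (trig_poly F c x))^2 \<partial>?U)"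
    using iw by (subst integral_Re) auto
  also have "\<dots> = (\<integral>x. (v x)^2 \<partial>?U) - (\<Sum>n\<in>F. (cmod (c n))^2)"
    unfolding R using L2norm_trig_poly[OF F, of c] by (simp add: L2norm_sq)
  finally show ?thesis by (simp add: c_def)
qed

subsection \<open>Riesz sequences on the circle and their combination\<close>

text \<open>Only a lower bound is demanded: Parseval on the whole circle supplies the matching upper
  bound with constant 1 for measurable \<open>S\<close>. Finite \<open>F\<close> suffice because
  both bounds pass to limits.\<close>

definition riesz_seq :: "real set \<Rightarrow> int set \<Rightarrow> bool" where
  "riesz_seq S L \<longleftrightarrow> (\<exists>c>0. \<forall>F a. finite F \<longrightarrow> F \<subseteq> L \<longrightarrow>
     c * (\<Sum>n\<in>F. (cmod (a n))^2) \<le> (L2norm (S \<inter> {0..<1}) (trig_poly F a))^2)"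

text \<open>The second conjunct is dual to the completeness of the frequencies \<open>L\<close> on \<open>S\<close>; in this form both
halves of the basis property are inequalities for trigonometric polynomials.\<close>

definition riesz_split :: "real set \<Rightarrow> int set \<Rightarrow> bool" where
  "riesz_split S L \<longleftrightarrow> riesz_seq S L \<and> riesz_seq (- S) (- L)"

lemma riesz_seq_I:
  "0 < c \<Longrightarrow> (\<And>F a. finite F \<Longrightarrow> F \<subseteq> L \<Longrightarrow> c * (\<Sum>n\<in>F. (cmod (a n))^2) \<le> (L2norm (S \<inter> {0..<1}) (trig_poly F a))^2) \<Longrightarrow> riesz_seq S L"
  unfolding riesz_seq_def by blast

lemma riesz_split_Compl: "riesz_split (- S) (- L) \<longleftrightarrow> riesz_split S L"
  by (auto simp: riesz_split_def)

lemma riesz_seq_empty [simp]: "riesz_seq S {}"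
  by (rule riesz_seq_I[of 1]) auto

lemma riesz_split_UNIV: "riesz_split UNIV UNIV"
  unfolding riesz_split_def by (auto intro!: riesz_seq_I[of 1] simp: L2norm_trig_poly)

lemma riesz_split_empty: "riesz_split {} {}"
  using riesz_split_UNIV riesz_split_Compl[of UNIV UNIV] by simp

lemma L2norm_sq_Int_borel:
  assumes "S \<in> sets borel" "f \<in> borel_measurable borel"
  shows "(L2norm (S \<inter> {0..<1}) f)^2 = (\<integral>x. indicator S x * (cmod (f x))^2 \<partial>lebesgue_on {0..<1})"
proof -
  have "(L2norm (S \<inter> {0..<1}) f)^2 = (\<integral>x. indicator (S \<inter> {0..<1}) x *\<^sub>R (cmod (f x))^2 \<partial>lborel)"
    unfolding L2norm_sq using assms by (intro integral_lebesgue_on_borel) auto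
  also have "\<dots> = (\<integral>x. indicator {0..<1} x *\<^sub>R (indicator S x * (cmod (f x))^2) \<partial>lborel)"
    by (intro Bochner_Integration.integral_cong) (auto simp: indicator_def)
  also have "\<dots> = (\<integral>x. indicator S x * (cmod (f x))^2 \<partial>lebesgue_on {0..<1})"
    using assms by (intro integral_lebesgue_on_borel[symmetric]) auto
  finally show ?thesis .
qed

section \<open>Triangular systems with Vandermonde blocks\<close>

text \<open>The functional is the divided difference at the nodes \<open>U\<close>. It is the last
  row of the inverse Vandermonde matrix, the only row that the triangular scheme uses.\<close>

lemma top_coefficient_functional:
  fixes U :: "complex set"
  assumes "finite U" "card U = Suc n"
  shows "\<exists>c. \<forall>m\<le>n. (\<Sum>u\<in>U. c u * u ^ m) = (if m = n then 1 else 0)"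
  using assms
proof (induction n arbitrary: U)
  case 0
  then obtain u where "U = {u}" by (auto simp: card_1_singleton_iff)
  then show ?case by (intro exI[of _ "\<lambda>_. 1"]) auto
next
  case (Suc n)
  then obtain v W where U: "U = insert v W" and v: "v \<notin> W" and W: "card W = Suc n" "finite W"
    by (metis card_Suc_eq finite_insert)
  from Suc.IH[OF W(2,1)] obtain c where c: "\<And>m. m \<le> n \<Longrightarrow> (\<Sum>u\<in>W. c u * u ^ m) = (if m = n then 1 else 0)" by blast
  \<comment> \<open>Adjoining a node v means applying the functional on W to (p(u) - p(v))/(u - v)
    for a polynomial p; the weight at v collects the terms with p(v).\<close>
  define c' where "c' u = (if u = v then - (\<Sum>w\<in>W. c w / (w - v)) else c u / (u - v))" for u
  show ?case
  proof (intro exI[of _ c'] allI impI)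
    fix m assume m: "m \<le> Suc n"
    have "(\<Sum>u\<in>U. c' u * u ^ m) = c' v * v ^ m + (\<Sum>u\<in>W. c' u * u ^ m)"
      using U v W by simp
    also have "(\<Sum>u\<in>W. c' u * u ^ m) = (\<Sum>u\<in>W. c u / (u - v) * u ^ m)"
      using v by (intro sum.cong) (auto simp: c'_def)
    also have "c' v * v ^ m + \<dots> = (\<Sum>w\<in>W. c w / (w - v) * (w ^ m - v ^ m))"
      by (simp add: c'_def sum_distrib_right right_diff_distrib sum_subtractf)
    also have "\<dots> = (\<Sum>w\<in>W. \<Sum>i<m. v ^ (m - Suc i) * (c w * w ^ i))"
    proof (rule sum.cong[OF refl])
      fix w assume "w \<in> W"
      then have "w - v \<noteq> 0" using v by auto
      then show "c w / (w - v) * (w ^ m - v ^ m) = (\<Sum>i<m. v ^ (m - Suc i) * (c w * w ^ i))"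
        unfolding power_diff_sumr2 by (simp add: sum_distrib_left mult_ac)
    qed
    also have "\<dots> = (\<Sum>i<m. v ^ (m - Suc i) * (\<Sum>w\<in>W. c w * w ^ i))"
      by (subst sum.swap) (simp add: sum_distrib_left)
    also have "\<dots> = (\<Sum>i<m. if i = n then v ^ (m - Suc i) else 0)"
      using m by (intro sum.cong refl) (auto simp: c)
    also have "\<dots> = (if m = Suc n then 1 else 0)"
      using m by (simp add: sum.delta)
    finally show "(\<Sum>u\<in>U. c' u * u ^ m) = (if m = Suc n then 1 else 0)" .
  qed
qed

lemma int_dvd_small_eq_0:
  fixes x N :: int
  assumes "N dvd x" "\<bar>x\<bar> < \<bar>N\<bar>"
  shows "x = 0"
  using dvd_imp_le_int[of x N] assms by force

lemma sign_mult_dvd: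
  fixes s x N k :: int
  assumes "s = 1 \<or> s = -1" "s * x = N * k"
  shows "N dvd x"
proof -
  have "N dvd s * x" using assms(2) by simp
  then show ?thesis using assms(1) by auto
qed

lemma inj_on_roots:
  fixes s :: int
  assumes "N > 0" "s = 1 \<or> s = -1"
  shows "inj_on (\<lambda>j. e1 (of_int s * real j / real N)) {..<N}"
proof (rule inj_onI)
  fix i j assume ij: "i \<in> {..<N}" "j \<in> {..<N}" and e: "e1 (of_int s * real i / real N) = e1 (of_int s * real j / real N)"
  have "e1 (of_int s * real i / real N - of_int s * real j / real N) = 1"
    unfolding e1_diff e by (simp flip: complex_norm_square)
  then obtain k where "of_int s * real i / real N - of_int s * real j / real N = of_int k"
    by (auto simp: e1_eq_1_iff elim: Ints_cases)
  then have "of_int (s * (int i - int j)) = (of_int (k * int N) :: real)"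
    using assms by (simp add: field_simps)
  then have "s * (int i - int j) = int N * k" by (simp only: of_int_eq_iff mult.commute)
  then have "int N dvd int i - int j" using assms(2) by (rule sign_mult_dvd[rotated])
  then have "int i - int j = 0" by (rule int_dvd_small_eq_0) (use ij in auto)
  then show "i = j" by simp
qed

text \<open>Move the unknowns with m > n to the other side. In the rows of \<open>J\<close> the
  columns 1, ..., n form, up to a unimodular factor in each row, a Vandermonde matrix with distinct
  nodes, and n rows suffice to isolate z_n. The parameters \<open>s\<close> and \<open>d\<close>
  cover the two numberings of the residue classes that are used later, one for a set and one for its
  complement.\<close>

lemma triangular_bound:
  fixes s d :: int
  assumes N: "N > 0" and s: "s = 1 \<or> s = -1" and n: "n \<in> {1..N}" and J: "J \<subseteq> {..<N}" "n \<le> card J"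
  shows "\<exists>C\<ge>0. \<forall>z. (cmod (z n))^2 \<le> C * ((\<Sum>j\<in>J. (cmod (\<Sum>m=1..N. e1 (of_int (s * int m + d) * real j / real N) * z m))^2)
     + (\<Sum>m\<in>{n<..N}. (cmod (z m))^2))"
proof -
  obtain J' where J': "J' \<subseteq> J" "card J' = n" "finite J'" using J(2) by (meson obtain_subset_with_card_n)
  define u where "u j = e1 (of_int s * real j / real N)" for j
  have inj: "inj_on u J'" unfolding u_def
    by (rule inj_on_subset[OF inj_on_roots[OF N s]]) (use J J' in auto)
  obtain k where k: "n = Suc k" using n by (cases n) auto
  have "card (u ` J') = Suc k" using inj J' k by (simp add: card_image)
  from top_coefficient_functional[OF _ this] J'(3)
  obtain c where c: "\<And>m. m \<le> k \<Longrightarrow> (\<Sum>w\<in>u ` J'. c w * w ^ m) = (if m = k then 1 else 0)" by blast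
  \<comment> \<open>The extra factor strips e1((s + d) j / N) from row j, so that column m becomes
    the power m - 1 of the node.\<close>
  define c' where "c' j = c (u j) * e1 (- (of_int (s + d) * real j / real N))" for j
  let ?e = "\<lambda>m j. e1 (of_int (s * int m + d) * real j / real N)"
  have c': "(\<Sum>j\<in>J'. c' j * ?e m j) = (if m = n then 1 else 0)" if m: "m \<in> {1..n}" for m
  proof -
    obtain i where i: "m = Suc i" using m by (cases m) auto
    have "(\<Sum>j\<in>J'. c' j * ?e m j) = (\<Sum>j\<in>J'. c (u j) * u j ^ i)"
    proof (rule sum.cong[OF refl])
      fix j
      have "e1 (- (of_int (s + d) * real j / real N)) * ?e m j = e1 (- (of_int (s + d) * real j / real N) + of_int (s * int m + d) * real j / real N)"
        by (simp only: e1_add)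
      also have "- (of_int (s + d) * real j / real N) + of_int (s * int m + d) * real j / real N = real i * (of_int s * real j / real N)"
        using N by (simp add: i field_simps)
      finally show "c' j * ?e m j = c (u j) * u j ^ i"
        by (simp add: c'_def u_def e1_power)
    qed
    also have "\<dots> = (\<Sum>w\<in>u ` J'. c w * w ^ i)" using inj by (simp add: sum.reindex)
    also have "\<dots> = (if m = n then 1 else 0)" using m i k by (subst c) auto
    finally show ?thesis .
  qed
  define D where "D = (\<Sum>j\<in>J'. cmod (c' j))"
  have D0: "0 \<le> D" by (simp add: D_def sum_nonneg)
  have fJ: "finite J" using J(1) finite_subset by blast
  \<comment> \<open>The 2 comes from splitting (P + R)^2, the N from Cauchy-Schwarz for sums of at
    most N terms, and D is the norm of the functional.\<close>
  have bound: "(cmod (z n))^2 \<le> (2 * D^2 * real N) * ((\<Sum>j\<in>J. (cmod (\<Sum>m=1..N. ?e m j * z m))^2) + (\<Sum>m\<in>{n<..N}. (cmod (z m))^2))" for z :: "nat \<Rightarrow> complex"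
  proof -
    define Y where "Y j = (\<Sum>m=1..N. ?e m j * z m)" for j
    define P where "P = (\<Sum>j\<in>J. cmod (Y j))"
    define R where "R = (\<Sum>m\<in>{n<..N}. cmod (z m))"
    have split: "{1..N} = {1..n} \<union> {n<..N}" using n by auto
    have Yd: "Y j = (\<Sum>m\<in>{1..n}. ?e m j * z m) + (\<Sum>m\<in>{n<..N}. ?e m j * z m)" for j
      unfolding Y_def split by (rule sum.union_disjoint) auto
    have "(\<Sum>j\<in>J'. c' j * (\<Sum>m\<in>{1..n}. ?e m j * z m)) = (\<Sum>m\<in>{1..n}. (\<Sum>j\<in>J'. c' j * ?e m j) * z m)"
      unfolding sum_distrib_left sum_distrib_right by (subst sum.swap) (simp add: mult_ac)
    also have "\<dots> = (\<Sum>m\<in>{1..n}. if m = n then z m else 0)"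
    proof (rule sum.cong[OF refl])
      fix m assume "m \<in> {1..n}"
      from c'[OF this] show "(\<Sum>j\<in>J'. c' j * ?e m j) * z m = (if m = n then z m else 0)" by simp
    qed
    also have "\<dots> = z n" using n by (simp add: sum.delta)
    finally have zn: "z n = (\<Sum>j\<in>J'. c' j * (Y j - (\<Sum>m\<in>{n<..N}. ?e m j * z m)))"
      by (simp add: Yd)
    have "cmod (z n) \<le> (\<Sum>j\<in>J'. cmod (c' j) * (P + R))"
    proof (subst zn, rule sum_norm_le)
      fix j assume j: "j \<in> J'"
      have "cmod (Y j) \<le> P" unfolding P_def using j J' fJ by (intro member_le_sum) auto
      moreover have "cmod (\<Sum>m\<in>{n<..N}. ?e m j * z m) \<le> R"
        unfolding R_def by (rule sum_norm_le) (simp add: norm_mult)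
      ultimately have "cmod (Y j - (\<Sum>m\<in>{n<..N}. ?e m j * z m)) \<le> P + R"
        using norm_triangle_ineq4[of "Y j" "\<Sum>m\<in>{n<..N}. ?e m j * z m"] by linarith
      then show "cmod (c' j * (Y j - (\<Sum>m\<in>{n<..N}. ?e m j * z m))) \<le> cmod (c' j) * (P + R)"
        by (simp add: norm_mult mult_left_mono)
    qed
    also have "\<dots> = D * (P + R)" by (simp add: D_def sum_distrib_right)
    finally have "(cmod (z n))^2 \<le> (D * (P + R))^2" by (intro power_mono) auto
    also have "\<dots> \<le> D^2 * (2 * (P^2 + R^2))"
    proof -
      have "0 \<le> (P - R)^2" by simp
      then have "(P + R)^2 \<le> 2 * (P^2 + R^2)" by (simp add: power2_eq_square algebra_simps)
      then show ?thesis by (simp add: power_mult_distrib mult_left_mono)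
    qed
    also have "\<dots> \<le> D^2 * (2 * (real N * (\<Sum>j\<in>J. (cmod (Y j))^2) + real N * (\<Sum>m\<in>{n<..N}. (cmod (z m))^2)))"
    proof -
      have "P^2 \<le> real (card J) * (\<Sum>j\<in>J. (cmod (Y j))^2)" unfolding P_def by (subst mult.commute) (rule sum_squared_le_sum_of_squares)
      also have "\<dots> \<le> real N * (\<Sum>j\<in>J. (cmod (Y j))^2)"
        using card_mono[OF _ J(1)] by (intro mult_right_mono sum_nonneg) auto
      finally have 1: "P^2 \<le> real N * (\<Sum>j\<in>J. (cmod (Y j))^2)" .
      have "R^2 \<le> real (card {n<..N}) * (\<Sum>m\<in>{n<..N}. (cmod (z m))^2)" unfolding R_def by (subst mult.commute) (rule sum_squared_le_sum_of_squares)
      also have "\<dots> \<le> real N * (\<Sum>m\<in>{n<..N}. (cmod (z m))^2)"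
        by (intro mult_right_mono sum_nonneg) auto
      finally have 2: "R^2 \<le> real N * (\<Sum>m\<in>{n<..N}. (cmod (z m))^2)" .
      show ?thesis using 1 2 by (intro mult_left_mono add_mono) auto
    qed
    finally show ?thesis by (simp add: Y_def algebra_simps)
  qed
  show ?thesis by (rule exI[of _ "2 * D^2 * real N"], intro conjI allI bound) simp
qed

text \<open>In the application \<open>J\<close> indexes the preimages of a point that lie in the
  set, and it varies with the point. There are only finitely many pairs of a level and a set
  \<open>J\<close>, so adding their constants gives one for all.\<close>

lemma triangular_bound_uniform:
  fixes s d :: int
  assumes N: "N > 0" and s: "s = 1 \<or> s = -1"
  shows "\<exists>C>0. \<forall>n\<in>{1..N}. \<forall>J. J \<subseteq> {..<N} \<longrightarrow> n \<le> card J \<longrightarrow> (\<forall>z. (cmod (z n))^2 \<le>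
     C * ((\<Sum>j\<in>J. (cmod (\<Sum>m=1..N. e1 (of_int (s * int m + d) * real j / real N) * z m))^2)
     + (\<Sum>m\<in>{n<..N}. (cmod (z m))^2)))"
proof -
  let ?P = "\<lambda>n J C. \<forall>z. (cmod (z n))^2 \<le> C * ((\<Sum>j\<in>J. (cmod (\<Sum>m=1..N. e1 (of_int (s * int m + d) * real j / real N) * z m))^2)
     + (\<Sum>m\<in>{n<..N}. (cmod (z m))^2))"
  define A where "A = {(n, J). n \<in> {1..N} \<and> J \<subseteq> {..<N} \<and> n \<le> card J}"
  have "A \<subseteq> {1..N} \<times> Pow {..<N}" by (auto simp: A_def)
  then have fA: "finite A" by (rule finite_subset) auto
  have "\<forall>p\<in>A. \<exists>C\<ge>0. ?P (fst p) (snd p) C"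
    using triangular_bound[OF N s] by (auto simp: A_def)
  from bchoice[OF this] obtain C where C: "\<forall>p\<in>A. 0 \<le> C p \<and> ?P (fst p) (snd p) (C p)" by blast
  have C0: "0 \<le> C p" if "p \<in> A" for p using C that by (meson bspec)
  have le: "C p \<le> 1 + sum C A" if "p \<in> A" for p
    using member_le_sum[OF that _ fA, of C] C0 by force
  have "1 + sum C A > 0" using sum_nonneg[of A C] C0 by force
  moreover have "?P n J (1 + sum C A)" if "n \<in> {1..N}" "J \<subseteq> {..<N}" "n \<le> card J" for n J
  proof
    fix z
    have p: "(n, J) \<in> A" using that by (auto simp: A_def)
    let ?X = "(\<Sum>j\<in>J. (cmod (\<Sum>m=1..N. e1 (of_int (s * int m + d) * real j / real N) * z m))^2) + (\<Sum>m\<in>{n<..N}. (cmod (z m))^2)"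
    have "(cmod (z n))^2 \<le> C (n, J) * ?X" using bspec[OF C p, THEN conjunct2, rule_format, of z] by (simp only: fst_conv snd_conv)
    also have "\<dots> \<le> (1 + sum C A) * ?X" by (intro mult_right_mono le p add_nonneg_nonneg sum_nonneg) auto
    finally show "(cmod (z n))^2 \<le> (1 + sum C A) * ?X" .
  qed
  ultimately show ?thesis by blast
qed

text \<open>A discrete Gronwall argument from the top: the largest index has an empty tail, and each
  step down multiplies the bound by 1 + K.\<close>

lemma downward_sum_bound:
  fixes A :: "nat \<Rightarrow> real"
  assumes K: "0 \<le> K" and "\<And>n. n \<in> {1..N} \<Longrightarrow> A n \<le> K * (Q + (\<Sum>m\<in>{n<..N}. A m))"
  shows "k \<le> N \<Longrightarrow> Q + (\<Sum>m\<in>{N-k<..N}. A m) \<le> (1 + K) ^ k * Q"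
proof (induction k)
  case (Suc k)
  have "{N - Suc k<..N} = insert (N - k) {N - k<..N}" using Suc.prems by auto
  then have "Q + (\<Sum>m\<in>{N - Suc k<..N}. A m) = A (N - k) + (Q + (\<Sum>m\<in>{N - k<..N}. A m))" by simp
  also have "\<dots> \<le> (1 + K) * (Q + (\<Sum>m\<in>{N - k<..N}. A m))"
    using assms(2)[of "N - k"] Suc.prems by (simp add: distrib_right)
  also have "\<dots> \<le> (1 + K) * ((1 + K) ^ k * Q)"
    using Suc K by (intro mult_left_mono) auto
  finally show ?case by (simp add: mult_ac)
qed simp

section \<open>Folding the circle and combining residue classes\<close>

text \<open>The points (y + j)/N are the preimages of y under multiplication by \<open>N\<close> on
  the circle, so the superlevel sets of this function are the sets B_n of the overview.\<close>

definition fold_mult :: "nat \<Rightarrow> real set \<Rightarrow> real \<Rightarrow> nat" where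
  "fold_mult N S y = card {j \<in> {..<N}. (y + real j) / real N \<in> S}"

lemma fold_mult_eq_sum: "real (fold_mult N S y) = (\<Sum>j<N. indicator S ((y + real j) / real N))"
  unfolding fold_mult_def by (simp add: indicator_def sum.If_cases Int_def)

lemma superlevel_borel [measurable]:
  assumes [measurable]: "S \<in> sets borel"
  shows "{y. n \<le> fold_mult N S y} \<in> sets borel"
proof -
  have "{y. n \<le> fold_mult N S y} = {y. real n \<le> (\<Sum>j<N. indicator S ((y + real j) / real N))}"
    by (simp flip: fold_mult_eq_sum)
  also have "\<dots> \<in> sets borel" by measurable
  finally show ?thesis .
qed

text \<open>Sorted by residue class, a polynomial with these frequencies is a sum of characters
  times g_n(N x). Its values at the \<open>N\<close> preimages of y form a linear system in g_1(y),
  ..., g_N(y). Over a point y of B_n at least n of the preimages lie in \<open>S\<close>, so g_n(y)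
  is controlled by values on \<open>S\<close> and by the g_m(y) with m > n. The hypothesis on B_n
  turns this local control into control of all coefficients of g_n, and that closes a recursion from
  n = N down to 1.\<close>

lemma riesz_seq_combine:
  fixes s d :: int
  assumes S [measurable]: "S \<in> sets borel" and N: "N > 0" and s: "s = 1 \<or> s = -1"
    and rs: "\<And>n. n \<in> {1..N} \<Longrightarrow> riesz_seq {y. n \<le> fold_mult N S y} (lam n)"
  shows "riesz_seq S {int N * l + (s * int n + d) | n l. n \<in> {1..N} \<and> l \<in> lam n}"
proof -
  let ?U = "lebesgue_on {0..<1::real}"
  let ?L = "{int N * l + (s * int n + d) | n l. n \<in> {1..N} \<and> l \<in> lam n}"
  define B where "B n = {y. n \<le> fold_mult N S y}" for n
  define r where "r n = s * int n + d" for n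
  define phi where "phi = (\<lambda>(n, l). int N * l + r n)"
  have [measurable]: "B n \<in> sets borel" for n unfolding B_def by measurable
  from triangular_bound_uniform[OF N s, of d, folded r_def]
  obtain C where C: "C > 0" and Cb0: "\<forall>n\<in>{1..N}. \<forall>J. J \<subseteq> {..<N} \<longrightarrow> n \<le> card J \<longrightarrow> (\<forall>z. (cmod (z n))^2 \<le>
     C * ((\<Sum>j\<in>J. (cmod (\<Sum>m=1..N. e1 (of_int (r m) * real j / real N) * z m))^2)
     + (\<Sum>m\<in>{n<..N}. (cmod (z m))^2)))" by (elim exE conjE)
  note Cb = Cb0[THEN bspec, THEN spec, THEN mp, THEN mp, THEN spec]
  let ?R = "\<lambda>n c. c > 0 \<and> (\<forall>F a. finite F \<longrightarrow> F \<subseteq> lam n \<longrightarrow>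
     c * (\<Sum>n\<in>F. (cmod (a n))^2) \<le> (L2norm (B n \<inter> {0..<1}) (trig_poly F a))^2)"
  have "\<exists>c. ?R n c" if "n \<in> {1..N}" for n
    using rs[OF that] unfolding riesz_seq_def B_def .
  then have "\<forall>n\<in>{1..N}. \<exists>c. ?R n c" ..
  from bchoice[OF this] obtain c where c0: "\<forall>n\<in>{1..N}. ?R n (c n)" by (elim exE)
  have c: "0 < c n" if "n \<in> {1..N}" for n using c0[THEN bspec, OF that] by (rule conjunct1)
  note cb = c0[THEN bspec, THEN conjunct2, THEN spec, THEN spec, THEN mp, THEN mp]
  \<comment> \<open>\<open>C\<close> is the cost of solving the system, N that of unfolding the
    integral, and 1 / c n that of passing from B_n to the coefficients.\<close>
  define K where "K = (\<Sum>n=1..N. C * real N / c n)"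
  have K: "C * real N / c n \<le> K" if "n \<in> {1..N}" for n
    unfolding K_def using that C c by (intro member_le_sum[of n "{1..N}" "\<lambda>n. C * real N / c n"]) (simp_all add: less_imp_le)
  have K0: "0 \<le> K" unfolding K_def using C c by (intro sum_nonneg) (simp add: less_imp_le)
  \<comment> \<open>The residues s n + d with 1 \<le> n \<le> N are distinct modulo N, so a
    frequency determines both its class and its quotient.\<close>
  have inj: "inj_on phi ({1..N} \<times> UNIV)"
  proof (rule inj_onI, clarify)
    fix n l n' l' assume n: "n \<in> {1..N}" "n' \<in> {1..N}" and "phi (n, l) = phi (n', l')"
    then have e: "int N * (l - l') = s * (int n' - int n)" by (simp add: phi_def r_def algebra_simps)
    then have "int N dvd int n' - int n" using s by (intro sign_mult_dvd[of s _ _ "l - l'"]) auto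
    moreover have "\<bar>int n' - int n\<bar> < \<bar>int N\<bar>" using n by auto
    ultimately have "int n' - int n = 0" by (rule int_dvd_small_eq_0)
    then have "n = n'" by simp
    moreover then have "l = l'" using e N by simp
    ultimately show "n = n' \<and> l = l'" by simp
  qed
  show ?thesis
  proof (rule riesz_seq_I[of "1 / (1 + K) ^ N"])
    show "0 < 1 / (1 + K) ^ N" using K0 by simp
  next
    fix F :: "int set" and a :: "int \<Rightarrow> complex" assume F: "finite F" "F \<subseteq> ?L"
    define G where "G n = {l \<in> lam n. phi (n, l) \<in> F}" for n
    define b where "b n l = a (phi (n, l))" for n l
    define A where "A n = (\<Sum>l\<in>G n. (cmod (b n l))^2)" for n
    define Q where "Q = (L2norm (S \<inter> {0..<1}) (trig_poly F a))^2"
    have finG: "finite (G n)" if "n \<in> {1..N}" for n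
    proof (rule finite_imageD)
      show "finite ((\<lambda>l. phi (n, l)) ` G n)" using F(1) by (rule finite_subset[rotated]) (auto simp: G_def)
      show "inj_on (\<lambda>l. phi (n, l)) (G n)"
      proof (rule inj_onI)
        fix x y assume "phi (n, x) = phi (n, y)"
        from inj_onD[OF inj this] show "x = y" using that by simp
      qed
    qed
    have img: "phi ` (SIGMA n:{1..N}. G n) = F"
    proof
      show "phi ` (SIGMA n:{1..N}. G n) \<subseteq> F" by (auto simp: G_def)
      show "F \<subseteq> phi ` (SIGMA n:{1..N}. G n)"
      proof
        fix k assume k: "k \<in> F"
        then obtain n l where nl: "k = int N * l + (s * int n + d)" "n \<in> {1..N}" "l \<in> lam n" using F(2) by blast
        then have "k = phi (n, l)" by (simp add: phi_def r_def)
        with k nl show "k \<in> phi ` (SIGMA n:{1..N}. G n)" by (intro image_eqI[of _ _ "(n, l)"]) (auto simp: G_def)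
      qed
    qed
    have reorg: "(\<Sum>k\<in>F. g k) = (\<Sum>n=1..N. \<Sum>l\<in>G n. g (phi (n, l)))" for g :: "int \<Rightarrow> 'z::comm_monoid_add"
    proof -
      have "(\<Sum>k\<in>F. g k) = (\<Sum>p\<in>(SIGMA n:{1..N}. G n). g (phi p))"
        unfolding img[symmetric] by (rule sum.reindex_cong[OF inj_on_subset[OF inj] refl refl]) auto
      also have "\<dots> = (\<Sum>n=1..N. \<Sum>l\<in>G n. g (phi (n, l)))"
        using finG by (subst sum.Sigma) (simp_all add: case_prod_beta)
      finally show ?thesis .
    qed
    \<comment> \<open>The phase does not depend on j, so it can be absorbed into the unknown; it
      leaves the modulus of g_n(y) unchanged.\<close>
    define z where "z y n = e1 (of_int (r n) * y / real N) * trig_poly (G n) (b n) y" for y n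
    have eval: "trig_poly F a ((y + real j) / real N) = (\<Sum>n=1..N. e1 (of_int (r n) * real j / real N) * z y n)" for y j
    proof -
      have "trig_poly F a ((y + real j) / real N) = (\<Sum>n=1..N. \<Sum>l\<in>G n. b n l * e1 (of_int (phi (n, l)) * ((y + real j) / real N)))"
        unfolding trig_poly_def by (subst reorg) (simp add: b_def)
      also have "\<dots> = (\<Sum>n=1..N. e1 (of_int (r n) * real j / real N) * z y n)"
      proof (rule sum.cong[OF refl])
        fix n
        have "b n l * e1 (of_int (phi (n, l)) * ((y + real j) / real N)) =
            e1 (of_int (r n) * real j / real N) * (e1 (of_int (r n) * y / real N) * (b n l * e1 (of_int l * y)))" for l
        proof -
          have "of_int (phi (n, l)) * ((y + real j) / real N) =
             of_int (r n) * real j / real N + of_int (r n) * y / real N + of_int l * y + of_int (l * int j)"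
            using N by (simp add: phi_def field_simps)
          also have "e1 \<dots> = e1 (of_int (r n) * real j / real N) * e1 (of_int (r n) * y / real N) * e1 (of_int l * y)"
            by (subst e1_add_Ints) (simp_all only: e1_add Ints_of_int)
          finally show ?thesis by (simp add: mult_ac)
        qed
        then show "(\<Sum>l\<in>G n. b n l * e1 (of_int (phi (n, l)) * ((y + real j) / real N))) = e1 (of_int (r n) * real j / real N) * z y n"
          unfolding z_def trig_poly_def sum_distrib_left by (intro sum.cong refl)
      qed
      finally show ?thesis .
    qed
    define X where "X y = (\<Sum>j<N. indicator S ((y + real j) / real N) * (cmod (trig_poly F a ((y + real j) / real N)))^2)" for y
    have tpb: "(cmod (trig_poly H h x))^2 \<le> (\<Sum>n\<in>H. cmod (h n))^2" for H h x
      by (intro power_mono norm_trig_poly_le) auto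
    have ib: "\<bar>indicator T x * (cmod (trig_poly H h x))^2\<bar> \<le> (\<Sum>n\<in>H. cmod (h n))^2" for T H h and x :: real
      using tpb[of H h x] by (auto simp: indicator_def)
    have Q: "Q = (1/real N) * (\<integral>y. X y \<partial>?U)"
      unfolding Q_def X_def L2norm_sq_Int_borel[OF S trig_poly_measurable]
      by (rule integral_unfold[OF _ ib N]) measurable
    have intX: "integrable ?U X"
      unfolding X_def
    proof (rule Bochner_Integration.integrable_sum)
      fix j
      show "integrable ?U (\<lambda>y. indicator S ((y + real j) / real N) * (cmod (trig_poly F a ((y + real j) / real N)))^2)"
        by (rule integrable_lebesgue_on_bounded[where B="(\<Sum>n\<in>F. cmod (a n))^2"], measurable) (simp only: real_norm_def ib)
    qed
    have inttp: "integrable ?U (\<lambda>y. (cmod (trig_poly H h y))^2)" for H h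
      by (rule L2_integrable[OF trig_poly_L2]) simp
    have key: "A n \<le> K * (Q + (\<Sum>m\<in>{n<..N}. A m))" if n: "n \<in> {1..N}" for n
    proof -
      have "c n * A n \<le> (L2norm (B n \<inter> {0..<1}) (trig_poly (G n) (b n)))^2"
        unfolding A_def using finG[OF n] by (intro cb n) (auto simp: G_def)
      also have "\<dots> = (\<integral>y. indicator (B n) y * (cmod (trig_poly (G n) (b n) y))^2 \<partial>?U)"
        by (rule L2norm_sq_Int_borel) auto
      also have "\<dots> \<le> (\<integral>y. C * (X y + (\<Sum>m\<in>{n<..N}. (cmod (trig_poly (G m) (b m) y))^2)) \<partial>?U)"
      proof (rule integral_mono)
        show "integrable ?U (\<lambda>y. indicator (B n) y * (cmod (trig_poly (G n) (b n) y))^2)"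
          by (rule integrable_lebesgue_on_bounded[where B="(\<Sum>l\<in>G n. cmod (b n l))^2"], measurable) (simp only: real_norm_def ib)
        show "integrable ?U (\<lambda>y. C * (X y + (\<Sum>m\<in>{n<..N}. (cmod (trig_poly (G m) (b m) y))^2)))"
          by (intro integrable_mult_right Bochner_Integration.integrable_add intX Bochner_Integration.integrable_sum inttp)
        fix y
        have X0: "0 \<le> X y" unfolding X_def by (intro sum_nonneg) auto
        show "indicator (B n) y * (cmod (trig_poly (G n) (b n) y))^2 \<le> C * (X y + (\<Sum>m\<in>{n<..N}. (cmod (trig_poly (G m) (b m) y))^2))"
        proof (cases "y \<in> B n")
          case True
          define J where "J = {j \<in> {..<N}. (y + real j) / real N \<in> S}"
          have J: "J \<subseteq> {..<N}" "n \<le> card J" using True by (auto simp: J_def B_def fold_mult_def)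
          have XJ: "X y = (\<Sum>j\<in>J. (cmod (trig_poly F a ((y + real j) / real N)))^2)"
            unfolding X_def J_def by (simp add: indicator_def sum.If_cases Int_def if_distrib[of "\<lambda>x. x * _"] cong: if_cong)
          show ?thesis using Cb[OF n J, of "z y"] True
            unfolding XJ eval by (simp add: z_def norm_mult)
        next
          case False
          then show ?thesis using X0 C by (auto intro!: mult_nonneg_nonneg add_nonneg_nonneg sum_nonneg)
        qed
      qed
      also have "\<dots> = C * ((\<integral>y. X y \<partial>?U) + (\<Sum>m\<in>{n<..N}. \<integral>y. (cmod (trig_poly (G m) (b m) y))^2 \<partial>?U))"
        using intX inttp by (simp add: Bochner_Integration.integral_add Bochner_Integration.integrable_sum Bochner_Integration.integral_sum)
      \<comment> \<open>The tail terms were integrated over the whole circle and not only over B_n,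
        so that Parseval evaluates them.\<close>
      also have "(\<Sum>m\<in>{n<..N}. \<integral>y. (cmod (trig_poly (G m) (b m) y))^2 \<partial>?U) = (\<Sum>m\<in>{n<..N}. A m)"
        unfolding A_def using finG by (intro sum.cong refl) (simp flip: L2norm_sq add: L2norm_trig_poly)
      also have "(\<integral>y. X y \<partial>?U) = real N * Q" using N by (simp add: Q)
      also have "C * (real N * Q + (\<Sum>m\<in>{n<..N}. A m)) \<le> C * (real N * (Q + (\<Sum>m\<in>{n<..N}. A m)))"
      proof -
        have "1 * (\<Sum>m\<in>{n<..N}. A m) \<le> real N * (\<Sum>m\<in>{n<..N}. A m)"
          using N by (intro mult_right_mono sum_nonneg) (auto simp: A_def intro: sum_nonneg)
        then show ?thesis using C by (simp add: distrib_left)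
      qed
      finally have "A n \<le> (C * real N / c n) * (Q + (\<Sum>m\<in>{n<..N}. A m))"
        using c[OF n] by (simp add: field_simps)
      also have "\<dots> \<le> K * (Q + (\<Sum>m\<in>{n<..N}. A m))"
        by (intro mult_right_mono K n add_nonneg_nonneg sum_nonneg) (auto simp: Q_def A_def intro: sum_nonneg)
      finally show ?thesis .
    qed
    have "(\<Sum>n\<in>F. (cmod (a n))^2) = (\<Sum>n=1..N. A n)" unfolding A_def b_def by (rule reorg)
    also have "\<dots> = (\<Sum>n\<in>{N-N<..N}. A n)" by (rule sum.cong) auto
    also have "\<dots> \<le> Q + (\<Sum>n\<in>{N-N<..N}. A n)" by (simp add: Q_def)
    also have "\<dots> \<le> (1 + K) ^ N * Q" by (rule downward_sum_bound[OF K0 key]) auto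
    finally show "1 / (1 + K) ^ N * (\<Sum>n\<in>F. (cmod (a n))^2) \<le> (L2norm (S \<inter> {0..<1}) (trig_poly F a))^2"
      using K0 unfolding Q_def by (simp add: field_simps)
  qed
qed

lemma fold_mult_Compl: "fold_mult N (- S) y = N - fold_mult N S y"
proof -
  have "{j \<in> {..<N}. (y + real j) / real N \<in> - S} = {..<N} - {j \<in> {..<N}. (y + real j) / real N \<in> S}" by auto
  then show ?thesis unfolding fold_mult_def by (simp only:) (subst card_Diff_subset, auto)
qed

lemma fold_mult_le: "fold_mult N S y \<le> N"
  unfolding fold_mult_def using card_mono[of "{..<N}" "{j \<in> {..<N}. (y + real j) / real N \<in> S}"] by auto

text \<open>Complementing \<open>S\<close> reverses the order of the superlevel sets, hence of the residue classes.\<close>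

lemma riesz_split_combine:
  assumes S: "S \<in> sets borel" and N: "N > 0"
    and rb: "\<And>n. n \<in> {1..N} \<Longrightarrow> \<exists>L. riesz_split {y. n \<le> fold_mult N S y} L"
  shows "\<exists>L. riesz_split S L"
proof -
  obtain lam where lam: "\<And>n. n \<in> {1..N} \<Longrightarrow> riesz_split {y. n \<le> fold_mult N S y} (lam n)" using rb by metis
  let ?L = "{int N * l + (1 * int n + 0) | n l. n \<in> {1..N} \<and> l \<in> lam n}"
  \<comment> \<open>Level n of the complement is the complement of level N + 1 - n, so its
    frequencies belong to the class -n + (N + 1).\<close>
  let ?lam' = "\<lambda>n. - lam (N + 1 - n)"
  let ?L' = "{int N * l + (- 1 * int n + (int N + 1)) | n l. n \<in> {1..N} \<and> l \<in> ?lam' n}"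
  have 1: "riesz_seq S ?L"
    by (rule riesz_seq_combine[OF S N]) (use lam in \<open>auto simp: riesz_split_def\<close>)
  have 2: "riesz_seq (- S) ?L'"
  proof (rule riesz_seq_combine[OF _ N])
    fix n assume n: "n \<in> {1..N}"
    have "{y. n \<le> fold_mult N (- S) y} = - {y. N + 1 - n \<le> fold_mult N S y}"
      using n fold_mult_le[of N S] by (auto simp: fold_mult_Compl)
    moreover have "N + 1 - n \<in> {1..N}" using n by auto
    ultimately show "riesz_seq {y. n \<le> fold_mult N (- S) y} (?lam' n)"
      using lam[of "N + 1 - n"] unfolding riesz_split_def by metis
  qed (use S in auto)
  have "?L' = - ?L"
  proof (rule set_eqI)
    fix k :: int
    \<comment> \<open>Subtracting 1 before the division yields representatives 1, ..., N instead of
      0, ..., N - 1.\<close>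
    define n l where "n = nat ((k - 1) mod int N) + 1" and "l = (k - 1) div int N"
    have m: "0 \<le> (k - 1) mod int N" "(k - 1) mod int N < int N" using N by auto
    have nl: "n \<in> {1..N}" "k = int N * l + int n"
      using m by (auto simp: n_def l_def nat_less_iff Suc_le_eq)
    have uq: "n' = n \<and> l' = l" if "n' \<in> {1..N}" "k = int N * l' + int n'" for n' l'
    proof -
      have "k - 1 = int N * l' + (int n' - 1)" "0 \<le> int n' - 1" "int n' - 1 < int N" using that by auto
      then have "l = l'" "(k - 1) mod int N = int n' - 1"
        unfolding l_def by (rule int_div_pos_eq, rule int_mod_pos_eq)
      then show ?thesis using that(1) by (auto simp: n_def nat_diff_distrib)
    qed
    have "k \<in> ?L \<longleftrightarrow> l \<in> lam n"
    proof
      assume "k \<in> ?L"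
      then obtain n' l' where n': "k = int N * l' + (1 * int n' + 0)" "n' \<in> {1..N}" "l' \<in> lam n'" by blast
      then have "n' = n \<and> l' = l" by (intro uq) simp_all
      then show "l \<in> lam n" using n' by simp
    next
      assume "l \<in> lam n"
      moreover have "k = int N * l + (1 * int n + 0)" using nl by simp
      ultimately show "k \<in> ?L" using nl(1) by blast
    qed
    moreover have "k \<in> ?L' \<longleftrightarrow> l \<notin> lam n"
    proof
      assume "k \<in> ?L'"
      then obtain n' l' where n': "k = int N * l' + (- 1 * int n' + (int N + 1))" "n' \<in> {1..N}" "l' \<notin> lam (N + 1 - n')" by blast
      have "N + 1 - n' = n \<and> l' = l"
      proof (rule uq)
        show "N + 1 - n' \<in> {1..N}" using n'(2) by auto
        show "k = int N * l' + int (N + 1 - n')" using n'(1,2) by (simp add: of_nat_diff)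
      qed
      then show "l \<notin> lam n" using n'(3) by metis
    next
      assume l: "l \<notin> lam n"
      have "k = int N * l + (- 1 * int (N + 1 - n) + (int N + 1))" "N + 1 - n \<in> {1..N}"
        using nl by (auto simp: of_nat_diff)
      moreover have "l \<in> ?lam' (N + 1 - n)" using l nl(1) by simp
      ultimately show "k \<in> ?L'" by blast
    qed
    ultimately show "k \<in> ?L' \<longleftrightarrow> k \<in> - ?L" by blast
  qed
  with 1 2 have "riesz_split S ?L" unfolding riesz_split_def by simp
  then show ?thesis by (rule exI)
qed

subsection \<open>Integer-valued periodic step functions\<close>

text \<open>\<open>\<epsilon> p\<close> is the height of the jump at p and at its integer
  translates. If the heights add to 0, the linear growth of the floors cancels and the function has
  period 1. Floors are preferred to indicators of arcs because Hermite's identity describes how they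
  fold.\<close>

definition stepf :: "int \<Rightarrow> real set \<Rightarrow> (real \<Rightarrow> int) \<Rightarrow> real \<Rightarrow> int" where
  "stepf c Y \<epsilon> y = c + (\<Sum>p\<in>Y. \<epsilon> p * \<lfloor>y - p\<rfloor>)"

lemma stepf_add_int:
  assumes "sum \<epsilon> Y = 0"
  shows "stepf c Y \<epsilon> (y + of_int k) = stepf c Y \<epsilon> y"
proof -
  have "\<lfloor>y + of_int k - p\<rfloor> = \<lfloor>y - p\<rfloor> + k" for p
    using floor_add_int[of "y - p" k] by (simp add: algebra_simps)
  then have "stepf c Y \<epsilon> (y + of_int k) = stepf c Y \<epsilon> y + sum \<epsilon> Y * k"
    by (simp add: stepf_def distrib_left sum.distrib sum_distrib_right)
  then show ?thesis using assms by simp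
qed

lemma stepf_frac:
  assumes "sum \<epsilon> Y = 0"
  shows "stepf c Y \<epsilon> (frac y) = stepf c Y \<epsilon> y"
  using stepf_add_int[OF assms, of c y "- \<lfloor>y\<rfloor>"] by (simp add: frac_def)

lemma stepf_measurable [measurable]: "(\<lambda>y. real_of_int (stepf c Y \<epsilon> y)) \<in> borel_measurable borel"
  unfolding stepf_def of_int_add of_int_sum of_int_mult by measurable

lemma eventually_floor_right: "eventually (\<lambda>z. \<lfloor>z - p\<rfloor> = \<lfloor>y - p\<rfloor>) (at_right (y::real))"
proof -
  have "eventually (\<lambda>z. z \<in> {y<..<y + (1 - frac (y - p))}) (at_right y)"
    by (rule eventually_at_right_real) (simp add: frac_lt_1)
  then show ?thesis
  proof eventually_elim
    case (elim z)
    then show ?case unfolding floor_eq_iff by (auto simp: frac_def) linarith+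
  qed
qed

lemma eventually_floor_left:
  "eventually (\<lambda>z. \<lfloor>z - p\<rfloor> = \<lfloor>y - p\<rfloor> - (if y - p \<in> \<int> then 1 else 0)) (at_left (y::real))"
proof -
  define d where "d = (if y - p \<in> \<int> then 1 else frac (y - p))"
  have d: "d > 0" by (auto simp: d_def)
  have "eventually (\<lambda>z. z \<in> {y - d<..<y}) (at_left y)"
    by (rule eventually_at_left_real) (use d in simp)
  then show ?thesis
  proof eventually_elim
    case (elim z)
    show ?case
    proof (cases "y - p \<in> \<int>")
      case True
      then have "of_int \<lfloor>y - p\<rfloor> = y - p" by (auto elim!: Ints_cases)
      with True elim show ?thesis unfolding floor_eq_iff by (auto simp: d_def)
    next
      case False
      with elim show ?thesis unfolding floor_eq_iff by (auto simp: d_def frac_def) linarith+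
    qed
  qed
qed

lemma frac_eq_iff_diff_Ints:
  assumes "0 \<le> p" "p < 1"
  shows "y - p \<in> \<int> \<longleftrightarrow> p = frac (y::real)"
proof
  assume "y - p \<in> \<int>"
  then show "p = frac y" using assms frac_unique_iff[of y p] by auto
qed (auto simp: frac_def)

lemma stepf_right:
  assumes "finite Y"
  shows "eventually (\<lambda>z. stepf c Y \<epsilon> z = stepf c Y \<epsilon> y) (at_right y)"
proof -
  have "eventually (\<lambda>z. \<forall>p\<in>Y. \<lfloor>z - p\<rfloor> = \<lfloor>y - p\<rfloor>) (at_right y)"
    using assms by (intro eventually_ball_finite) (auto intro: eventually_floor_right)
  then show ?thesis by eventually_elim (simp add: stepf_def)
qed

lemma stepf_left:
  assumes "finite Y" "Y \<subseteq> {0..<1}"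
  shows "eventually (\<lambda>z. stepf c Y \<epsilon> z = stepf c Y \<epsilon> y - (if frac y \<in> Y then \<epsilon> (frac y) else 0)) (at_left y)"
proof -
  have "eventually (\<lambda>z. \<forall>p\<in>Y. \<lfloor>z - p\<rfloor> = \<lfloor>y - p\<rfloor> - (if y - p \<in> \<int> then 1 else 0)) (at_left y)"
    using assms by (intro eventually_ball_finite ballI eventually_floor_left)
  then show ?thesis
  proof eventually_elim
    case (elim z)
    have "(\<Sum>p\<in>Y. \<epsilon> p * \<lfloor>z - p\<rfloor>) = (\<Sum>p\<in>Y. \<epsilon> p * \<lfloor>y - p\<rfloor> - (if frac y = p then \<epsilon> p else 0))"
    proof (rule sum.cong[OF refl])
      fix p assume p: "p \<in> Y"
      then have "y - p \<in> \<int> \<longleftrightarrow> p = frac y" using assms by (intro frac_eq_iff_diff_Ints) auto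
      then show "\<epsilon> p * \<lfloor>z - p\<rfloor> = \<epsilon> p * \<lfloor>y - p\<rfloor> - (if frac y = p then \<epsilon> p else 0)"
        using elim p by (auto simp: right_diff_distrib)
    qed
    also have "\<dots> = (\<Sum>p\<in>Y. \<epsilon> p * \<lfloor>y - p\<rfloor>) - (if frac y \<in> Y then \<epsilon> (frac y) else 0)"
      using assms by (simp add: sum_subtractf sum.delta)
    finally show ?case by (simp add: stepf_def)
  qed
qed

text \<open>A locally constant function on the connected line is constant; here this is read off
  from a vanishing derivative.\<close>

lemma eventually_const_imp_const:
  fixes k :: "real \<Rightarrow> int"
  assumes "\<And>y. eventually (\<lambda>z. k z = k y) (at_left y)" "\<And>y. eventually (\<lambda>z. k z = k y) (at_right y)"
  shows "k x = k y"
proof -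
  have "((\<lambda>x. real_of_int (k x)) has_real_derivative 0) (at x)" for x
  proof (rule DERIV_cong_ev[THEN iffD2, OF refl _ refl DERIV_const[of "real_of_int (k x)"]])
    have "eventually (\<lambda>z. k z = k x) (at x)"
      using assms[of x] unfolding eventually_at_split by blast
    then show "eventually (\<lambda>z. real_of_int (k z) = real_of_int (k x)) (nhds x)"
      unfolding eventually_at_filter by eventually_elim auto
  qed
  then have "real_of_int (k x) = real_of_int (k y)" by (intro DERIV_isconst_all) auto
  then show ?thesis by simp
qed

lemma stepf_left_value:
  assumes "finite Y" "Y \<subseteq> {0..<1}" "p \<in> Y"
  obtains z where "stepf c Y \<epsilon> z = stepf c Y \<epsilon> p - \<epsilon> p"
proof -
  have "frac p = p" using assms by (simp add: subset_iff frac_eq)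
  then have "eventually (\<lambda>z. stepf c Y \<epsilon> z = stepf c Y \<epsilon> p - \<epsilon> p) (at_left p)"
    using stepf_left[OF assms(1,2), of c \<epsilon> p] assms(3) by simp
  then have "\<exists>z. stepf c Y \<epsilon> z = stepf c Y \<epsilon> p - \<epsilon> p"
    by (rule eventually_happens'[OF trivial_limit_at_left_real])
  then show thesis using that by blast
qed

text \<open>Subtract from the composition the step function with the expected jumps: the rest has no
  jump and is therefore constant. The new jumps add to 0 because the composition inherits the
  period.\<close>

lemma stepf_comp:
  fixes g :: "int \<Rightarrow> int" and c :: int
  assumes Y: "finite Y" "Y \<subseteq> {0..<1}" "sum \<epsilon> Y = 0"
  defines "h \<equiv> stepf c Y \<epsilon>"
  defines "\<epsilon>' \<equiv> \<lambda>p. g (h p) - g (h p - \<epsilon> p)"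
  obtains c' where "\<And>y. g (h y) = stepf c' Y \<epsilon>' y" "sum \<epsilon>' Y = 0"
proof -
  define k where "k y = g (h y) - stepf 0 Y \<epsilon>' y" for y
  have "k x = k y" for x y
  proof (rule eventually_const_imp_const)
    fix y
    show "eventually (\<lambda>z. k z = k y) (at_right y)"
      using stepf_right[OF Y(1), of c \<epsilon> y] stepf_right[OF Y(1), of 0 \<epsilon>' y]
      unfolding k_def h_def by eventually_elim simp
    show "eventually (\<lambda>z. k z = k y) (at_left y)"
      using stepf_left[OF Y(1,2), of c \<epsilon> y] stepf_left[OF Y(1,2), of 0 \<epsilon>' y]
    proof eventually_elim
      case (elim z)
      have "h (frac y) = h y" unfolding h_def by (rule stepf_frac[OF Y(3)])
      then show ?case using elim unfolding k_def by (auto simp: h_def \<epsilon>'_def)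
    qed
  qed
  then have k: "g (h y) = stepf (k 0) Y \<epsilon>' y" for y
  proof -
    have "k y = k 0" by fact
    then show ?thesis by (simp add: k_def[of y] stepf_def)
  qed
  have "h (0 + 1) = h 0" unfolding h_def using stepf_add_int[OF Y(3), of c 0 1] by simp
  then have "stepf (k 0) Y \<epsilon>' (0 + 1) = stepf (k 0) Y \<epsilon>' 0" by (simp only: k[symmetric])
  moreover have "\<lfloor>0 + 1 - p\<rfloor> = \<lfloor>0 - p\<rfloor> + 1" for p :: real using floor_add_int[of "0 - p" 1] by (simp add: algebra_simps)
  ultimately have "sum \<epsilon>' Y = 0"
    by (simp add: stepf_def distrib_left sum.distrib)
  with k show thesis by (rule that)
qed

text \<open>\<open>n\<close> counts the chosen break points, some of which may carry jump 0, so it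
  only bounds the number of true jumps. The condition forces \<open>S\<close> to have period 1, that
  is, to be a subset of the circle.\<close>

definition step_set :: "nat \<Rightarrow> real set \<Rightarrow> bool" where
  "step_set n S \<longleftrightarrow> (\<exists>c Y \<epsilon>. finite Y \<and> Y \<subseteq> {0..<1} \<and> sum \<epsilon> Y = 0 \<and> card Y = n \<and>
     (\<forall>y. stepf c Y \<epsilon> y = (if y \<in> S then 1 else 0)))"

lemma step_set_borel:
  assumes "step_set n S"
  shows "S \<in> sets borel"
proof -
  obtain c Y \<epsilon> where "\<forall>y. stepf c Y \<epsilon> y = (if y \<in> S then 1 else 0)" using assms by (auto simp: step_set_def)
  then have "S = {y. real_of_int (stepf c Y \<epsilon> y) = 1}" by (auto split: if_splits)
  also have "\<dots> \<in> sets borel" by measurable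
  finally show ?thesis .
qed

lemma step_setI:
  assumes Y: "finite Y" "Y \<subseteq> {0..<1}" "sum \<epsilon> Y = 0"
    and h: "\<And>y. stepf c Y \<epsilon> y = (if y \<in> S then 1 else 0)"
  shows "step_set (card {p \<in> Y. \<epsilon> p \<noteq> 0}) S"
proof -
  let ?Z = "{p \<in> Y. \<epsilon> p \<noteq> 0}"
  have "sum \<epsilon> ?Z = sum \<epsilon> Y" using Y by (intro sum.mono_neutral_left) auto
  moreover have "stepf c ?Z \<epsilon> y = stepf c Y \<epsilon> y" for y
    unfolding stepf_def using Y by (intro arg_cong2[of _ _ _ _ "(+)"] refl sum.mono_neutral_left) auto
  ultimately show ?thesis
    unfolding step_set_def using Y h by (intro exI[of _ c] exI[of _ ?Z] exI[of _ \<epsilon>]) auto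
qed

text \<open>A jump survives in the superlevel set exactly if it crosses the level. The count
  therefore drops below \<open>card Y\<close> unless all jumps cross the same level.\<close>

lemma superlevel_step_set:
  fixes c :: int
  assumes Y: "finite Y" "Y \<subseteq> {0..<1}" "sum \<epsilon> Y = 0"
  defines "h \<equiv> stepf c Y \<epsilon>"
  shows "step_set (card {p \<in> Y. (n \<le> h p) \<noteq> (n \<le> h p - \<epsilon> p)}) {y. n \<le> h y}"
proof -
  let ?g = "\<lambda>v. if n \<le> v then 1 else 0 :: int"
  let ?e = "\<lambda>p. ?g (stepf c Y \<epsilon> p) - ?g (stepf c Y \<epsilon> p - \<epsilon> p)"
  obtain c' where c': "\<And>y. ?g (stepf c Y \<epsilon> y) = stepf c' Y ?e y" "sum ?e Y = 0"
    using stepf_comp[OF Y, of ?g c] by blast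
  have "step_set (card {p \<in> Y. ?e p \<noteq> 0}) {y. n \<le> h y}"
    by (rule step_setI[OF Y(1,2) c'(2), of c']) (simp only: c'(1)[symmetric] h_def mem_Collect_eq)
  moreover have "{p \<in> Y. ?e p \<noteq> 0} = {p \<in> Y. (n \<le> h p) \<noteq> (n \<le> h p - \<epsilon> p)}" by (auto simp: h_def)
  ultimately show ?thesis by simp
qed

text \<open>A unit jump that crosses level n leads from one of n - 1 and n to the other. Hence the
  indicator of all other values has no jump at all; it is constant, and it is 0 at a break
  point.\<close>

lemma two_valued_if_all_jumps:
  assumes Y: "finite Y" "Y \<subseteq> {0..<1}" "sum \<epsilon> Y = 0" and ne: "Y \<noteq> {}"
    and one: "\<And>p. p \<in> Y \<Longrightarrow> \<bar>\<epsilon> p\<bar> = 1"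
    and all: "\<And>p. p \<in> Y \<Longrightarrow> (n \<le> stepf c Y \<epsilon> p) \<noteq> (n \<le> stepf c Y \<epsilon> p - \<epsilon> p)"
  shows "stepf c Y \<epsilon> y \<in> {n - 1, n}"
proof -
  let ?h = "stepf c Y \<epsilon>"
  define g where "g v = (if v = n - 1 \<or> v = n then 0 else 1 :: int)" for v
  define e where "e p = g (?h p) - g (?h p - \<epsilon> p)" for p
  obtain c' where c': "\<And>y. g (?h y) = stepf c' Y e y"
    using stepf_comp[OF Y, of g c] unfolding e_def[abs_def] by blast
  have *: "g (?h p) = 0" "g (?h p - \<epsilon> p) = 0" if "p \<in> Y" for p
    using one[OF that] all[OF that] by (auto simp: g_def)
  then have "e p = 0" if "p \<in> Y" for p using that by (simp add: e_def)
  then have "stepf c' Y e y = c'" for y by (simp add: stepf_def sum.neutral)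
  then have k: "g (?h y) = c'" for y using c' by simp
  obtain p where "p \<in> Y" using ne by auto
  from *(1)[OF this] have "g (?h y) = 0" unfolding k .
  then show ?thesis by (auto simp: g_def split: if_splits)
qed

lemma step_set_jump_bound:
  assumes Y: "finite Y" "Y \<subseteq> {0..<1}" and h: "\<And>y. stepf c Y \<epsilon> y = (if y \<in> S then 1 else 0)" and p: "p \<in> Y"
  shows "\<bar>\<epsilon> p\<bar> \<le> 1"
proof -
  obtain z where "stepf c Y \<epsilon> z = stepf c Y \<epsilon> p - \<epsilon> p" by (rule stepf_left_value[OF Y p])
  then show ?thesis unfolding h by (auto split: if_splits)
qed

section \<open>How jumps behave under folding\<close>

text \<open>Raising M by 1 trades the term M div N for (M + N) div N and so adds 1; at M = 0 every
  term vanishes.\<close>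

lemma sum_int_div:
  assumes "N > 0"
  shows "(\<Sum>j<N. (M + int j) div int N) = M"
proof -
  have step: "(\<Sum>j<N. (M + 1 + int j) div int N) = (\<Sum>j<N. (M + int j) div int N) + 1" for M
  proof -
    have "(\<Sum>j<N. (M + 1 + int j) div int N) + M div int N = (\<Sum>j<Suc N. (M + int j) div int N)"
      unfolding sum.lessThan_Suc_shift by (simp add: add_ac)
    also have "\<dots> = (\<Sum>j<N. (M + int j) div int N) + (M div int N + 1)"
      using assms by simp
    finally show ?thesis by simp
  qed
  show ?thesis
  proof (induction M rule: int_induct[where k=0])
    case base
    have "int j div int N = 0" if "j < N" for j using that by simp
    then show ?case by (simp add: sum.neutral)
  next
    case (step1 i) then show ?case using step[of i] by simp
  next
    case (step2 i) then show ?case using step[of "i - 1"] by simp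
  qed
qed

text \<open>Hermite's identity for the floor function.\<close>

lemma sum_floor_shift:
  assumes "N > 0"
  shows "(\<Sum>j<N. \<lfloor>(y + real j) / real N - p\<rfloor>) = \<lfloor>y - real N * p\<rfloor>"
proof -
  have "\<lfloor>(y + real j) / real N - p\<rfloor> = (\<lfloor>y - real N * p\<rfloor> + int j) div int N" for j
  proof -
    have "(y + real j) / real N - p = (y - real N * p + real j) / of_int (int N)" using assms by (simp add: field_simps)
    then have "\<lfloor>(y + real j) / real N - p\<rfloor> = \<lfloor>y - real N * p + real j\<rfloor> div int N"
      by (simp only: floor_divide_real_eq_div of_nat_0_le_iff)
    also have "\<lfloor>y - real N * p + real j\<rfloor> = \<lfloor>y - real N * p\<rfloor> + int j"
      using floor_add_int[of "y - real N * p" "int j"] by simp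
    finally show ?thesis .
  qed
  then show ?thesis using sum_int_div[OF assms] by simp
qed

text \<open>Break points are reduced modulo 1, coinciding ones are merged by adding their jumps, and
  the integer parts go into the constant. Merging is what lowers the number of jumps when two of
  them differ by a rational.\<close>

lemma stepf_normalize:
  fixes \<phi> :: "'a \<Rightarrow> real" and \<epsilon> :: "'a \<Rightarrow> int"
  assumes "finite X"
  defines "\<epsilon>' \<equiv> \<lambda>p. (\<Sum>x\<in>{x\<in>X. frac (\<phi> x) = p}. \<epsilon> x)"
  shows "c + (\<Sum>x\<in>X. \<epsilon> x * \<lfloor>y - \<phi> x\<rfloor>) = stepf (c - (\<Sum>x\<in>X. \<epsilon> x * \<lfloor>\<phi> x\<rfloor>)) ((\<lambda>x. frac (\<phi> x)) ` X) \<epsilon>' y"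
    and "sum \<epsilon>' ((\<lambda>x. frac (\<phi> x)) ` X) = sum \<epsilon> X"
proof -
  show "sum \<epsilon>' ((\<lambda>x. frac (\<phi> x)) ` X) = sum \<epsilon> X"
    unfolding \<epsilon>'_def using sum.image_gen[OF assms(1), of \<epsilon> "\<lambda>x. frac (\<phi> x)"] by simp
  have fl: "\<lfloor>y - \<phi> x\<rfloor> = \<lfloor>y - frac (\<phi> x)\<rfloor> - \<lfloor>\<phi> x\<rfloor>" for x
    using floor_diff_of_int[of "y - frac (\<phi> x)" "\<lfloor>\<phi> x\<rfloor>"] by (simp add: frac_def)
  have "(\<Sum>p\<in>(\<lambda>x. frac (\<phi> x)) ` X. \<epsilon>' p * \<lfloor>y - p\<rfloor>) = (\<Sum>p\<in>(\<lambda>x. frac (\<phi> x)) ` X. \<Sum>x\<in>{x\<in>X. frac (\<phi> x) = p}. \<epsilon> x * \<lfloor>y - frac (\<phi> x)\<rfloor>)"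
    unfolding \<epsilon>'_def by (intro sum.cong refl) (auto simp: sum_distrib_right)
  also have "\<dots> = (\<Sum>x\<in>X. \<epsilon> x * \<lfloor>y - frac (\<phi> x)\<rfloor>)"
    by (rule sum.image_gen[OF assms(1), symmetric])
  finally show "c + (\<Sum>x\<in>X. \<epsilon> x * \<lfloor>y - \<phi> x\<rfloor>) = stepf (c - (\<Sum>x\<in>X. \<epsilon> x * \<lfloor>\<phi> x\<rfloor>)) ((\<lambda>x. frac (\<phi> x)) ` X) \<epsilon>' y"
    unfolding stepf_def fl by (simp add: right_diff_distrib sum_subtractf)
qed

text \<open>By Hermite's identity folding moves a jump from p to N p and keeps its height, so no
  jumps are created.\<close>

lemma fold_mult_stepf:
  assumes h: "\<And>y. stepf c Y \<epsilon> y = (if y \<in> S then 1 else 0)" and N: "N > 0"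
  shows "int (fold_mult N S y) = int N * c + (\<Sum>p\<in>Y. \<epsilon> p * \<lfloor>y - real N * p\<rfloor>)"
proof -
  have "int (fold_mult N S y) = (\<Sum>j<N. stepf c Y \<epsilon> ((y + real j) / real N))"
    unfolding h fold_mult_def by (simp add: sum.If_cases Int_def)
  also have "\<dots> = int N * c + (\<Sum>j<N. \<Sum>p\<in>Y. \<epsilon> p * \<lfloor>(y + real j) / real N - p\<rfloor>)"
    by (simp add: stepf_def sum.distrib)
  also have "(\<Sum>j<N. \<Sum>p\<in>Y. \<epsilon> p * \<lfloor>(y + real j) / real N - p\<rfloor>) = (\<Sum>p\<in>Y. \<epsilon> p * (\<Sum>j<N. \<lfloor>(y + real j) / real N - p\<rfloor>))"
    by (subst sum.swap) (simp add: sum_distrib_left)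
  also have "\<dots> = (\<Sum>p\<in>Y. \<epsilon> p * \<lfloor>y - real N * p\<rfloor>)" using sum_floor_shift[OF N] by simp
  finally show ?thesis .
qed

subsection \<open>Two-valued multiplicity functions are rare\<close>

text \<open>On [0, 1) the floor of x - p is minus the indicator of [0, p), whose coefficient is
  elementary; the contributions without p cancel because the jumps add to 0. The shift by
  \<open>t\<close> is invisible at nonzero frequencies and permits centring.\<close>

lemma stepf_fourier_coefficient:
  assumes Y: "finite Y" "Y \<subseteq> {0..<1}" "sum \<epsilon> Y = 0" and k: "k \<noteq> 0"
  shows "(\<integral>x. of_real (of_int (stepf c Y \<epsilon> x) - t) * e1 (- of_int k * x) \<partial>lebesgue_on {0..<1})
    = (\<Sum>p\<in>Y. of_int (\<epsilon> p) * e1 (- of_int k * p)) / (2 * pi * of_int k * \<i>)"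
proof -
  let ?U = "lebesgue_on {0..<1::real}"
  let ?E = "\<lambda>x. e1 (- of_int k * x)"
  have iE: "integrable ?U ?E"
    by (rule integrable_lebesgue_on_bounded[where B=1]) auto
  have iI: "integrable ?U (\<lambda>x. indicator {0..<p} x *\<^sub>R ?E x)" for p
    by (rule integrable_lebesgue_on_bounded[where B=1]) (auto simp: indicator_def)
  have fl: "\<lfloor>x - p\<rfloor> = - (if x < p then 1 else 0)" if "p \<in> Y" "x \<in> {0..<1}" for p x
    using that Y(2) by (auto simp: floor_eq_iff subset_iff)
  have "(\<integral>x. of_real (of_int (stepf c Y \<epsilon> x) - t) * ?E x \<partial>?U) =
     (\<integral>x. of_real (of_int c - t) * ?E x - (\<Sum>p\<in>Y. of_int (\<epsilon> p) * (indicator {0..<p} x *\<^sub>R ?E x)) \<partial>?U)"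
  proof (rule Bochner_Integration.integral_cong[OF refl])
    fix x :: real assume "x \<in> space ?U"
    then have x: "x \<in> {0..<1}" by simp
    have "stepf c Y \<epsilon> x = c - (\<Sum>p\<in>Y. \<epsilon> p * (if x < p then 1 else 0))"
      unfolding stepf_def using fl[OF _ x] by (simp add: sum_negf[symmetric])
    then have "complex_of_real (of_int (stepf c Y \<epsilon> x) - t) = of_real (of_int c - t) - (\<Sum>p\<in>Y. of_int (\<epsilon> p) * of_real (indicator {0..<p} x))"
      using x by (simp add: of_int_sum) (intro sum.cong, auto)
    then show "of_real (of_int (stepf c Y \<epsilon> x) - t) * ?E x =
       of_real (of_int c - t) * ?E x - (\<Sum>p\<in>Y. of_int (\<epsilon> p) * (indicator {0..<p} x *\<^sub>R ?E x))"
      by (simp only: left_diff_distrib sum_distrib_right scaleR_conv_of_real mult.assoc)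
  qed
  also have "\<dots> = of_real (of_int c - t) * (\<integral>x. ?E x \<partial>?U) - (\<Sum>p\<in>Y. of_int (\<epsilon> p) * (\<integral>x. indicator {0..<p} x *\<^sub>R ?E x \<partial>?U))"
  proof -
    have i1: "integrable ?U (\<lambda>x. of_real (of_int c - t) * ?E x)" by (rule integrable_mult_right[OF iE])
    have i2: "integrable ?U (\<lambda>x. of_int (\<epsilon> p) * (indicator {0..<p} x *\<^sub>R ?E x))" for p
      by (rule integrable_mult_right[OF iI])
    show ?thesis
      unfolding Bochner_Integration.integral_diff[OF i1 Bochner_Integration.integrable_sum[OF i2]]
        Bochner_Integration.integral_sum[OF i2] by (simp only: integral_mult_right_zero)
  qed
  also have "(\<integral>x. ?E x \<partial>?U) = 0"
    using integral_e1_period[of "-k"] k by simp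
  also have "(\<Sum>p\<in>Y. of_int (\<epsilon> p) * (\<integral>x. indicator {0..<p} x *\<^sub>R ?E x \<partial>?U)) =
     (\<Sum>p\<in>Y. of_int (\<epsilon> p) * ((1 - e1 (- of_int k * p)) / (2 * pi * of_int k * \<i>)))"
  proof (rule sum.cong[OF refl])
    fix p assume p: "p \<in> Y"
    then have p': "0 \<le> p" "p < 1" using Y by auto
    have "(\<integral>x. indicator {0..<p} x *\<^sub>R ?E x \<partial>?U) = (\<integral>x. indicator {0..<1} x *\<^sub>R (indicator {0..<p} x *\<^sub>R ?E x) \<partial>lborel)"
      by (rule integral_lebesgue_on_borel) auto
    also have "\<dots> = (\<integral>x. indicator {0..<p} x *\<^sub>R ?E x \<partial>lborel)"
      using p' by (intro Bochner_Integration.integral_cong) (auto simp: indicator_def)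
    also have "\<dots> = (\<integral>x. ?E x \<partial>lebesgue_on {0..<p})"
      by (rule integral_lebesgue_on_borel[symmetric]) auto
    also have "\<dots> = (e1 (- of_int k * p) - 1) / (2 * pi * (- of_int k) * \<i>)"
      using integral_e1[of "- of_int k" p] p' k by simp
    also have "\<dots> = (1 - e1 (- of_int k * p)) / (2 * pi * of_int k * \<i>)"
      using k by (simp add: field_simps)
    finally show "of_int (\<epsilon> p) * (\<integral>x. indicator {0..<p} x *\<^sub>R ?E x \<partial>?U) =
       of_int (\<epsilon> p) * ((1 - e1 (- of_int k * p)) / (2 * pi * of_int k * \<i>))" by simp
  qed
  also have "\<dots> = ((\<Sum>p\<in>Y. of_int (\<epsilon> p)) - (\<Sum>p\<in>Y. of_int (\<epsilon> p) * e1 (- of_int k * p))) / (2 * pi * of_int k * \<i>)"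
    by (simp add: right_diff_distrib sum_subtractf diff_divide_distrib sum_divide_distrib)
  also have "(\<Sum>p\<in>Y. complex_of_int (\<epsilon> p)) = 0" using Y(3) by (simp flip: of_int_sum)
  finally show ?thesis by simp
qed

text \<open>Bessel's inequality at the frequencies \<open>\<plusminus>1\<close>, \<open>\<plusminus>2\<close>, for a function with values \<open>\<plusminus>1/2\<close>.\<close>

lemma two_valued_imp_small:
  assumes Y: "finite Y" "Y \<subseteq> {0..<1}" "sum \<epsilon> Y = 0" and two: "\<And>y. stepf c Y \<epsilon> y \<in> {n - 1, n}"
  defines "P \<equiv> \<lambda>k::int. (\<Sum>p\<in>Y. of_int (\<epsilon> p) * e1 (- of_int k * p))"
  shows "(cmod (P 1))^2 + (cmod (P 2))^2 / 4 \<le> pi^2 / 2"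
proof -
  let ?U = "lebesgue_on {0..<1::real}"
  \<comment> \<open>Centring between the two values makes |v| constant, so the mass is 1/4 whatever
    the measures of the two level sets are.\<close>
  define v where "v x = of_int (stepf c Y \<epsilon> x) - (of_int n - 1/2 :: real)" for x
  have v: "\<bar>v x\<bar> = 1/2" for x using two[of x] by (auto simp: v_def)
  have [measurable]: "v \<in> borel_measurable borel" unfolding v_def by measurable
  have co: "(cmod (\<integral>x. v x * e1 (- of_int k * x) \<partial>?U))^2 = (cmod (P k))^2 / (4 * pi^2 * (of_int k)^2)" if "k \<noteq> 0" for k
  proof -
    have "(\<integral>x. v x * e1 (- of_int k * x) \<partial>?U) = P k / (2 * pi * of_int k * \<i>)"
      using stepf_fourier_coefficient[OF Y that, of c "of_int n - 1/2"] by (simp add: v_def P_def)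
    then show ?thesis by (simp add: norm_divide norm_mult power_divide power_mult_distrib)
  qed
  have Pm: "cmod (P (-k)) = cmod (P k)" for k
  proof -
    have "P (-k) = cnj (P k)" unfolding P_def by (simp add: e1_minus)
    then show ?thesis by simp
  qed
  have "(\<Sum>k\<in>{1,-1,2,-2}. (cmod (\<integral>x. v x * e1 (- of_int k * x) \<partial>?U))^2) \<le> (\<integral>x. (v x)^2 \<partial>?U)"
    using v by (intro Bessel_real[where B="1/2"]) auto
  also have "(\<integral>x. (v x)^2 \<partial>?U) = (\<integral>x. 1/4 \<partial>?U)"
  proof (intro Bochner_Integration.integral_cong refl)
    fix x
    have "(v x)^2 = \<bar>v x\<bar>^2" by simp
    also have "\<dots> = 1/4" unfolding v by (simp add: power2_eq_square)
    finally show "(v x)^2 = 1/4" .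
  qed
  also have "\<dots> = 1/4" by simp
  also have "(\<Sum>k\<in>{1,-1,2,-2}. (cmod (\<integral>x. v x * e1 (- of_int k * x) \<partial>?U))^2) = (\<Sum>k\<in>{1,-1,2,-2}. (cmod (P k))^2 / (4 * pi^2 * (of_int k)^2))"
    by (intro sum.cong refl co) auto
  also have "\<dots> = 2 * ((cmod (P 1))^2 / (4 * pi^2)) + 2 * ((cmod (P 2))^2 / (16 * pi^2))"
    using Pm[of 1] Pm[of 2] by simp
  finally show ?thesis by (simp add: field_simps)
qed

lemma irrational_geometric_bounded:
  assumes "\<theta> \<notin> \<rat>"
  shows "\<exists>B. \<forall>M. cmod (\<Sum>N=1..M. e1 (real N * \<theta>)) \<le> B"
proof (intro exI allI)
  fix M
  have "\<theta> \<notin> \<int>" using assms Ints_subset_Rats by blast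
  then have ne: "e1 \<theta> \<noteq> 1" by (simp add: e1_eq_1_iff)
  have "(\<Sum>N=1..M. e1 (real N * \<theta>)) = (\<Sum>N=1..M. e1 \<theta> ^ N)" by (simp add: e1_power)
  also have "\<dots> = (e1 \<theta> - e1 \<theta> ^ Suc M) / (1 - e1 \<theta>)"
    using ne by (subst sum_gp) auto
  finally have "cmod (\<Sum>N=1..M. e1 (real N * \<theta>)) = cmod (e1 \<theta> - e1 \<theta> ^ Suc M) / cmod (1 - e1 \<theta>)"
    by (simp add: norm_divide)
  also have "\<dots> \<le> 2 / cmod (1 - e1 \<theta>)"
    using norm_triangle_ineq4[of "e1 \<theta>" "e1 \<theta> ^ Suc M"] by (intro divide_right_mono) (auto simp: norm_power norm_mult)
  finally show "cmod (\<Sum>N=1..M. e1 (real N * \<theta>)) \<le> 2 / cmod (1 - e1 \<theta>)" .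
qed

text \<open>Expand the square. The diagonal contributes M times the sum of the squared jumps; off
  the diagonal stand geometric sums with irrational rotation number k (q - p), which stay bounded as
  M grows.\<close>

lemma mean_square_lower:
  fixes \<epsilon> :: "real \<Rightarrow> int" and k :: int
  assumes Y: "finite Y" and irr: "\<And>p q. p \<in> Y \<Longrightarrow> q \<in> Y \<Longrightarrow> p \<noteq> q \<Longrightarrow> p - q \<notin> \<rat>" and k: "k \<noteq> 0"
  shows "\<exists>B. \<forall>M. real M * (\<Sum>p\<in>Y. (of_int (\<epsilon> p))^2) - B \<le>
     (\<Sum>N=1..M. (cmod (\<Sum>p\<in>Y. of_int (\<epsilon> p) * e1 (- of_int k * (real N * p))))^2)"
proof -
  let ?I = "{pq \<in> Y \<times> Y. fst pq \<noteq> snd pq}"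
  have "\<exists>B. \<forall>M. cmod (\<Sum>N=1..M. e1 (real N * (of_int k * (snd pq - fst pq)))) \<le> B" if "pq \<in> ?I" for pq
  proof (rule irrational_geometric_bounded)
    have "snd pq - fst pq \<notin> \<rat>" using irr that by auto
    then show "of_int k * (snd pq - fst pq) \<notin> \<rat>"
      using k Rats_divide[of "of_int k * (snd pq - fst pq)" "of_int k"] by auto
  qed
  then have "\<forall>pq\<in>?I. \<exists>B. \<forall>M. cmod (\<Sum>N=1..M. e1 (real N * (of_int k * (snd pq - fst pq)))) \<le> B" by blast
  from bchoice[OF this] obtain B where
    B: "\<forall>pq\<in>?I. \<forall>M. cmod (\<Sum>N=1..M. e1 (real N * (of_int k * (snd pq - fst pq)))) \<le> B pq" by (elim exE)
  let ?c = "\<lambda>pq. complex_of_int (\<epsilon> (fst pq) * \<epsilon> (snd pq))"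
  show ?thesis
  proof (intro exI[of _ "\<Sum>pq\<in>?I. cmod (?c pq) * B pq"] allI)
    fix M
    let ?D = "{pq \<in> Y \<times> Y. fst pq = snd pq}"
    have split: "Y \<times> Y = ?D \<union> ?I" "?D \<inter> ?I = {}" "finite ?D" "finite ?I" using Y by auto
    have sq: "complex_of_real ((cmod (\<Sum>p\<in>Y. of_int (\<epsilon> p) * e1 (- of_int k * (real N * p))))^2)
        = (\<Sum>pq\<in>Y \<times> Y. ?c pq * e1 (real N * (of_int k * (snd pq - fst pq))))" for N
    proof -
      have "complex_of_real ((cmod (\<Sum>p\<in>Y. of_int (\<epsilon> p) * e1 (- of_int k * (real N * p))))^2) =
        (\<Sum>p\<in>Y. \<Sum>q\<in>Y. (of_int (\<epsilon> p) * e1 (- of_int k * (real N * p))) * cnj (of_int (\<epsilon> q) * e1 (- of_int k * (real N * q))))"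
        unfolding complex_norm_square cnj_sum sum_product ..
      also have "\<dots> = (\<Sum>p\<in>Y. \<Sum>q\<in>Y. ?c (p, q) * e1 (real N * (of_int k * (q - p))))"
      proof (intro sum.cong refl)
        fix p q
        have "e1 (real N * (of_int k * (q - p))) = e1 (- of_int k * (real N * p) - (- of_int k * (real N * q)))"
          by (rule arg_cong[of _ _ e1]) (simp add: algebra_simps)
        then have "e1 (real N * (of_int k * (q - p))) = e1 (- of_int k * (real N * p)) * cnj (e1 (- of_int k * (real N * q)))"
          by (simp only: e1_diff)
        then show "(of_int (\<epsilon> p) * e1 (- of_int k * (real N * p))) * cnj (of_int (\<epsilon> q) * e1 (- of_int k * (real N * q)))
          = ?c (p, q) * e1 (real N * (of_int k * (q - p)))" by simp
      qed
      also have "\<dots> = (\<Sum>pq\<in>Y \<times> Y. ?c pq * e1 (real N * (of_int k * (snd pq - fst pq))))"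
        by (simp add: sum.cartesian_product case_prod_beta)
      finally show ?thesis .
    qed
    define T where "T = (\<Sum>pq\<in>?I. ?c pq * (\<Sum>N=1..M. e1 (real N * (of_int k * (snd pq - fst pq)))))"
    have "complex_of_real (\<Sum>N=1..M. (cmod (\<Sum>p\<in>Y. of_int (\<epsilon> p) * e1 (- of_int k * (real N * p))))^2)
      = (\<Sum>N=1..M. \<Sum>pq\<in>Y \<times> Y. ?c pq * e1 (real N * (of_int k * (snd pq - fst pq))))"
      unfolding of_real_sum sq ..
    also have "\<dots> = (\<Sum>pq\<in>Y \<times> Y. ?c pq * (\<Sum>N=1..M. e1 (real N * (of_int k * (snd pq - fst pq)))))"
      by (subst sum.swap) (simp add: sum_distrib_left)
    also have "\<dots> = (\<Sum>pq\<in>?D. ?c pq * (\<Sum>N=1..M. e1 (real N * (of_int k * (snd pq - fst pq))))) + T"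
      unfolding T_def by (subst split(1), rule sum.union_disjoint) (use split in auto)
    also have "(\<Sum>pq\<in>?D. ?c pq * (\<Sum>N=1..M. e1 (real N * (of_int k * (snd pq - fst pq))))) = (\<Sum>pq\<in>?D. ?c pq * of_nat M)"
      by (intro sum.cong refl) auto
    also have "\<dots> = (\<Sum>p\<in>Y. of_int (\<epsilon> p * \<epsilon> p) * of_nat M)"
      by (rule sum.reindex_bij_witness[of _ "\<lambda>p. (p, p)" fst]) auto
    also have "\<dots> = complex_of_real (real M * (\<Sum>p\<in>Y. (of_int (\<epsilon> p))^2))"
      by (simp add: sum_distrib_left power2_eq_square mult_ac)
    finally have eq: "complex_of_real (\<Sum>N=1..M. (cmod (\<Sum>p\<in>Y. of_int (\<epsilon> p) * e1 (- of_int k * (real N * p))))^2)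
      = complex_of_real (real M * (\<Sum>p\<in>Y. (of_int (\<epsilon> p))^2)) + T" .
    have "cmod T \<le> (\<Sum>pq\<in>?I. cmod (?c pq) * B pq)"
      unfolding T_def
    proof (rule sum_norm_le)
      fix pq assume "pq \<in> ?I"
      then show "cmod (?c pq * (\<Sum>N=1..M. e1 (real N * (of_int k * (snd pq - fst pq))))) \<le> cmod (?c pq) * B pq"
        unfolding norm_mult using B by (intro mult_left_mono) auto
    qed
    moreover have "(\<Sum>N=1..M. (cmod (\<Sum>p\<in>Y. of_int (\<epsilon> p) * e1 (- of_int k * (real N * p))))^2) =
        real M * (\<Sum>p\<in>Y. (of_int (\<epsilon> p))^2) + Re T"
      using arg_cong[OF eq, of Re] by simp
    moreover have "- cmod T \<le> Re T" using abs_Re_le_cmod[of T] by linarith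
    ultimately show "real M * (\<Sum>p\<in>Y. (of_int (\<epsilon> p))^2) - (\<Sum>pq\<in>?I. cmod (?c pq) * B pq) \<le>
       (\<Sum>N=1..M. (cmod (\<Sum>p\<in>Y. of_int (\<epsilon> p) * e1 (- of_int k * (real N * p))))^2)" by linarith
  qed
qed

text \<open>If all N were small, averaging would force 4 + 4/4 = 5 \<le> pi^2/2, but pi^2/2 < 4.95.
  The second frequency is essential, since the first one alone yields only 4.\<close>

lemma exists_large_exponential_sum:
  fixes \<epsilon> :: "real \<Rightarrow> int"
  assumes Y: "finite Y" and irr: "\<And>p q. p \<in> Y \<Longrightarrow> q \<in> Y \<Longrightarrow> p \<noteq> q \<Longrightarrow> p - q \<notin> \<rat>"
    and four: "4 \<le> (\<Sum>p\<in>Y. (\<epsilon> p)^2)"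
  defines "P \<equiv> \<lambda>(k::int) (N::nat). (cmod (\<Sum>p\<in>Y. of_int (\<epsilon> p) * e1 (- of_int k * (real N * p))))^2"
  shows "\<exists>N>0. pi^2 / 2 < P 1 N + P 2 N / 4"
proof (rule ccontr)
  let ?E = "\<Sum>p\<in>Y. (real_of_int (\<epsilon> p))^2"
  assume A: "\<not> (\<exists>N>0. pi^2 / 2 < P 1 N + P 2 N / 4)"
  have small: "P 1 N + P 2 N / 4 \<le> pi^2 / 2" if "N > 0" for N
    using A that by (meson not_less)
  have low: "\<exists>B. \<forall>M. real M * ?E - B \<le> (\<Sum>N=1..M. P k N)" if "k \<noteq> 0" for k
    unfolding P_def by (rule mean_square_lower[OF Y irr that])
  obtain B1 where B1: "\<And>M. real M * ?E - B1 \<le> (\<Sum>N=1..M. P 1 N)" using low[of 1] by auto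
  obtain B2 where B2: "\<And>M. real M * ?E - B2 \<le> (\<Sum>N=1..M. P 2 N)" using low[of 2] by auto
  have "real_of_int 4 \<le> real_of_int (\<Sum>p\<in>Y. (\<epsilon> p)^2)" using four by (simp only: of_int_le_iff)
  then have E: "4 \<le> ?E" by simp
  have pi: "pi^2 / 2 < 4.95"
  proof -
    have "pi^2 \<le> 3.1416^2" using pi_approx by (intro power_mono) auto
    then show ?thesis by (simp add: power2_eq_square)
  qed
  have bd: "real M * 5 - (B1 + B2 / 4) \<le> real M * 4.95" for M
  proof -
    have "real M * 5 \<le> real M * ?E + real M * ?E / 4"
      using E mult_left_mono[of 4 ?E "real M"] by simp
    also have "\<dots> - (B1 + B2 / 4) \<le> (\<Sum>N=1..M. P 1 N) + (\<Sum>N=1..M. P 2 N) / 4"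
      using B1[of M] B2[of M] by simp
    also have "\<dots> = (\<Sum>N=1..M. P 1 N + P 2 N / 4)"
      by (simp add: sum.distrib sum_divide_distrib)
    also have "\<dots> \<le> (\<Sum>N=1..M. 4.95)"
    proof (rule sum_mono)
      fix N assume "N \<in> {1..M}"
      then have "N > 0" by simp
      from small[OF this] pi show "P 1 N + P 2 N / 4 \<le> 4.95" by linarith
    qed
    also have "\<dots> = real M * 4.95" by simp
    finally show ?thesis by simp
  qed
  \<comment> \<open>The gap 5 - 4.95 = 1/20 wins as soon as M exceeds 20 times the bounded
    error.\<close>
  obtain M :: nat where "(B1 + B2 / 4) * 20 < real M" using reals_Archimedean2 by blast
  with bd[of M] show False by simp
qed

subsection \<open>Density of trigonometric polynomials\<close>

definition is_trig_poly :: "(real \<Rightarrow> complex) \<Rightarrow> bool" where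
  "is_trig_poly f \<longleftrightarrow> (\<exists>F a. finite F \<and> (\<forall>x. f x = trig_poly F a x))"

lemma is_trig_poly_monom: "is_trig_poly (\<lambda>x. c * e1 (of_int n * x))"
  unfolding is_trig_poly_def by (intro exI[of _ "{n}"] exI[of _ "\<lambda>_. c"]) (simp add: trig_poly_def)

lemma trig_poly_Un:
  assumes "finite F" "finite G"
  obtains c where "\<And>x. trig_poly F a x + trig_poly G b x = trig_poly (F \<union> G) c x"
proof -
  let ?a = "\<lambda>n. if n \<in> F then a n else 0" and ?b = "\<lambda>n. if n \<in> G then b n else 0"
  have "trig_poly F a x = trig_poly (F \<union> G) ?a x" for x
    unfolding trig_poly_def using assms by (intro sum.mono_neutral_cong_left) auto
  moreover have "trig_poly G b x = trig_poly (F \<union> G) ?b x" for x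
    unfolding trig_poly_def using assms by (intro sum.mono_neutral_cong_left) auto
  ultimately have "trig_poly F a x + trig_poly G b x = trig_poly (F \<union> G) (\<lambda>n. ?a n + ?b n) x" for x
    by (simp only: trig_poly_def sum.distrib distrib_right)
  then show thesis by (rule that)
qed

lemma is_trig_poly_add:
  assumes "is_trig_poly f" "is_trig_poly g"
  shows "is_trig_poly (\<lambda>x. f x + g x)"
proof -
  obtain F a G b where F: "finite F" "\<And>x. f x = trig_poly F a x" and G: "finite G" "\<And>x. g x = trig_poly G b x"
    using assms unfolding is_trig_poly_def by blast
  obtain c where "\<And>x. trig_poly F a x + trig_poly G b x = trig_poly (F \<union> G) c x" by (rule trig_poly_Un[OF F(1) G(1), of a b]) (rule that)
  then show ?thesis unfolding is_trig_poly_def F(2) G(2) using F(1) G(1) by (intro exI[of _ "F \<union> G"] exI[of _ c]) simp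
qed

lemma is_trig_poly_0: "is_trig_poly (\<lambda>x. 0)"
  unfolding is_trig_poly_def by (intro exI[of _ "{}"]) (simp add: trig_poly_def)

lemma is_trig_poly_sum: "(\<And>i. i \<in> A \<Longrightarrow> is_trig_poly (f i)) \<Longrightarrow> is_trig_poly (\<lambda>x. \<Sum>i\<in>A. f i x)"
  by (induction A rule: infinite_finite_induct) (auto intro: is_trig_poly_add is_trig_poly_0)

lemma is_trig_poly_mult:
  assumes "is_trig_poly f" "is_trig_poly g"
  shows "is_trig_poly (\<lambda>x. f x * g x)"
proof -
  obtain F a G b where F: "finite F" "\<And>x. f x = trig_poly F a x" and G: "finite G" "\<And>x. g x = trig_poly G b x"
    using assms unfolding is_trig_poly_def by blast
  have "f x * g x = (\<Sum>n\<in>F. \<Sum>m\<in>G. (a n * b m) * e1 (of_int (n + m) * x))" for x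
    unfolding F(2) G(2) trig_poly_def sum_product of_int_add distrib_right e1_add
    by (intro sum.cong refl) (simp only: mult_ac)
  then show ?thesis by (simp only: is_trig_poly_sum is_trig_poly_monom)
qed

lemma is_trig_poly_const: "is_trig_poly (\<lambda>x. c)"
  using is_trig_poly_monom[of c 0] by simp

lemma is_trig_poly_real_polynomial_function:
  fixes f :: "complex \<Rightarrow> real"
  assumes "real_polynomial_function f"
  shows "is_trig_poly (\<lambda>x. complex_of_real (f (e1 x)))"
  using assms
proof (induction f rule: real_polynomial_function.induct)
  case (linear f)
  \<comment> \<open>A real-linear functional of e1 x is a combination of e1 x and its conjugate,
    which is e1 (-x).\<close>
  have "complex_of_real (f (e1 x)) = ((f 1 - \<i> * f \<i>) / 2) * e1 (of_int 1 * x) + ((f 1 + \<i> * f \<i>) / 2) * e1 (of_int (-1) * x)" for x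
  proof -
    interpret bounded_linear f by fact
    have "e1 x = Re (e1 x) *\<^sub>R 1 + Im (e1 x) *\<^sub>R \<i>" by (simp add: complex_eq_iff)
    then have "f (e1 x) = Re (e1 x) * f 1 + Im (e1 x) * f \<i>" by (metis add scaleR real_scaleR_def)
    moreover have "e1 (of_int (-1) * x) = cnj (e1 x)" by (simp add: e1_minus)
    ultimately show ?thesis by (simp add: complex_eq_iff field_simps)
  qed
  then show ?case by (simp only: is_trig_poly_add is_trig_poly_monom)
next
  case (const c)
  then show ?case by (rule is_trig_poly_const)
next
  case (add f g)
  then show ?case using is_trig_poly_add by fastforce
next
  case (mult f g)
  then show ?case using is_trig_poly_mult by fastforce
qed

lemma is_trig_poly_polynomial_function:
  fixes g :: "complex \<Rightarrow> complex"
  assumes "polynomial_function g"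
  shows "is_trig_poly (\<lambda>x. g (e1 x))"
proof -
  have "real_polynomial_function (Re \<circ> g)" "real_polynomial_function (Im \<circ> g)"
    using assms bounded_linear_Re bounded_linear_Im unfolding polynomial_function_def by blast+
  then have "is_trig_poly (\<lambda>x. complex_of_real (Re (g (e1 x))) + \<i> * complex_of_real (Im (g (e1 x))))"
    by (intro is_trig_poly_add is_trig_poly_mult[OF is_trig_poly_const]) (auto dest: is_trig_poly_real_polynomial_function)
  then show ?thesis by (simp flip: complex_eq)
qed

lemma periodic_continuous_uniform_approx:
  fixes f :: "real \<Rightarrow> complex"
  assumes cont: "continuous_on {0..1} f" and loop: "f 0 = f 1" and e: "0 < e"
  obtains F a where "finite F" "\<And>x. x \<in> {0..<1} \<Longrightarrow> cmod (f x - trig_poly F a x) < e"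
proof -
  \<comment> \<open>The constant homotopy from f to itself yields continuity of f transported to the
    circle, including at the branch cut of \<open>Arg2pi\<close>, where f 0 = f 1 enters.\<close>
  have "homotopic_loops UNIV f f"
    using cont loop by (simp add: homotopic_loops_refl path_def pathstart_def pathfinish_def)
  then have hom: "homotopic_with_canon (\<lambda>h. True) (sphere 0 1) UNIV (f \<circ> (\<lambda>z. Arg2pi z / (2*pi))) (f \<circ> (\<lambda>z. Arg2pi z / (2*pi)))"
    by (rule homotopic_loops_imp_homotopic_circlemaps)
  then have c: "continuous_on (sphere 0 1) (f \<circ> (\<lambda>z. Arg2pi z / (2*pi)))"
    using homotopic_with_imp_continuous by blast
  obtain g where g: "polynomial_function g" "\<forall>z\<in>sphere 0 1. cmod ((f \<circ> (\<lambda>z. Arg2pi z / (2*pi))) z - g z) < e"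
    using Stone_Weierstrass_polynomial_function[OF compact_sphere c e] by blast
  obtain F a where F: "finite F" "\<And>x. g (e1 x) = trig_poly F a x"
    using is_trig_poly_polynomial_function[OF g(1)] unfolding is_trig_poly_def by blast
  show thesis
  proof (rule that[OF F(1)])
    fix x :: real assume x: "x \<in> {0..<1}"
    have "Arg2pi (exp (\<i> * of_real (2 * pi * x))) = 2 * pi * x"
      using x by (subst Arg2pi_exp) auto
    then have "Arg2pi (e1 x) / (2*pi) = x" by (simp add: e1_def cis_conv_exp)
    then show "cmod (f x - trig_poly F a x) < e" using bspec[OF g(2), of "e1 x"] by (simp add: F(2))
  qed
qed

text \<open>This is the retraction of the plane onto the disc of radius K; the maximum in the
  denominator makes continuity evident and avoids division by 0.\<close>

definition clip :: "real \<Rightarrow> complex \<Rightarrow> complex" where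
  "clip K z = (K / max K (cmod z)) *\<^sub>R z"

lemma norm_clip:
  assumes "0 < K"
  shows "cmod (clip K z) \<le> K"
proof -
  have "max K (cmod z) > 0" using assms by simp
  then have "K * cmod z / max K (cmod z) \<le> K" using assms by (simp add: divide_le_eq mult_left_mono)
  then show ?thesis using assms by (simp add: clip_def)
qed

lemma clip_eq: "0 < K \<Longrightarrow> cmod z \<le> K \<Longrightarrow> clip K z = z"
  by (simp add: clip_def max_def)

lemma norm_diff_clip:
  assumes "0 < K"
  shows "cmod (z - clip K z) \<le> cmod z"
proof -
  define s where "s = K / max K (cmod z)"
  have "max K (cmod z) > 0" using assms by simp
  then have s: "0 \<le> s" "s \<le> 1" using assms by (auto simp: s_def divide_le_eq)
  have "z - clip K z = (1 - s) *\<^sub>R z" by (simp add: clip_def s_def scaleR_left_diff_distrib)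
  then have "cmod (z - clip K z) = (1 - s) * cmod z" using s by simp
  also have "\<dots> \<le> 1 * cmod z" using s by (intro mult_right_mono) auto
  finally show ?thesis by simp
qed

lemma continuous_clip: "0 < K \<Longrightarrow> continuous_on A (clip K)"
  unfolding clip_def by (intro continuous_intros) (auto simp: max_def)

lemma L2norm_tendsto_0_dominated:
  assumes "\<And>n. f n \<in> borel_measurable (lebesgue_on S)" "w \<in> L2 S"
    and "AE x in lebesgue_on S. (\<lambda>n. f n x) \<longlonglongrightarrow> 0"
    and "\<And>n x. x \<in> S \<Longrightarrow> cmod (f n x) \<le> cmod (w x)"
  shows "(\<lambda>n. L2norm S (f n)) \<longlonglongrightarrow> 0"
proof -
  have "(\<lambda>n. \<integral>x. (cmod (f n x))^2 \<partial>lebesgue_on S) \<longlonglongrightarrow> (\<integral>x. 0 \<partial>lebesgue_on S)"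
  proof (rule integral_dominated_convergence[where w="\<lambda>x. (cmod (w x))^2"])
    show "integrable (lebesgue_on S) (\<lambda>x. (cmod (w x))^2)" using assms(2) by (rule L2_integrable)
    show "AE x in lebesgue_on S. (\<lambda>n. (cmod (f n x))^2) \<longlonglongrightarrow> 0"
      using assms(3) by eventually_elim (auto intro!: tendsto_eq_intros)
    show "AE x in lebesgue_on S. norm ((cmod (f n x))^2) \<le> (cmod (w x))^2" for n
      using assms(4) by (intro AE_I2) (auto intro!: power_mono)
  qed (use assms(1) in measurable)
  then have "(\<lambda>n. sqrt (\<integral>x. (cmod (f n x))^2 \<partial>lebesgue_on S)) \<longlonglongrightarrow> sqrt 0"
    by (intro tendsto_real_sqrt) simp
  then show ?thesis by (simp add: L2norm_def)
qed

text \<open>Three errors of e/3 each: truncate f, replace the truncation by a bounded continuous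
  function vanishing at both ends, and approximate that one uniformly.\<close>

lemma trig_poly_dense:
  assumes f: "f \<in> L2 {0..<1}" and e: "0 < e"
  obtains F a where "finite F" "L2norm {0..<1} (\<lambda>x. f x - trig_poly F a x) < e"
proof -
  let ?I = "{0..<1::real}"
  let ?U = "lebesgue_on ?I"
  have fm [measurable]: "f \<in> borel_measurable ?U" using f by (rule L2_measurable)
  have bm: "g \<in> borel_measurable ?U" if "continuous_on UNIV g" for g :: "real \<Rightarrow> complex"
    using that by (intro borel_measurable_lebesgue_on borel_measurable_continuous_onI)
  have cb: "clip K \<in> borel_measurable borel" if "0 < K" for K
    using that by (intro borel_measurable_continuous_onI continuous_clip)
  have cf: "(\<lambda>x. clip K (f x)) \<in> borel_measurable ?U" if "0 < K" for K
    by (rule measurable_compose[OF fm cb[OF that]])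
  have "(\<lambda>n. L2norm ?I (\<lambda>x. f x - clip (real (Suc n)) (f x))) \<longlonglongrightarrow> 0"
  proof (rule L2norm_tendsto_0_dominated[OF _ f])
    show "(\<lambda>x. f x - clip (real (Suc n)) (f x)) \<in> borel_measurable ?U" for n
      using cf[of "real (Suc n)"] by (intro borel_measurable_diff fm) simp
    show "AE x in ?U. (\<lambda>n. f x - clip (real (Suc n)) (f x)) \<longlonglongrightarrow> 0"
    proof (rule AE_I2)
      fix x
      obtain m :: nat where m: "cmod (f x) < real m" using reals_Archimedean2 by blast
      have "eventually (\<lambda>n. f x - clip (real (Suc n)) (f x) = 0) sequentially"
        using m by (intro eventually_sequentiallyI[of m]) (simp add: clip_eq)
      then show "(\<lambda>n. f x - clip (real (Suc n)) (f x)) \<longlonglongrightarrow> 0" by (rule tendsto_eventually)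
    qed
    show "cmod (f x - clip (real (Suc n)) (f x)) \<le> cmod (f x)" for n x by (rule norm_diff_clip) simp
  qed
  from order_tendstoD(2)[OF this, of "e/3"] e
  obtain m where m: "L2norm ?I (\<lambda>x. f x - clip (real (Suc m)) (f x)) < e/3"
    by (auto simp: eventually_sequentially)
  define K where "K = real (Suc m)"
  have K: "0 < K" by (simp add: K_def)
  have "f measurable_on ?I" using fm by (simp add: measurable_on_iff_borel_measurable)
  then obtain N g where N: "negligible N" and g: "\<And>n. continuous_on UNIV (g n)"
    and lim: "\<And>x. x \<notin> N \<Longrightarrow> (\<lambda>n. g n x) \<longlonglongrightarrow> (if x \<in> ?I then f x else 0)"
    unfolding measurable_on_def by blast
  \<comment> \<open>The cutoff tends to 1 on (0, 1) and vanishes at both end points, so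
    \<open>h n\<close> closes up to a continuous function on the circle.\<close>
  define h where "h n x = complex_of_real (max 0 (min 1 (real n * (x * (1 - x))))) * clip K (g n x)" for n x
  have hc: "continuous_on UNIV (h n)" for n
    unfolding h_def using continuous_on_compose2[OF continuous_clip[OF K, of UNIV] g[of n]]
    by (intro continuous_intros) auto
  have hb: "cmod (h n x) \<le> K" for n x
  proof -
    have "cmod (h n x) = \<bar>max 0 (min 1 (real n * (x * (1 - x))))\<bar> * cmod (clip K (g n x))"
      unfolding h_def norm_mult norm_of_real ..
    also have "\<dots> \<le> 1 * K" using norm_clip[OF K] K by (intro mult_mono) auto
    finally show ?thesis by simp
  qed
  have AEn: "AE x in ?U. x \<notin> insert 0 N"
  proof -
    have "negligible (insert 0 N)" using N by simp
    then have "AE x in lebesgue. x \<notin> insert 0 N"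
      by (intro AE_not_in) (simp add: negligible_iff_null_sets)
    then show ?thesis by (auto simp: AE_restrict_space_iff)
  qed
  have "(\<lambda>n. L2norm ?I (\<lambda>x. clip K (f x) - h n x)) \<longlonglongrightarrow> 0"
  proof (rule L2norm_tendsto_0_dominated[where w="\<lambda>x. complex_of_real (2 * K)"])
    show "(\<lambda>x. clip K (f x) - h n x) \<in> borel_measurable ?U" for n
      by (intro borel_measurable_diff cf K bm hc)
    show "(\<lambda>x. complex_of_real (2 * K)) \<in> L2 ?I"
      by (rule L2_bounded[where B="2 * K"]) (use K in auto)
    have "AE x in ?U. x \<in> ?I" by (rule AE_I2) simp
    then show "AE x in ?U. (\<lambda>n. clip K (f x) - h n x) \<longlonglongrightarrow> 0"
      using AEn
    proof eventually_elim
      case (elim x)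
      then have x: "0 < x" "x < 1" and xN: "x \<notin> N" by auto
      have "(\<lambda>n. clip K (g n x)) \<longlonglongrightarrow> clip K (f x)"
        using lim[OF xN] elim continuous_on_tendsto_compose[OF continuous_clip[OF K, of UNIV], of "\<lambda>n. g n x" "f x"] by auto
      moreover have "(\<lambda>n. complex_of_real (max 0 (min 1 (real n * (x * (1 - x)))))) \<longlonglongrightarrow> 1"
      proof (rule tendsto_eventually)
        have p: "0 < x * (1 - x)" using x by simp
        obtain k :: nat where k: "1 / (x * (1 - x)) < real k" using reals_Archimedean2 by blast
        have "1 \<le> real n * (x * (1 - x))" if "k \<le> n" for n
        proof -
          have "1 = 1 / (x * (1 - x)) * (x * (1 - x))" using x by simp
          also have "\<dots> \<le> real n * (x * (1 - x))" using k that p by (intro mult_right_mono) auto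
          finally show ?thesis .
        qed
        then show "eventually (\<lambda>n. complex_of_real (max 0 (min 1 (real n * (x * (1 - x))))) = 1) sequentially"
          by (intro eventually_sequentiallyI[of k]) (simp add: min_def)
      qed
      ultimately have "(\<lambda>n. clip K (f x) - h n x) \<longlonglongrightarrow> clip K (f x) - 1 * clip K (f x)"
        unfolding h_def by (intro tendsto_intros)
      then show ?case by simp
    qed
    show "cmod (clip K (f x) - h n x) \<le> cmod (complex_of_real (2 * K))" for n x
      using norm_triangle_ineq4[of "clip K (f x)" "h n x"] norm_clip[OF K, of "f x"] hb[of n x] K by simp
  qed
  from order_tendstoD(2)[OF this, of "e/3"] e
  obtain n where n: "L2norm ?I (\<lambda>x. clip K (f x) - h n x) < e/3" by (auto simp: eventually_sequentially)
  have "h n 0 = h n 1" by (simp add: h_def)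
  then obtain F a where F: "finite F" "\<And>x. x \<in> ?I \<Longrightarrow> cmod (h n x - trig_poly F a x) < e/3"
    using periodic_continuous_uniform_approx[of "h n" "e/3"] e continuous_on_subset[OF hc[of n], of "{0..1}"] by auto
  have L1: "(\<lambda>x. clip K (f x)) \<in> L2 ?I"
    by (rule L2_bounded[where B=K]) (use cf K norm_clip in auto)
  have L2: "h n \<in> L2 ?I" by (rule L2_bounded[where B=K]) (use bm hc hb in auto)
  have L3: "trig_poly F a \<in> L2 ?I" by (rule trig_poly_L2) simp
  have "L2norm ?I (\<lambda>x. h n x - trig_poly F a x) \<le> L2norm ?I (\<lambda>x. complex_of_real (e/3))"
  proof (rule L2_dominated(2))
    show "(\<lambda>x. complex_of_real (e/3)) \<in> L2 ?I" by (rule L2_bounded[where B="e/3"]) (use e in auto)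
    show "(\<lambda>x. h n x - trig_poly F a x) \<in> borel_measurable ?U"
      by (rule L2_measurable[OF L2_diff[OF L2 L3]])
    show "cmod (h n x - trig_poly F a x) \<le> cmod (complex_of_real (e/3))" if "x \<in> ?I" for x
      using F(2)[OF that] e by simp
  qed
  also have "\<dots> = e/3" using e by (simp add: L2norm_def)
  finally have 3: "L2norm ?I (\<lambda>x. h n x - trig_poly F a x) \<le> e/3" .
  have "L2norm ?I (\<lambda>x. f x - trig_poly F a x) \<le> L2norm ?I (\<lambda>x. f x - clip K (f x)) + L2norm ?I (\<lambda>x. clip K (f x) - trig_poly F a x)"
    by (rule L2norm_triangle_mid[OF f L1 L3])
  also have "L2norm ?I (\<lambda>x. clip K (f x) - trig_poly F a x) \<le> L2norm ?I (\<lambda>x. clip K (f x) - h n x) + L2norm ?I (\<lambda>x. h n x - trig_poly F a x)"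
    by (rule L2norm_triangle_mid[OF L1 L2 L3])
  finally have "L2norm ?I (\<lambda>x. f x - trig_poly F a x) < e" using m n 3 unfolding K_def by linarith
  with F(1) show thesis by (rule that)
qed

subsection \<open>Short arcs\<close>

lemma sum_exp_tail_le:
  fixes x :: real
  assumes "0 \<le> x"
  shows "(\<Sum>k<K. x ^ Suc k / fact (Suc k)) \<le> exp x - 1"
proof -
  have s: "(\<lambda>n. x ^ n /\<^sub>R fact n) sums exp x" by (rule exp_converges)
  have "(\<Sum>k<Suc K. x ^ k /\<^sub>R fact k) \<le> (\<Sum>k. x ^ k /\<^sub>R fact k)"
    using assms by (intro sum_le_suminf sums_summable[OF s]) auto
  also have "\<dots> = exp x" using s by (rule sums_unique[symmetric])
  finally show ?thesis unfolding sum.lessThan_Suc_shift by (simp add: divide_inverse mult.commute)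
qed

lemma e1_series: "(\<lambda>K. \<Sum>k<K. (2 * pi * \<i> * of_real t) ^ Suc k / fact (Suc k)) \<longlonglongrightarrow> e1 t - 1"
proof -
  let ?z = "2 * pi * \<i> * of_real t"
  have "(\<lambda>n. ?z ^ n /\<^sub>R fact n) sums exp ?z" by (rule exp_converges)
  then have "(\<lambda>n. ?z ^ Suc n /\<^sub>R fact (Suc n)) sums (exp ?z - 1)"
    by (subst sums_Suc_iff) simp
  also have "exp ?z = e1 t" by (simp add: e1_def cis_conv_exp mult_ac)
  finally show ?thesis unfolding sums_def by (simp add: scaleR_conv_of_real divide_inverse mult.commute)
qed

lemma L2_const: "(\<lambda>_. c) \<in> L2 {a..<b}"
  by (rule L2_bounded[where B="cmod c"]) auto

text \<open>The Paley-Wiener perturbation argument. Expand e1(\<delta>_n u) - 1 in powers of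
  \<delta>_n u: the power of u is a bounded multiplier common to all n, and the power of \<delta>_n
  merely changes the coefficients, so Parseval applies to each order. This costs the l2 norm of the
  coefficients, where a termwise estimate would cost the l1 norm. The orders add up to exp (2 pi
  \<eta>) - 1.\<close>

lemma perturbation_bound:
  fixes \<delta> :: "int \<Rightarrow> real"
  assumes F: "finite F" and \<eta>: "0 \<le> \<eta>" "\<And>n. n \<in> F \<Longrightarrow> \<bar>\<delta> n\<bar> \<le> \<eta>"
  shows "L2norm {0..<1} (\<lambda>u. \<Sum>n\<in>F. a n * e1 (of_int n * u) * (e1 (\<delta> n * u) - 1))
    \<le> (exp (2 * pi * \<eta>) - 1) * sqrt (\<Sum>n\<in>F. (cmod (a n))^2)"
proof -
  let ?I = "{0..<1::real}"
  let ?A = "sqrt (\<Sum>n\<in>F. (cmod (a n))^2)"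
  define D where "D u = (\<Sum>n\<in>F. a n * e1 (of_int n * u) * (e1 (\<delta> n * u) - 1))" for u
  define DK where "DK K u = (\<Sum>n\<in>F. a n * e1 (of_int n * u) * (\<Sum>k<K. (2 * pi * \<i> * of_real (\<delta> n * u)) ^ Suc k / fact (Suc k)))" for K u
  \<comment> \<open>\<open>E k\<close> gathers the terms of order k + 1 in \<delta>, for all n at
    once.\<close>
  define E where "E k u = ((2 * pi * \<i> * of_real u) ^ Suc k / fact (Suc k)) * trig_poly F (\<lambda>n. a n * of_real (\<delta> n ^ Suc k)) u" for k u
  have DKE: "DK K u = (\<Sum>k<K. E k u)" for K u
  proof -
    have "DK K u = (\<Sum>n\<in>F. \<Sum>k<K. ((2 * pi * \<i> * of_real u) ^ Suc k / fact (Suc k)) * (a n * of_real (\<delta> n ^ Suc k) * e1 (of_int n * u)))"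
      unfolding DK_def sum_distrib_left
    proof (intro sum.cong refl)
      fix n k
      have "(2 * pi * \<i> * complex_of_real (\<delta> n * u)) ^ Suc k = (2 * pi * \<i> * of_real u) ^ Suc k * of_real (\<delta> n ^ Suc k)"
        unfolding of_real_power power_mult_distrib[symmetric] of_real_mult by (rule arg_cong[of _ _ "\<lambda>x. x ^ Suc k"]) (simp only: mult_ac)
      then show "a n * e1 (of_int n * u) * ((2 * pi * \<i> * complex_of_real (\<delta> n * u)) ^ Suc k / fact (Suc k)) =
         ((2 * pi * \<i> * of_real u) ^ Suc k / fact (Suc k)) * (a n * of_real (\<delta> n ^ Suc k) * e1 (of_int n * u))"
        by (simp only: divide_inverse mult_ac)
    qed
    also have "\<dots> = (\<Sum>k<K. E k u)"
      unfolding E_def trig_poly_def sum_distrib_left by (rule sum.swap)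
    finally show ?thesis .
  qed
  have mD: "D \<in> borel_measurable borel" unfolding D_def by measurable
  have mE: "E k \<in> borel_measurable borel" for k unfolding E_def by measurable
  have coef: "cmod ((2 * pi * \<i> * of_real u) ^ Suc k / fact (Suc k)) \<le> (2 * pi) ^ Suc k / fact (Suc k)" if "u \<in> ?I" for u k
  proof -
    have "cmod (2 * pi * \<i> * of_real u) \<le> 2 * pi" using that by (simp add: norm_mult)
    then have "cmod (2 * pi * \<i> * of_real u) ^ Suc k \<le> (2 * pi) ^ Suc k" by (intro power_mono) auto
    then have "cmod (2 * pi * \<i> * of_real u) ^ Suc k / fact (Suc k) \<le> (2 * pi) ^ Suc k / fact (Suc k)"
      by (intro divide_right_mono) auto
    then show ?thesis by (simp only: norm_divide norm_power norm_fact)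
  qed
  have pd: "\<bar>\<delta> n\<bar> ^ m \<le> \<eta> ^ m" if "n \<in> F" for n m
    using \<eta>(2)[OF that] by (intro power_mono) auto
  have EL: "E k \<in> L2 ?I" "L2norm ?I (E k) \<le> (2 * pi * \<eta>) ^ Suc k / fact (Suc k) * ?A" for k
  proof -
    let ?t = "trig_poly F (\<lambda>n. a n * of_real (\<delta> n ^ Suc k))"
    let ?c = "(2 * pi) ^ Suc k / fact (Suc k) :: real"
    have tL: "?t \<in> L2 ?I" by (rule trig_poly_L2) simp
    have c0: "0 \<le> ?c" by simp
    have dom: "cmod (E k u) \<le> cmod (of_real ?c * ?t u)" if "u \<in> ?I" for u
      unfolding E_def norm_mult norm_of_real abs_of_nonneg[OF c0] using coef[OF that, of k]
      by (rule mult_right_mono) simp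
    show "E k \<in> L2 ?I"
      by (rule L2_dominated(1)[OF L2_cmult[OF tL] borel_measurable_lebesgue_on[OF mE] dom])
    have tn: "L2norm ?I ?t \<le> \<eta> ^ Suc k * ?A"
    proof (rule power2_le_imp_le)
      have "(L2norm ?I ?t)^2 = (\<Sum>n\<in>F. (cmod (a n) * \<bar>\<delta> n\<bar> ^ Suc k)^2)"
        unfolding L2norm_trig_poly[OF F] norm_mult norm_of_real power_abs ..
      also have "\<dots> \<le> (\<Sum>n\<in>F. (cmod (a n) * \<eta> ^ Suc k)^2)"
        by (intro sum_mono power_mono mult_left_mono pd mult_nonneg_nonneg) auto
      also have "\<dots> = (\<eta> ^ Suc k * ?A)^2"
        unfolding power_mult_distrib real_sqrt_pow2[OF sum_nonneg[of F "\<lambda>n. (cmod (a n))^2", OF zero_le_power2]] sum_distrib_left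
        by (intro sum.cong refl) (simp only: mult_ac)
      finally show "(L2norm ?I ?t)^2 \<le> (\<eta> ^ Suc k * ?A)^2" .
      show "0 \<le> \<eta> ^ Suc k * ?A" using \<eta>(1) by (intro mult_nonneg_nonneg zero_le_power) (auto intro: sum_nonneg)
    qed
    have "L2norm ?I (E k) \<le> L2norm ?I (\<lambda>u. of_real ?c * ?t u)"
      by (rule L2_dominated(2)[OF L2_cmult[OF tL] borel_measurable_lebesgue_on[OF mE] dom])
    also have "\<dots> = ?c * L2norm ?I ?t" unfolding L2norm_cmult norm_of_real abs_of_nonneg[OF c0] ..
    also have "\<dots> \<le> ?c * (\<eta> ^ Suc k * ?A)" using tn c0 by (rule mult_left_mono)
    also have "\<dots> = (2 * pi * \<eta>) ^ Suc k / fact (Suc k) * ?A"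
      unfolding power_mult_distrib by simp
    finally show "L2norm ?I (E k) \<le> (2 * pi * \<eta>) ^ Suc k / fact (Suc k) * ?A" .
  qed
  have A0: "0 \<le> ?A" by (simp add: sum_nonneg)
  have DKL: "DK K \<in> L2 ?I" for K
    unfolding DKE[abs_def] by (rule L2_sum[OF EL(1)])
  have DKn: "L2norm ?I (DK K) \<le> (exp (2 * pi * \<eta>) - 1) * ?A" for K
  proof -
    have "L2norm ?I (DK K) \<le> (\<Sum>k<K. L2norm ?I (E k))"
      unfolding DKE[abs_def] by (rule L2norm_sum_le[OF EL(1)])
    also have "\<dots> \<le> (\<Sum>k<K. (2 * pi * \<eta>) ^ Suc k / fact (Suc k) * ?A)"
      by (rule sum_mono[OF EL(2)])
    also have "\<dots> = (\<Sum>k<K. (2 * pi * \<eta>) ^ Suc k / fact (Suc k)) * ?A"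
      by (rule sum_distrib_right[symmetric])
    also have "\<dots> \<le> (exp (2 * pi * \<eta>) - 1) * ?A"
      by (rule mult_right_mono[OF sum_exp_tail_le A0]) (use \<eta>(1) in simp)
    finally show ?thesis .
  qed
  let ?W = "(\<Sum>n\<in>F. cmod (a n)) * 2 + (\<Sum>n\<in>F. cmod (a n)) * exp (2 * pi * \<eta>)"
  have DB: "cmod (D u) \<le> (\<Sum>n\<in>F. cmod (a n)) * 2" for u
    unfolding D_def sum_distrib_right
  proof (rule sum_norm_le)
    fix n
    show "cmod (a n * e1 (of_int n * u) * (e1 (\<delta> n * u) - 1)) \<le> cmod (a n) * 2"
      using norm_triangle_ineq4[of "e1 (\<delta> n * u)" 1] by (simp add: norm_mult mult_left_mono)
  qed
  have DKB: "cmod (DK K u) \<le> (\<Sum>n\<in>F. cmod (a n)) * exp (2 * pi * \<eta>)" if u: "u \<in> ?I" for K u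
    unfolding DK_def sum_distrib_right
  proof (rule sum_norm_le)
    fix n assume n: "n \<in> F"
    have "cmod (\<Sum>k<K. (2 * pi * \<i> * of_real (\<delta> n * u)) ^ Suc k / fact (Suc k)) \<le> (\<Sum>k<K. (2 * pi * \<eta>) ^ Suc k / fact (Suc k))"
    proof (rule sum_norm_le)
      fix k
      have "\<bar>\<delta> n\<bar> * \<bar>u\<bar> \<le> \<eta> * 1" using \<eta> n u by (intro mult_mono) auto
      then have "cmod (2 * pi * \<i> * of_real (\<delta> n * u)) \<le> 2 * pi * \<eta>" by (simp add: norm_mult abs_mult mult_left_mono)
      then have "cmod (2 * pi * \<i> * of_real (\<delta> n * u)) ^ Suc k \<le> (2 * pi * \<eta>) ^ Suc k" by (intro power_mono) auto
      then have "cmod (2 * pi * \<i> * of_real (\<delta> n * u)) ^ Suc k / fact (Suc k) \<le> (2 * pi * \<eta>) ^ Suc k / fact (Suc k)"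
        by (intro divide_right_mono) auto
      then show "cmod ((2 * pi * \<i> * of_real (\<delta> n * u)) ^ Suc k / fact (Suc k)) \<le> (2 * pi * \<eta>) ^ Suc k / fact (Suc k)"
        by (simp only: norm_divide norm_power norm_fact)
    qed
    also have "\<dots> \<le> exp (2 * pi * \<eta>)" using sum_exp_tail_le[of "2 * pi * \<eta>" K] \<eta>(1) by simp
    finally show "cmod (a n * e1 (of_int n * u) * (\<Sum>k<K. (2 * pi * \<i> * of_real (\<delta> n * u)) ^ Suc k / fact (Suc k))) \<le> cmod (a n) * exp (2 * pi * \<eta>)"
      unfolding norm_mult norm_e1 mult_1_right by (rule mult_left_mono) simp
  qed
  have DL: "D \<in> L2 ?I" by (rule L2_bounded[OF _ borel_measurable_lebesgue_on[OF mD] DB]) simp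
  have W0: "0 \<le> ?W" by (intro add_nonneg_nonneg mult_nonneg_nonneg sum_nonneg) auto
  \<comment> \<open>The bound for the partial sums passes to \<open>D\<close> by dominated
    convergence; the crude estimates \<open>DB\<close> and \<open>DKB\<close> only provide a
    constant dominating function.\<close>
  have "(\<lambda>K. L2norm ?I (\<lambda>u. D u - DK K u)) \<longlonglongrightarrow> 0"
  proof (rule L2norm_tendsto_0_dominated[where w="\<lambda>_. of_real ?W"])
    show "(\<lambda>u. D u - DK K u) \<in> borel_measurable (lebesgue_on ?I)" for K
      by (rule L2_measurable[OF L2_diff[OF DL DKL]])
    show "(\<lambda>_. of_real ?W) \<in> L2 ?I" by (rule L2_const)
    show "AE u in lebesgue_on ?I. (\<lambda>K. D u - DK K u) \<longlonglongrightarrow> 0"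
    proof (rule AE_I2)
      fix u
      have "(\<lambda>K. DK K u) \<longlonglongrightarrow> D u"
        unfolding DK_def D_def by (intro tendsto_intros e1_series)
      then have "(\<lambda>K. D u - DK K u) \<longlonglongrightarrow> D u - D u" by (intro tendsto_intros)
      then show "(\<lambda>K. D u - DK K u) \<longlonglongrightarrow> 0" by simp
    qed
    show "cmod (D u - DK K u) \<le> cmod (of_real ?W)" if "u \<in> ?I" for K u
      unfolding norm_of_real abs_of_nonneg[OF W0]
      using norm_triangle_ineq4[of "D u" "DK K u"] DB[of u] DKB[OF that, of K] by linarith
  qed
  then have "(\<lambda>K. (exp (2 * pi * \<eta>) - 1) * ?A + L2norm ?I (\<lambda>u. D u - DK K u)) \<longlonglongrightarrow> (exp (2 * pi * \<eta>) - 1) * ?A + 0"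
    by (intro tendsto_intros)
  then have "L2norm ?I D \<le> (exp (2 * pi * \<eta>) - 1) * ?A + 0"
  proof (rule LIMSEQ_le_const, intro exI[of _ 0] allI impI)
    fix K
    show "L2norm ?I D \<le> (exp (2 * pi * \<eta>) - 1) * ?A + L2norm ?I (\<lambda>u. D u - DK K u)"
      using L2norm_le_add_diff[OF DL DKL[of K]] DKn[of K] by linarith
  qed
  then show ?thesis unfolding D_def[abs_def] by simp
qed

lemma L2norm_dilate:
  assumes "0 < \<tau>" and [measurable]: "f \<in> borel_measurable borel"
  shows "L2norm {0..<\<tau>} f = sqrt \<tau> * L2norm {0..<1} (\<lambda>u. f (\<tau> * u))"
proof -
  have "(\<integral>t. (cmod (f t))^2 \<partial>lebesgue_on {0..<\<tau>}) = (\<integral>t. indicator {0..<\<tau>} t *\<^sub>R (cmod (f t))^2 \<partial>lborel)"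
    by (rule integral_lebesgue_on_borel) auto
  also have "\<dots> = \<tau> * (\<integral>u. indicator {0..<\<tau>} (\<tau> * u) * (cmod (f (\<tau> * u)))^2 \<partial>lborel)"
    using assms(1) by (subst lborel_integral_real_affine[where c=\<tau> and t=0]) auto
  also have "(\<integral>u. indicator {0..<\<tau>} (\<tau> * u) * (cmod (f (\<tau> * u)))^2 \<partial>lborel) = (\<integral>u. indicator {0..<1} u *\<^sub>R (cmod (f (\<tau> * u)))^2 \<partial>lborel)"
    using assms(1) by (intro Bochner_Integration.integral_cong) (auto simp: indicator_def zero_le_mult_iff)
  also have "\<dots> = (\<integral>u. (cmod (f (\<tau> * u)))^2 \<partial>lebesgue_on {0..<1})"
    by (rule integral_lebesgue_on_borel[symmetric]) auto
  finally show ?thesis unfolding L2norm_def by (simp add: real_sqrt_mult)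
qed

lemma trig_poly_image:
  assumes "inj_on lam F"
  shows "trig_poly (lam ` F) c t = (\<Sum>n\<in>F. c (lam n) * e1 (of_int (lam n) * t))"
  unfolding trig_poly_def using assms by (simp add: sum.reindex)

text \<open>On an arc of length \<tau> the frequencies n/\<tau> form an orthogonal basis. Rounding
  moves each by at most 1/2, which after rescaling the arc to length 1 is a shift by at most
  \<tau>/2, within reach of the perturbation bound. For the complementary frequencies, a polynomial
  g is matched on the arc by some h with rounded frequencies. Then g - h is small on the arc, yet
  its total mass is that of g plus that of h, as their frequencies are disjoint. So g cannot be
  concentrated on the arc.\<close>

lemma riesz_split_arc_at_0:
  assumes \<tau>: "0 < \<tau>" "\<tau> \<le> 1/10"
  shows "\<exists>L. riesz_split {y. frac y < \<tau>} L"
proof -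
  let ?S = "{y. frac y < \<tau>}" and ?I = "{0..<1::real}"
  define lam :: "int \<Rightarrow> int" where "lam n = round (of_int n / \<tau>)" for n
  define \<delta> where "\<delta> n = of_int (lam n) * \<tau> - of_int n" for n
  have d: "\<bar>\<delta> n\<bar> \<le> \<tau> / 2" for n
  proof -
    have "\<bar>of_int (lam n) - of_int n / \<tau>\<bar> \<le> 1/2" unfolding lam_def by (rule of_int_round_abs_le)
    then have "\<bar>of_int (lam n) - of_int n / \<tau>\<bar> * \<tau> \<le> 1/2 * \<tau>" using \<tau> by (intro mult_right_mono) auto
    moreover have "\<bar>of_int (lam n) - of_int n / \<tau>\<bar> * \<tau> = \<bar>(of_int (lam n) - of_int n / \<tau>) * \<tau>\<bar>" using \<tau> by (simp add: abs_mult)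
    moreover have "(of_int (lam n) - of_int n / \<tau>) * \<tau> = \<delta> n" using \<tau> by (simp add: \<delta>_def left_diff_distrib)
    ultimately show ?thesis by simp
  qed
  \<comment> \<open>Two rescaled shifts differ by at most \<tau> < 1, which is less than the
    distance of distinct integers.\<close>
  have inj: "inj lam"
  proof (rule injI)
    fix m n assume "lam m = lam n"
    then have "of_int m - of_int n = \<delta> n - \<delta> m" by (simp add: \<delta>_def)
    then have "\<bar>real_of_int m - of_int n\<bar> \<le> \<tau>" using d[of m] d[of n] by linarith
    then show "m = n" using \<tau> by linarith
  qed
  have injF: "inj_on lam F" for F using inj by (rule inj_on_subset) simp
  \<comment> \<open>The bound 1/10 on \<tau> is made for this: the exponent is at most 0.315, so the
    relative perturbation is at most 1/2.\<close>
  have ex: "exp (2 * pi * (\<tau> / 2)) - 1 \<le> 1/2"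
  proof -
    have "2 * pi * (\<tau> / 2) \<le> 3.15 * (1/10)"
      using \<tau> pi_approx mult_mono[of pi "3.15" \<tau> "1/10"] by simp
    then have "exp (2 * pi * (\<tau> / 2)) \<le> exp (0.315::real)" by simp
    also have "exp (0.315::real) \<le> 1 + 0.315 + 0.315^2" by (rule exp_bound) auto
    finally show ?thesis by (simp add: power2_eq_square)
  qed
  have per: "L2norm ?I (\<lambda>u. (\<Sum>n\<in>F. b n * e1 (of_int (lam n) * (\<tau> * u))) - trig_poly F b u) \<le> 1/2 * sqrt (\<Sum>n\<in>F. (cmod (b n))^2)"
    if "finite F" for F b
  proof -
    have "(\<Sum>n\<in>F. b n * e1 (of_int (lam n) * (\<tau> * u))) - trig_poly F b u = (\<Sum>n\<in>F. b n * e1 (of_int n * u) * (e1 (\<delta> n * u) - 1))" for u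
      unfolding trig_poly_def sum_subtractf[symmetric]
    proof (rule sum.cong[OF refl])
      fix n
      have "of_int (lam n) * (\<tau> * u) = of_int n * u + \<delta> n * u" by (simp add: \<delta>_def algebra_simps)
      then have "e1 (of_int (lam n) * (\<tau> * u)) = e1 (of_int n * u) * e1 (\<delta> n * u)" by (simp only: e1_add)
      then show "b n * e1 (of_int (lam n) * (\<tau> * u)) - b n * e1 (of_int n * u) = b n * e1 (of_int n * u) * (e1 (\<delta> n * u) - 1)"
        by (simp add: algebra_simps)
    qed
    then have "L2norm ?I (\<lambda>u. (\<Sum>n\<in>F. b n * e1 (of_int (lam n) * (\<tau> * u))) - trig_poly F b u) =
       L2norm ?I (\<lambda>u. \<Sum>n\<in>F. b n * e1 (of_int n * u) * (e1 (\<delta> n * u) - 1))" by simp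
    also have "\<dots> \<le> (exp (2 * pi * (\<tau> / 2)) - 1) * sqrt (\<Sum>n\<in>F. (cmod (b n))^2)"
      using \<tau> d by (intro perturbation_bound that) auto
    also have "\<dots> \<le> 1/2 * sqrt (\<Sum>n\<in>F. (cmod (b n))^2)" using ex by (intro mult_right_mono) (auto intro: sum_nonneg)
    finally show ?thesis .
  qed
  have SI: "?S \<inter> ?I = {0..<\<tau>}" using \<tau> by (auto simp: frac_eq)
  have SC: "- ?S \<inter> ?I = {\<tau>..<1}" using \<tau> by (auto simp: frac_eq not_less)
  have L2t: "trig_poly F b \<in> L2 {a'..<b'}" for F b a' b' by (rule trig_poly_L2) simp
  have L2s: "(\<lambda>u. \<Sum>n\<in>F. b n * e1 (of_int (lam n) * (\<tau> * u))) \<in> L2 ?I" if "finite F" for F b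
  proof (rule L2_bounded[where B="\<Sum>n\<in>F. cmod (b n)"])
    show "(\<lambda>u. \<Sum>n\<in>F. b n * e1 (of_int (lam n) * (\<tau> * u))) \<in> borel_measurable (lebesgue_on ?I)"
      by (rule borel_measurable_lebesgue_on) measurable
    show "cmod (\<Sum>n\<in>F. b n * e1 (of_int (lam n) * (\<tau> * u))) \<le> (\<Sum>n\<in>F. cmod (b n))" for u
      by (rule sum_norm_le) (simp add: norm_mult)
  qed simp
  have tpn: "L2norm ?I (trig_poly F b) = sqrt (\<Sum>n\<in>F. (cmod (b n))^2)" if "finite F" for F b
    using L2norm_trig_poly[OF that, of b] by (metis L2norm_nonneg real_sqrt_unique)
  \<comment> \<open>Half of the norm survives the perturbation, which is a quarter of its square;
    the factor \<tau> comes from the dilation.\<close>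
  have rs1: "riesz_seq ?S (range lam)"
  proof (rule riesz_seq_I[of "\<tau> / 4"])
    fix F' :: "int set" and a :: "int \<Rightarrow> complex" assume F': "finite F'" "F' \<subseteq> range lam"
    define F where "F = lam -` F'"
    have F: "finite F" "F' = lam ` F" using F' inj by (auto simp: F_def finite_vimageI)
    define b where "b n = a (lam n)" for n
    let ?A = "sqrt (\<Sum>n\<in>F. (cmod (b n))^2)"
    let ?g = "\<lambda>u. \<Sum>n\<in>F. b n * e1 (of_int (lam n) * (\<tau> * u))"
    have g: "trig_poly F' a (\<tau> * u) = ?g u" for u unfolding F(2) b_def by (rule trig_poly_image[OF injF])
    have "?A \<le> L2norm ?I ?g + L2norm ?I (\<lambda>u. trig_poly F b u - ?g u)"
      using L2norm_le_add_diff[OF L2t L2s[OF F(1)], of F b b] unfolding tpn[OF F(1)] .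
    also have "L2norm ?I (\<lambda>u. trig_poly F b u - ?g u) \<le> 1/2 * ?A"
      using per[OF F(1), of b] by (subst L2norm_minus_commute)
    finally have "?A / 2 \<le> L2norm ?I ?g" by simp
    then have "(?A / 2)^2 \<le> (L2norm ?I ?g)^2" by (intro power_mono) (auto intro: sum_nonneg)
    moreover have "?A^2 = (\<Sum>n\<in>F'. (cmod (a n))^2)"
      unfolding F(2) b_def by (simp add: sum.reindex[OF injF] sum_nonneg)
    ultimately have "(\<Sum>n\<in>F'. (cmod (a n))^2) / 4 \<le> (L2norm ?I ?g)^2" by (simp add: power_divide)
    then have "\<tau> * ((\<Sum>n\<in>F'. (cmod (a n))^2) / 4) \<le> \<tau> * (L2norm ?I ?g)^2" using \<tau> by (intro mult_left_mono) auto
    also have "\<dots> = (L2norm {0..<\<tau>} (trig_poly F' a))^2"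
      unfolding L2norm_dilate[OF \<tau>(1) trig_poly_measurable] g using \<tau> by (simp add: power_mult_distrib)
    finally show "\<tau> / 4 * (\<Sum>n\<in>F'. (cmod (a n))^2) \<le> (L2norm (?S \<inter> ?I) (trig_poly F' a))^2" unfolding SI by simp
  qed (use \<tau> in simp)
  have rs2: "riesz_seq (- ?S) (- range lam)"
  proof (rule riesz_seq_I[of "1 / (1 + 16 / \<tau>)"])
    fix G :: "int set" and b :: "int \<Rightarrow> complex" assume G: "finite G" "G \<subseteq> - range lam"
    define \<phi> where "\<phi> = L2norm {0..<\<tau>} (trig_poly G b)"
    define \<gamma> where "\<gamma> = L2norm {\<tau>..<1} (trig_poly G b)"
    have I: "?I = {0..<\<tau>} \<union> {\<tau>..<1}" "{0..<\<tau>} \<inter> {\<tau>..<1} = {}" using \<tau> by auto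
    have split: "(L2norm ?I (trig_poly H c))^2 = (L2norm {0..<\<tau>} (trig_poly H c))^2 + (L2norm {\<tau>..<1} (trig_poly H c))^2" for H c
      unfolding I(1) by (rule L2norm_sq_Un) (use I L2t[of H c 0 1] in auto)
    have tot: "(\<Sum>n\<in>G. (cmod (b n))^2) = \<phi>^2 + \<gamma>^2"
      unfolding \<phi>_def \<gamma>_def L2norm_trig_poly[OF G(1), symmetric] by (rule split)
    have pos: "0 \<le> \<phi>" "0 \<le> \<gamma>" by (simp_all add: \<phi>_def \<gamma>_def)
    \<comment> \<open>With \<phi> and \<gamma> the norms of g on and off the arc, the claim is that
      \<gamma> bounds \<phi>.\<close>
    have key: "\<phi>^2 \<le> 16 / \<tau> * \<gamma>^2"
    proof (cases "\<phi> = 0")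
      case True
      then show ?thesis using \<tau> by simp
    next
      case False
      then have \<phi>0: "0 < \<phi>" using pos by simp
      define \<psi> where "\<psi> = \<phi> / sqrt \<tau>"
      have st: "0 < sqrt \<tau>" using \<tau> by simp
      have \<psi>0: "0 < \<psi>" using \<phi>0 st by (simp add: \<psi>_def)
      let ?f = "\<lambda>u. trig_poly G b (\<tau> * u)"
      have fn: "L2norm ?I ?f = \<psi>"
        using L2norm_dilate[OF \<tau>(1) trig_poly_measurable, of G b] st by (simp add: \<psi>_def \<phi>_def)
      have fL: "?f \<in> L2 ?I"
        by (rule L2_bounded[where B="\<Sum>n\<in>G. cmod (b n)"]) (auto intro!: borel_measurable_lebesgue_on norm_trig_poly_le)
      \<comment> \<open>The rescaled g is approximated by a polynomial with frequencies n, and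
        replacing n by \<open>lam n\<close> gives h. The total relative error is 0.1 + 0.5 times 1.1
        = 0.65.\<close>
      obtain F a where F: "finite F" "L2norm ?I (\<lambda>u. ?f u - trig_poly F a u) < \<psi> / 10"
        using trig_poly_dense[OF fL, of "\<psi> / 10"] \<psi>0 by auto
      let ?A = "sqrt (\<Sum>n\<in>F. (cmod (a n))^2)"
      let ?h = "\<lambda>u. \<Sum>n\<in>F. a n * e1 (of_int (lam n) * (\<tau> * u))"
      have A: "?A \<le> 1.1 * \<psi>"
        using L2norm_le_add_diff[OF L2t fL, of F a] F(2)
        unfolding tpn[OF F(1)] fn L2norm_minus_commute[of ?I "trig_poly F a"] by simp
      have "L2norm ?I (\<lambda>u. ?f u - ?h u) \<le> L2norm ?I (\<lambda>u. ?f u - trig_poly F a u) + L2norm ?I (\<lambda>u. trig_poly F a u - ?h u)"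
        by (rule L2norm_triangle_mid[OF fL L2t L2s[OF F(1)]])
      also have "L2norm ?I (\<lambda>u. trig_poly F a u - ?h u) \<le> 1/2 * ?A"
        using per[OF F(1), of a] by (subst L2norm_minus_commute)
      finally have fh: "L2norm ?I (\<lambda>u. ?f u - ?h u) \<le> 0.65 * \<psi>" using F(2) A by simp
      \<comment> \<open>These are the coefficients of g - h; there is no overlap because G avoids
        the range of \<open>lam\<close>.\<close>
      define c where "c k = (if k \<in> G then b k else - a (inv lam k))" for k
      have disj: "G \<inter> lam ` F = {}" using G(2) by auto
      have cl: "c (lam n) = - a n" if "n \<in> F" for n
        using that G(2) inj by (auto simp: c_def)
      have gh: "trig_poly (G \<union> lam ` F) c t = trig_poly G b t - (\<Sum>n\<in>F. a n * e1 (of_int (lam n) * t))" for t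
      proof -
        have "trig_poly (G \<union> lam ` F) c t = trig_poly G c t + trig_poly (lam ` F) c t"
          unfolding trig_poly_def using G(1) F(1) disj by (intro sum.union_disjoint) auto
        also have "trig_poly G c t = trig_poly G b t" unfolding trig_poly_def by (intro sum.cong) (auto simp: c_def)
        also have "trig_poly (lam ` F) c t = (\<Sum>n\<in>F. - (a n * e1 (of_int (lam n) * t)))"
          unfolding trig_poly_image[OF injF] by (intro sum.cong refl) (simp add: cl)
        finally show ?thesis by (simp add: sum_negf)
      qed
      have "L2norm {0..<\<tau>} (trig_poly (G \<union> lam ` F) c) = sqrt \<tau> * L2norm ?I (\<lambda>u. ?f u - ?h u)"
        unfolding L2norm_dilate[OF \<tau>(1) trig_poly_measurable] gh ..
      also have "\<dots> \<le> sqrt \<tau> * (0.65 * \<psi>)" using fh st by (intro mult_left_mono) auto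
      also have "\<dots> = 0.65 * \<phi>" using st by (simp add: \<psi>_def)
      finally have b1: "L2norm {0..<\<tau>} (trig_poly (G \<union> lam ` F) c) \<le> 0.65 * \<phi>" .
      have totc: "(L2norm ?I (trig_poly (G \<union> lam ` F) c))^2 = \<phi>^2 + \<gamma>^2 + ?A^2"
      proof -
        have "(L2norm ?I (trig_poly (G \<union> lam ` F) c))^2 = (\<Sum>n\<in>G \<union> lam ` F. (cmod (c n))^2)"
          using G(1) F(1) by (intro L2norm_trig_poly) auto
        also have "\<dots> = (\<Sum>n\<in>G. (cmod (c n))^2) + (\<Sum>n\<in>lam ` F. (cmod (c n))^2)"
          using G(1) F(1) disj by (intro sum.union_disjoint) auto
        also have "(\<Sum>n\<in>G. (cmod (c n))^2) = (\<Sum>n\<in>G. (cmod (b n))^2)" by (intro sum.cong) (auto simp: c_def)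
        also have "(\<Sum>n\<in>lam ` F. (cmod (c n))^2) = (\<Sum>n\<in>F. (cmod (a n))^2)"
          by (simp add: sum.reindex[OF injF] cl)
        finally show ?thesis by (simp add: tot sum_nonneg)
      qed
      have hA: "L2norm {\<tau>..<1} (\<lambda>t. \<Sum>n\<in>F. a n * e1 (of_int (lam n) * t)) \<le> ?A"
      proof -
        have e: "(\<lambda>t. \<Sum>n\<in>F. a n * e1 (of_int (lam n) * t)) = trig_poly (lam ` F) (\<lambda>k. a (inv lam k))"
          unfolding fun_eq_iff trig_poly_image[OF injF] using inj by simp
        have "(L2norm {\<tau>..<1} (trig_poly (lam ` F) (\<lambda>k. a (inv lam k))))^2 \<le> (L2norm ?I (trig_poly (lam ` F) (\<lambda>k. a (inv lam k))))^2"
          unfolding split by simp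
        also have "\<dots> = ?A^2"
          using F(1) inj by (subst L2norm_trig_poly) (auto simp: sum.reindex[OF injF] sum_nonneg)
        finally show ?thesis unfolding e by (rule power2_le_imp_le) (simp add: sum_nonneg)
      qed
      have hL: "(\<lambda>t. \<Sum>n\<in>F. a n * e1 (of_int (lam n) * t)) \<in> L2 {\<tau>..<1}"
      proof -
        have "(\<lambda>t. \<Sum>n\<in>F. a n * e1 (of_int (lam n) * t)) = trig_poly (lam ` F) (\<lambda>k. a (inv lam k))"
          unfolding fun_eq_iff trig_poly_image[OF injF] using inj by simp
        then show ?thesis using L2t by simp
      qed
      have b2: "L2norm {\<tau>..<1} (trig_poly (G \<union> lam ` F) c) \<le> \<gamma> + ?A"
        using L2norm_triangle_diff[OF L2t hL, of G b] hA unfolding gh[abs_def] \<gamma>_def[symmetric] by linarith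
      \<comment> \<open>The squares of \<gamma> and \<open>?A\<close> cancel, so the share 1 -
        0.65^2 = 0.5775 of \<phi>^2 must come from the cross term of \<gamma> and \<open>?A\<close>.
        The constant 4 reached below exceeds 2.2 / 0.5775.\<close>
      have "\<phi>^2 + \<gamma>^2 + ?A^2 \<le> (0.65 * \<phi>)^2 + (\<gamma> + ?A)^2"
        unfolding totc[symmetric] split using b1 b2 by (intro add_mono power_mono) auto
      then have "0.5775 * \<phi>^2 \<le> 2 * \<gamma> * ?A"
        unfolding power_mult_distrib power2_sum by (simp add: power2_eq_square)
      also have "\<dots> \<le> 2 * \<gamma> * (1.1 * (\<phi> / sqrt \<tau>))" using A pos unfolding \<psi>_def by (intro mult_left_mono) auto
      finally have "\<phi> * (0.5775 * \<phi>) \<le> \<phi> * (2.2 * \<gamma> / sqrt \<tau>)" by (simp add: power2_eq_square mult_ac)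
      then have "0.5775 * \<phi> \<le> 2.2 * \<gamma> / sqrt \<tau>" using \<phi>0 by (simp only: mult_le_cancel_left_pos)
      moreover have "0 \<le> \<gamma> / sqrt \<tau>" using pos st by simp
      ultimately have "\<phi> \<le> 4 * (\<gamma> / sqrt \<tau>)" by simp
      then have "\<phi>^2 \<le> (4 * (\<gamma> / sqrt \<tau>))^2" using pos by (intro power_mono)
      also have "\<dots> = 16 / \<tau> * \<gamma>^2" using \<tau> by (simp add: power_mult_distrib power_divide)
      finally show ?thesis .
    qed
    have p: "0 < 1 + 16 / \<tau>" using \<tau> by (simp add: add_pos_pos)
    have "(\<Sum>n\<in>G. (cmod (b n))^2) \<le> (1 + 16 / \<tau>) * \<gamma>^2" unfolding tot using key by (simp add: distrib_right)
    then have "1 / (1 + 16 / \<tau>) * (\<Sum>n\<in>G. (cmod (b n))^2) \<le> \<gamma>^2"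
      using p by (simp add: pos_divide_le_eq mult.commute)
    then show "1 / (1 + 16 / \<tau>) * (\<Sum>n\<in>G. (cmod (b n))^2) \<le> (L2norm (- ?S \<inter> ?I) (trig_poly G b))^2"
      unfolding SC \<gamma>_def .
  next
    show "0 < 1 / (1 + 16 / \<tau>)" using \<tau> by (simp add: add_pos_pos)
  qed
  show ?thesis using rs1 rs2 unfolding riesz_split_def by (intro exI conjI)
qed

text \<open>A translation multiplies the coefficients by unimodular numbers, so the constant is
  preserved.\<close>

lemma riesz_seq_shift:
  assumes S [measurable]: "S \<in> sets borel" and per: "\<And>y. y + 1 \<in> S \<longleftrightarrow> y \<in> S" and rs: "riesz_seq S L"
  shows "riesz_seq {y. y - s \<in> S} L"
proof -
  obtain c where c: "0 < c" "\<And>F a. finite F \<Longrightarrow> F \<subseteq> L \<Longrightarrow> c * (\<Sum>n\<in>F. (cmod (a n))^2) \<le> (L2norm (S \<inter> {0..<1}) (trig_poly F a))^2"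
    using rs unfolding riesz_seq_def by blast
  show ?thesis
  proof (rule riesz_seq_I[OF c(1)])
    fix F :: "int set" and a :: "int \<Rightarrow> complex" assume F: "finite F" "F \<subseteq> L"
    define a' where "a' n = a n * e1 (of_int n * s)" for n
    define f where "f y = indicator S y * (cmod (trig_poly F a' y))^2" for y
    have tp': "trig_poly F a' y = trig_poly F a (y + s)" for y
      by (simp add: trig_poly_def a'_def distrib_left e1_add mult_ac)
    have T: "{y. y - s \<in> S} \<in> sets borel" by measurable
    have fm: "f \<in> borel_measurable borel" unfolding f_def by measurable
    have "c * (\<Sum>n\<in>F. (cmod (a n))^2) = c * (\<Sum>n\<in>F. (cmod (a' n))^2)" by (simp add: a'_def norm_mult)
    also have "\<dots> \<le> (L2norm (S \<inter> {0..<1}) (trig_poly F a'))^2" by (rule c(2)[OF F])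
    also have "\<dots> = (\<integral>y. f y \<partial>lebesgue_on {0..<1})"
      unfolding f_def by (rule L2norm_sq_Int_borel[OF S trig_poly_measurable])
    also have "\<dots> = (\<integral>y. f (y + (- s)) \<partial>lebesgue_on {0..<1})"
    proof (rule integral_periodic_shift[OF fm, symmetric])
      show "f (y + 1) = f y" for y unfolding f_def trig_poly_periodic by (simp add: per indicator_def)
      show "\<bar>f y\<bar> \<le> (\<Sum>n\<in>F. cmod (a' n))^2" for y
      proof -
        have "(cmod (trig_poly F a' y))^2 \<le> (\<Sum>n\<in>F. cmod (a' n))^2" by (intro power_mono norm_trig_poly_le) simp
        then show ?thesis by (auto simp: f_def indicator_def)
      qed
    qed
    also have "\<dots> = (\<integral>y. indicator {y. y - s \<in> S} y * (cmod (trig_poly F a y))^2 \<partial>lebesgue_on {0..<1})"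
      unfolding f_def tp' by (simp add: indicator_def)
    also have "\<dots> = (L2norm ({y. y - s \<in> S} \<inter> {0..<1}) (trig_poly F a))^2"
      by (rule L2norm_sq_Int_borel[OF T trig_poly_measurable, symmetric])
    finally show "c * (\<Sum>n\<in>F. (cmod (a n))^2) \<le> (L2norm ({y. y - s \<in> S} \<inter> {0..<1}) (trig_poly F a))^2" .
  qed
qed

lemma riesz_split_arc:
  assumes \<tau>: "0 < \<tau>" "\<tau> \<le> 1/10"
  shows "\<exists>L. riesz_split {y. frac (y - s) < \<tau>} L"
proof -
  let ?S = "{y. frac y < \<tau>}"
  obtain L where L: "riesz_seq ?S L" "riesz_seq (- ?S) (- L)" using riesz_split_arc_at_0[OF \<tau>] unfolding riesz_split_def by blast
  have S: "?S \<in> sets borel" unfolding frac_def by measurable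
  have f1: "frac (y + 1) = frac y" for y :: real by (simp add: frac_def)
  have "riesz_seq {y. y - s \<in> ?S} L" by (rule riesz_seq_shift[OF S _ L(1)]) (simp add: f1)
  moreover have "riesz_seq {y. y - s \<in> - ?S} (- L)" by (rule riesz_seq_shift[OF _ _ L(2)]) (use S f1 in auto)
  moreover have "{y. y - s \<in> - ?S} = - {y. y - s \<in> ?S}" by auto
  ultimately have "riesz_split {y. y - s \<in> ?S} L" unfolding riesz_split_def by simp
  then show ?thesis by auto
qed

subsection \<open>Step sets have Riesz bases of integer frequencies\<close>

lemma floor_diff_frac:
  fixes z :: real
  assumes "0 < \<tau>" "\<tau> < 1"
  shows "\<lfloor>z\<rfloor> - \<lfloor>z - \<tau>\<rfloor> = (if frac z < \<tau> then 1 else 0)"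
proof (cases "frac z < \<tau>")
  case True
  then have "\<lfloor>z - \<tau>\<rfloor> = \<lfloor>z\<rfloor> - 1" using assms unfolding floor_eq_iff frac_def by auto linarith+
  with True show ?thesis by simp
next
  case False
  then have "\<lfloor>z - \<tau>\<rfloor> = \<lfloor>z\<rfloor>" using assms unfolding floor_eq_iff frac_def by auto linarith+
  with False show ?thesis by simp
qed

text \<open>Here \<open>S\<close> is an arc of arbitrary length. If N (q - p) lies just above an
  integer, the folded arc has multiplicity K or K + 1, and the points with K + 1 form an arc of
  length \<tau>.\<close>

lemma riesz_split_two_jumps:
  assumes h: "\<And>y. stepf c {p, q} \<epsilon> y = (if y \<in> S then 1 else 0)" and pq: "p \<noteq> q" "\<epsilon> p = 1" "\<epsilon> q = -1"
    and irr: "q - p \<notin> \<rat>" and S: "S \<in> sets borel"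
  shows "\<exists>L. riesz_split S L"
proof -
  \<comment> \<open>Centre and radius 1/20 place the fractional part strictly between 0 and 1/10, as
    the lemma on short arcs requires.\<close>
  obtain N :: nat where N: "N > 0" "\<bar>frac (real N * (q - p)) - 1/20\<bar> < 1/20"
    using Kronecker_approx_1_explicit[OF irr, of "1/20" "1/20"] by auto
  define \<tau> where "\<tau> = frac (real N * (q - p))"
  have \<tau>: "0 < \<tau>" "\<tau> < 1/10" using N(2) unfolding \<tau>_def by linarith+
  define s where "s = real N * p"
  define K where "K = int N * c + \<lfloor>real N * (q - p)\<rfloor>"
  have fold: "int (fold_mult N S y) = K + (if frac (y - s) < \<tau> then 1 else 0)" for y
  proof -
    have "int (fold_mult N S y) = int N * c + (\<lfloor>y - real N * p\<rfloor> - \<lfloor>y - real N * q\<rfloor>)"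
      unfolding fold_mult_stepf[OF h N(1)] using pq by simp
    also have "y - real N * q = (y - s) - \<tau> - of_int \<lfloor>real N * (q - p)\<rfloor>"
      unfolding \<tau>_def frac_def s_def by (simp add: algebra_simps)
    also have "\<lfloor>\<dots>\<rfloor> = \<lfloor>(y - s) - \<tau>\<rfloor> - \<lfloor>real N * (q - p)\<rfloor>" by (rule floor_diff_of_int)
    also have "y - real N * p = y - s" by (simp add: s_def)
    finally show ?thesis using floor_diff_frac[of \<tau> "y - s"] \<tau> unfolding K_def by linarith
  qed
  show ?thesis
  proof (rule riesz_split_combine[OF S N(1)])
    fix m
    have eq: "{y. m \<le> fold_mult N S y} = {y. int m \<le> K + (if frac (y - s) < \<tau> then 1 else 0)}"
      by (simp flip: fold)
    consider "int m \<le> K" | "int m = K + 1" | "int m > K + 1" by linarith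
    then show "\<exists>L. riesz_split {y. m \<le> fold_mult N S y} L"
    proof cases
      case 1
      then have "{y. m \<le> fold_mult N S y} = UNIV" unfolding eq by auto
      then show ?thesis using riesz_split_UNIV by auto
    next
      case 2
      then have "{y. m \<le> fold_mult N S y} = {y. frac (y - s) < \<tau>}" unfolding eq by auto
      then show ?thesis using riesz_split_arc[of \<tau> s] \<tau> by simp
    next
      case 3
      then have "{y. m \<le> fold_mult N S y} = {}" unfolding eq by auto
      then show ?thesis using riesz_split_empty by auto
    qed
  qed
qed

theorem riesz_split_step_set:
  assumes "step_set n S"
  shows "\<exists>L. riesz_split S L"
  using assms
proof (induction n arbitrary: S rule: less_induct)
  case (less n)
  obtain c Y \<epsilon> where Y: "finite Y" "Y \<subseteq> {0..<1}" "sum \<epsilon> Y = 0" and card: "card Y = n"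
    and h: "\<And>y. stepf c Y \<epsilon> y = (if y \<in> S then 1 else 0)"
    using less.prems unfolding step_set_def by blast
  have S: "S \<in> sets borel" by (rule step_set_borel[OF less.prems])
  show ?case
  proof (cases "\<exists>p\<in>Y. \<epsilon> p = 0")
    case True
    \<comment> \<open>Zero jumps are discarded first, since the other cases rely on every jump being
      1 or -1.\<close>
    then have "card {p \<in> Y. \<epsilon> p \<noteq> 0} < n" unfolding card[symmetric] using Y(1) by (intro psubset_card_mono) auto
    then show ?thesis using less.IH step_setI[OF Y h] by blast
  next
    case False
    have one: "\<bar>\<epsilon> p\<bar> = 1" if "p \<in> Y" for p
      using step_set_jump_bound[OF Y(1,2) h that] False that by force
    define Z where "Z N = (\<lambda>p. frac (real N * p)) ` Y" for N
    define eN where "eN N q = (\<Sum>x\<in>{x\<in>Y. frac (real N * x) = q}. \<epsilon> x)" for N q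
    define cN where "cN N = int N * c - (\<Sum>x\<in>Y. \<epsilon> x * \<lfloor>real N * x\<rfloor>)" for N
    have fm: "int (fold_mult N S y) = stepf (cN N) (Z N) (eN N) y" if "N > 0" for N y
      unfolding fold_mult_stepf[OF h that] cN_def Z_def eN_def[abs_def] by (rule stepf_normalize(1)[OF Y(1)])
    have Zf: "finite (Z N)" "Z N \<subseteq> {0..<1}" for N using Y(1) by (auto simp: Z_def frac_lt_1)
    have Zs: "sum (eN N) (Z N) = 0" for N
      unfolding Z_def eN_def[abs_def] using stepf_normalize(2)[OF Y(1), where \<phi>="\<lambda>x. real N * x" and \<epsilon>=\<epsilon>] Y(3) by simp
    have Zc: "card (Z N) \<le> n" for N unfolding Z_def card[symmetric] by (rule card_image_le[OF Y(1)])
    \<comment> \<open>The common exit of the rational case and of the case of many jumps: some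
      folding after which no superlevel set keeps all n jumps.\<close>
    have fin: "\<exists>L. riesz_split S L" if N: "N > 0" and
      J: "\<And>k. card {p \<in> Z N. (k \<le> stepf (cN N) (Z N) (eN N) p) \<noteq> (k \<le> stepf (cN N) (Z N) (eN N) p - eN N p)} < n" for N
    proof (rule riesz_split_combine[OF S N])
      fix k
      have "{y. k \<le> fold_mult N S y} = {y. int k \<le> stepf (cN N) (Z N) (eN N) y}"
        by (simp flip: fm[OF N])
      then show "\<exists>L. riesz_split {y. k \<le> fold_mult N S y} L"
        using less.IH[OF J superlevel_step_set[OF Zf Zs]] by simp
    qed
    show ?thesis
    proof (cases "\<exists>p\<in>Y. \<exists>q\<in>Y. p \<noteq> q \<and> p - q \<in> \<rat>")
      case True
      then obtain p q where pq: "p \<in> Y" "q \<in> Y" "p \<noteq> q" "p - q \<in> \<rat>" by blast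
      obtain a b where ab: "b > 0" "p - q = of_int a / of_int b" using pq(4) by (meson Rats_cases')
      \<comment> \<open>With the denominator of p - q as N, the points N p and N q agree modulo 1
        and two jumps merge.\<close>
      define N where "N = nat b"
      have N: "N > 0" "real N = of_int b" using ab(1) by (auto simp: N_def)
      have "real N * p = real N * q + of_int a" using ab N by (simp add: field_simps)
      then have "frac (real N * p) = frac (real N * q)" by (simp add: frac_def)
      then have "\<not> inj_on (\<lambda>p. frac (real N * p)) Y" using pq by (auto simp: inj_on_def)
      then have "card (Z N) \<noteq> card Y" unfolding Z_def using eq_card_imp_inj_on[OF Y(1)] by blast
      then have lt: "card (Z N) < n" using Zc[of N] card by linarith
      show ?thesis
      proof (rule fin[OF N(1)])
        fix k
        show "card {p \<in> Z N. (k \<le> stepf (cN N) (Z N) (eN N) p) \<noteq> (k \<le> stepf (cN N) (Z N) (eN N) p - eN N p)} < n"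
          by (rule le_less_trans[OF card_mono[OF Zf(1)] lt]) auto
      qed
    next
      case False
      then have irr: "p - q \<notin> \<rat>" if "p \<in> Y" "q \<in> Y" "p \<noteq> q" for p q using that by blast
      consider "n = 0" | "n = 1" | "n = 2" | "n \<ge> 3" by linarith
      then show ?thesis
      proof cases
        case 1
        then have "Y = {}" using card Y(1) by simp
        then have "(if y \<in> S then 1 else 0) = c" for y using h[of y] by (simp add: stepf_def)
        then have "S = UNIV \<or> S = {}" by (metis UNIV_eq_I equals0I zero_neq_one)
        then show ?thesis using riesz_split_UNIV riesz_split_empty by auto
      next
        case 2
        then obtain p where "Y = {p}" using card by (auto simp: card_1_singleton_iff)
        then show ?thesis using Y(3) one by fastforce
      next
        case 3
        then obtain p q where pq: "Y = {p, q}" "p \<noteq> q" using card by (auto simp: card_2_iff)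
        then have s: "\<epsilon> p + \<epsilon> q = 0" using Y(3) by simp
        consider "\<epsilon> p = 1" | "\<epsilon> p = -1" using one[of p] pq by force
        then show ?thesis
        proof cases
          case 1
          show ?thesis
          proof (rule riesz_split_two_jumps[of c p q \<epsilon> S])
            show "stepf c {p, q} \<epsilon> y = (if y \<in> S then 1 else 0)" for y using h pq(1) by simp
            show "q - p \<notin> \<rat>" using irr[of q p] pq by auto
          qed (use 1 s pq S in auto)
        next
          case 2
          show ?thesis
          proof (rule riesz_split_two_jumps[of c q p \<epsilon> S])
            show "stepf c {q, p} \<epsilon> y = (if y \<in> S then 1 else 0)" for y using h pq(1) by (simp add: insert_commute)
            show "p - q \<notin> \<rat>" using irr[of p q] pq by auto
          qed (use 2 s pq S in auto)
        qed
      next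
        case 4
        have sq: "(\<epsilon> p)^2 = 1" if "p \<in> Y" for p
          using one[OF that] by (metis power2_abs one_power2)
        then have sum_sq: "(\<Sum>p\<in>Y. (\<epsilon> p)^2) = int n" using card by simp
        \<comment> \<open>A jump and its square have the same parity, so n has the parity of the sum
          of the jumps, which is 0. This rules out three jumps and yields the bound 4.\<close>
        have "even (\<Sum>p\<in>Y. (\<epsilon> p)^2 - \<epsilon> p)" by (rule dvd_sum) simp
        then have "even (int n)" using sum_sq Y(3) by (simp add: sum_subtractf)
        then have "n \<noteq> 3" by auto
        then have four: "4 \<le> (\<Sum>p\<in>Y. (\<epsilon> p)^2)" using sum_sq 4 by simp
        have "\<exists>N>0. pi^2 / 2 < (cmod (\<Sum>p\<in>Y. of_int (\<epsilon> p) * e1 (- of_int 1 * (real N * p))))^2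
            + (cmod (\<Sum>p\<in>Y. of_int (\<epsilon> p) * e1 (- of_int 2 * (real N * p))))^2 / 4"
          by (rule exists_large_exponential_sum[OF Y(1) _ four]) (rule irr)
        then obtain N where N: "N > 0" and large: "pi^2 / 2 < (cmod (\<Sum>p\<in>Y. of_int (\<epsilon> p) * e1 (- of_int 1 * (real N * p))))^2
            + (cmod (\<Sum>p\<in>Y. of_int (\<epsilon> p) * e1 (- of_int 2 * (real N * p))))^2 / 4"
          by (elim exE conjE)
        \<comment> \<open>Irrational differences keep the jumps apart under every folding, so all
          heights remain 1 or -1 and the exponential sums of the folded function are those over Y at
          N p.\<close>
        have inj: "inj_on (\<lambda>p. frac (real N * p)) Y"
        proof (rule inj_onI, rule ccontr)
          fix p q assume pq: "p \<in> Y" "q \<in> Y" "frac (real N * p) = frac (real N * q)" "p \<noteq> q"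
          have "real N * p - real N * q = of_int (\<lfloor>real N * p\<rfloor> - \<lfloor>real N * q\<rfloor>)" using pq(3) by (simp add: frac_def)
          then have "p - q = of_int (\<lfloor>real N * p\<rfloor> - \<lfloor>real N * q\<rfloor>) / of_int (int N)" using N by (simp add: field_simps)
          then have "p - q \<in> \<rat>" by (metis Rats_divide Rats_of_int)
          then show False using irr pq by blast
        qed
        have eNv: "eN N (frac (real N * p)) = \<epsilon> p" if "p \<in> Y" for p
        proof -
          have "{x\<in>Y. frac (real N * x) = frac (real N * p)} = {p}" using inj that by (auto simp: inj_on_def)
          then show ?thesis by (simp add: eN_def)
        qed
        have oneN: "\<bar>eN N q\<bar> = 1" if "q \<in> Z N" for q using that eNv one by (auto simp: Z_def)
        have ZP: "(\<Sum>q\<in>Z N. of_int (eN N q) * e1 (- of_int k * q)) = (\<Sum>p\<in>Y. of_int (\<epsilon> p) * e1 (- of_int k * (real N * p)))" for k :: int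
        proof -
          have "(\<Sum>q\<in>Z N. of_int (eN N q) * e1 (- of_int k * q)) = (\<Sum>p\<in>Y. of_int (eN N (frac (real N * p))) * e1 (- of_int k * frac (real N * p)))"
            unfolding Z_def by (subst sum.reindex[OF inj]) (simp only: o_def)
          also have "\<dots> = (\<Sum>p\<in>Y. of_int (\<epsilon> p) * e1 (- of_int k * (real N * p)))"
          proof (rule sum.cong[OF refl])
            fix p assume p: "p \<in> Y"
            have "- of_int k * frac (real N * p) = - of_int k * (real N * p) + of_int (k * \<lfloor>real N * p\<rfloor>)"
              by (simp add: frac_def algebra_simps)
            then have "e1 (- of_int k * frac (real N * p)) = e1 (- of_int k * (real N * p))"
              by (simp only: e1_add_Ints Ints_of_int)
            then show "of_int (eN N (frac (real N * p))) * e1 (- of_int k * frac (real N * p)) = of_int (\<epsilon> p) * e1 (- of_int k * (real N * p))"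
              by (simp only: eNv[OF p])
          qed
          finally show ?thesis .
        qed
        show ?thesis
        proof (rule fin[OF N], rule ccontr)
          fix k
          let ?T = "{p \<in> Z N. (k \<le> stepf (cN N) (Z N) (eN N) p) \<noteq> (k \<le> stepf (cN N) (Z N) (eN N) p - eN N p)}"
          assume "\<not> card ?T < n"
          \<comment> \<open>A level crossed by all n jumps would leave only two multiplicities,
            which the choice of N excludes.\<close>
          then have "card (Z N) \<le> card ?T" using Zc[of N] by linarith
          then have "?T = Z N" by (intro card_seteq Zf(1)) auto
          then have all: "(k \<le> stepf (cN N) (Z N) (eN N) p) \<noteq> (k \<le> stepf (cN N) (Z N) (eN N) p - eN N p)" if "p \<in> Z N" for p
            using that by blast
          have "Z N \<noteq> {}" using 4 card by (auto simp: Z_def)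
          then have "stepf (cN N) (Z N) (eN N) y \<in> {k - 1, k}" for y
            by (rule two_valued_if_all_jumps[OF Zf Zs _ oneN all])
          from two_valued_imp_small[OF Zf Zs this] large show False
            unfolding ZP by linarith
        qed
      qed
    qed
  qed
qed

subsection \<open>From the circle to \<open>L2\<close>\<close>

lemma lmeasurable_Int_unit:
  assumes "S \<in> sets borel"
  shows "S \<inter> {0..<1::real} \<in> lmeasurable"
  using assms by (intro bounded_set_imp_lmeasurable) (auto intro: bounded_subset[of "{0..<1}"])

text \<open>A polynomial with frequencies outside \<open>L\<close> has a fixed share of its mass outside \<open>S\<close>, so dropping
these frequencies from a good approximation of \<open>g\<close> leaves an error smaller than \<open>g\<close> by a fixed factor.\<close>

lemma riesz_split_approx_step:
  assumes S: "S \<in> sets borel" and rb: "riesz_split S L"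
  obtains r where "0 \<le> r" "r < 1" "\<And>g. g \<in> L2 (S \<inter> {0..<1}) \<Longrightarrow>
    \<exists>F a. finite F \<and> F \<subseteq> L \<and> L2norm (S \<inter> {0..<1}) (\<lambda>x. g x - trig_poly F a x) \<le> r * L2norm (S \<inter> {0..<1}) g"
proof -
  let ?I = "{0..<1::real}"
  let ?T = "S \<inter> ?I"
  have Tm: "?T \<in> lmeasurable" by (rule lmeasurable_Int_unit[OF S])
  have Tl: "?T \<in> sets lebesgue" "- S \<inter> ?I \<in> sets lebesgue" using S by auto
  obtain c0 where c0: "0 < c0" "\<And>F a. finite F \<Longrightarrow> F \<subseteq> - L \<Longrightarrow> c0 * (\<Sum>n\<in>F. (cmod (a n))^2) \<le> (L2norm (- S \<inter> ?I) (trig_poly F a))^2"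
    using rb unfolding riesz_split_def riesz_seq_def by blast
  \<comment> \<open>Capping at 1 keeps 1 - c nonnegative, so that its square root q is
    available.\<close>
  define c where "c = min c0 1"
  have c: "0 < c" "c \<le> 1" "\<And>F a. finite F \<Longrightarrow> F \<subseteq> - L \<Longrightarrow> c * (\<Sum>n\<in>F. (cmod (a n))^2) \<le> (L2norm (- S \<inter> ?I) (trig_poly F a))^2"
  proof -
    fix F a assume F: "finite F" "F \<subseteq> - L"
    have "c * (\<Sum>n\<in>F. (cmod (a n))^2) \<le> c0 * (\<Sum>n\<in>F. (cmod (a n))^2)"
      by (intro mult_right_mono sum_nonneg) (auto simp: c_def)
    also note c0(2)[OF F]
    finally show "c * (\<Sum>n\<in>F. (cmod (a n))^2) \<le> (L2norm (- S \<inter> ?I) (trig_poly F a))^2" .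
  qed (use c0(1) in \<open>auto simp: c_def\<close>)
  define q where "q = sqrt (1 - c)"
  have q: "0 \<le> q" "q < 1" "q^2 = 1 - c" using c by (auto simp: q_def)
  show thesis
  proof (rule that[of "(1 + q) / 2"])
    fix g assume g: "g \<in> L2 ?T"
    define G where "G = L2norm ?T g"
    show "\<exists>F a. finite F \<and> F \<subseteq> L \<and> L2norm ?T (\<lambda>x. g x - trig_poly F a x) \<le> (1 + q) / 2 * L2norm ?T g"
    proof (cases "G = 0")
      case True
      then show ?thesis by (intro exI[of _ "{}"]) (simp add: trig_poly_def G_def)
    next
      case False
      then have G: "0 < G" using L2norm_nonneg[of ?T g] unfolding G_def by linarith
      \<comment> \<open>The target factor (1 + q)/2 exceeds q by (1 - q)/2, and exactly this room is
        used up by the error 2 \<eta>.\<close>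
      define \<eta> where "\<eta> = (1 - q) / 4 * G"
      have \<eta>: "0 < \<eta>" using G q by (simp add: \<eta>_def)
      \<comment> \<open>Extension by 0 keeps the norm, so a polynomial close to \<open>g0\<close>
        has norm at most G + \<eta> on the whole circle.\<close>
      define g0 where "g0 x = (if x \<in> ?T then g x else 0)" for x
      have g0: "g0 \<in> L2 ?I"
      proof (rule L2_I)
        show "g0 \<in> borel_measurable (lebesgue_on ?I)"
          unfolding g0_def[abs_def] using Tl L2_measurable[OF g] by (subst borel_measurable_if_lebesgue_on) auto
        have "integrable lebesgue (\<lambda>t. indicator ?T t *\<^sub>R (cmod (g t))^2)"
          using L2_integrable[OF g] Tl(1) by (simp add: integrable_restrict_space)
        moreover have "(\<lambda>t. indicator ?T t *\<^sub>R (cmod (g t))^2) = (\<lambda>t. indicator ?I t *\<^sub>R (cmod (g0 t))^2)"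
          by (auto simp: fun_eq_iff g0_def indicator_def)
        ultimately show "integrable (lebesgue_on ?I) (\<lambda>t. (cmod (g0 t))^2)"
          by (simp add: integrable_restrict_space)
      qed
      have g0n: "L2norm ?I g0 = G"
      proof -
        have U: "?I = ?T \<union> (- S \<inter> ?I)" by auto
        have "(L2norm (?T \<union> (- S \<inter> ?I)) g0)^2 = (L2norm ?T g0)^2 + (L2norm (- S \<inter> ?I) g0)^2"
          by (rule L2norm_sq_Un) (use g0 Tl U in auto)
        moreover have "L2norm (- S \<inter> ?I) g0 = L2norm (- S \<inter> ?I) (\<lambda>_. 0)" by (rule L2norm_cong) (auto simp: g0_def)
        moreover have "L2norm ?T g0 = G" unfolding G_def by (rule L2norm_cong) (auto simp: g0_def)
        ultimately have "(L2norm ?I g0)^2 = G^2" using U by simp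
        then show ?thesis using G by (simp add: power2_eq_iff_nonneg)
      qed
      obtain F a where F: "finite F" "L2norm ?I (\<lambda>x. g0 x - trig_poly F a x) < \<eta>" using trig_poly_dense[OF g0 \<eta>] by blast
      have tL: "trig_poly H b \<in> L2 ?I" "trig_poly H b \<in> L2 ?T" for H b using Tm by (auto intro: trig_poly_L2)
      have split: "(L2norm ?I f)^2 = (L2norm ?T f)^2 + (L2norm (- S \<inter> ?I) f)^2" if "f \<in> L2 ?I" for f
      proof -
        have U: "?I = ?T \<union> (- S \<inter> ?I)" by auto
        show ?thesis by (subst U, rule L2norm_sq_Un) (use that Tl U in auto)
      qed
      have pn: "L2norm ?I (trig_poly F a) \<le> G + \<eta>"
        using L2norm_le_add_diff[OF tL(1) g0, of F a] F(2) unfolding g0n L2norm_minus_commute[of ?I "trig_poly F a"] by linarith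
      define F1 F2 where "F1 = F \<inter> L" and "F2 = F - L"
      have fF: "finite F1" "finite F2" "F1 \<union> F2 = F" "F1 \<inter> F2 = {}" using F(1) by (auto simp: F1_def F2_def)
      have tps: "trig_poly F a x = trig_poly F1 a x + trig_poly F2 a x" for x
        unfolding trig_poly_def fF(3)[symmetric] by (rule sum.union_disjoint[OF fF(1,2,4)])
      \<comment> \<open>On \<open>?T\<close> there remains the total mass minus the guaranteed share
        outside S, hence at most the fraction q^2.\<close>
      have "(L2norm ?T (trig_poly F2 a))^2 = (\<Sum>n\<in>F2. (cmod (a n))^2) - (L2norm (- S \<inter> ?I) (trig_poly F2 a))^2"
        using split[OF tL(1), of F2 a] L2norm_trig_poly[OF fF(2), of a] by linarith
      also have "\<dots> \<le> (\<Sum>n\<in>F2. (cmod (a n))^2) - c * (\<Sum>n\<in>F2. (cmod (a n))^2)"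
        using c(3)[OF fF(2), of a] by (auto simp: F2_def)
      also have "\<dots> = q^2 * (\<Sum>n\<in>F2. (cmod (a n))^2)" unfolding q(3) by (simp add: left_diff_distrib)
      also have "\<dots> \<le> q^2 * (\<Sum>n\<in>F. (cmod (a n))^2)"
        using F(1) by (intro mult_left_mono sum_mono2) (auto simp: F2_def)
      also have "\<dots> = (q * L2norm ?I (trig_poly F a))^2" unfolding power_mult_distrib L2norm_trig_poly[OF F(1)] ..
      finally have "L2norm ?T (trig_poly F2 a) \<le> q * L2norm ?I (trig_poly F a)"
        by (rule power2_le_imp_le) (use q in simp)
      also have "\<dots> \<le> q * (G + \<eta>)" using pn q by (intro mult_left_mono)
      finally have n2: "L2norm ?T (trig_poly F2 a) \<le> q * (G + \<eta>)" .
      have n1: "L2norm ?T (\<lambda>x. g x - trig_poly F a x) \<le> \<eta>"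
      proof -
        have "L2norm ?T (\<lambda>x. g x - trig_poly F a x) = L2norm ?T (\<lambda>x. g0 x - trig_poly F a x)"
          by (rule L2norm_cong) (simp add: g0_def)
        also have "\<dots> \<le> L2norm ?I (\<lambda>x. g0 x - trig_poly F a x)"
        proof (rule power2_le_imp_le)
          show "(L2norm ?T (\<lambda>x. g0 x - trig_poly F a x))^2 \<le> (L2norm ?I (\<lambda>x. g0 x - trig_poly F a x))^2"
            unfolding split[OF L2_diff[OF g0 tL(1)]] by simp
        qed simp
        finally show ?thesis using F(2) by linarith
      qed
      have "L2norm ?T (\<lambda>x. g x - trig_poly F1 a x) = L2norm ?T (\<lambda>x. (g x - trig_poly F a x) + trig_poly F2 a x)"
        unfolding tps by simp
      also have "\<dots> \<le> L2norm ?T (\<lambda>x. g x - trig_poly F a x) + L2norm ?T (trig_poly F2 a)"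
        by (rule L2norm_triangle[OF L2_diff[OF g tL(2)] tL(2)])
      also have "\<dots> \<le> \<eta> + q * (G + \<eta>)" using n1 n2 by linarith
      also have "\<dots> \<le> (1 + q) / 2 * G"
      proof -
        have "\<eta> + q * (G + \<eta>) = (1 + q) * \<eta> + q * G" by (simp add: algebra_simps)
        also have "\<dots> \<le> 2 * \<eta> + q * G" using q \<eta> by (intro add_right_mono mult_right_mono) auto
        also have "\<dots> = (1 + q) / 2 * G" by (simp add: \<eta>_def field_simps)
        finally show ?thesis .
      qed
      finally show ?thesis unfolding G_def using fF(1) by (intro exI[of _ F1] exI[of _ a]) (auto simp: F1_def)
    qed
  qed (use q in auto)
qed

text \<open>Applying the approximation step to each remainder in turn gives errors r^k times the
  norm of f.\<close>

lemma riesz_split_complete: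
  assumes S: "S \<in> sets borel" and rb: "riesz_split S L" and f: "f \<in> L2 (S \<inter> {0..<1})" and e: "0 < e"
  shows "\<exists>F a. finite F \<and> F \<subseteq> L \<and> L2norm (S \<inter> {0..<1}) (\<lambda>x. f x - trig_poly F a x) < e"
proof -
  let ?T = "S \<inter> {0..<1::real}"
  have Tm: "?T \<in> lmeasurable" by (rule lmeasurable_Int_unit[OF S])
  obtain r where r: "0 \<le> r" "r < 1" and step: "\<And>g. g \<in> L2 ?T \<Longrightarrow>
    \<exists>F a. finite F \<and> F \<subseteq> L \<and> L2norm ?T (\<lambda>x. g x - trig_poly F a x) \<le> r * L2norm ?T g"
    by (rule riesz_split_approx_step[OF S rb]) (rule that)
  have it: "\<exists>F a. finite F \<and> F \<subseteq> L \<and> L2norm ?T (\<lambda>x. f x - trig_poly F a x) \<le> r ^ k * L2norm ?T f" for k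
  proof (induction k)
    case 0
    show ?case by (intro exI[of _ "{}"]) (simp add: trig_poly_def)
  next
    case (Suc k)
    then obtain F a where F: "finite F" "F \<subseteq> L" "L2norm ?T (\<lambda>x. f x - trig_poly F a x) \<le> r ^ k * L2norm ?T f"
      by (elim exE conjE)
    obtain G b where G: "finite G" "G \<subseteq> L" "L2norm ?T (\<lambda>x. (f x - trig_poly F a x) - trig_poly G b x) \<le> r * L2norm ?T (\<lambda>x. f x - trig_poly F a x)"
      using step[OF L2_diff[OF f trig_poly_L2[OF Tm]], of F a] by (elim exE conjE)
    obtain c where c: "\<And>x. trig_poly F a x + trig_poly G b x = trig_poly (F \<union> G) c x" by (rule trig_poly_Un[OF F(1) G(1), of a b]) (rule that)
    have "L2norm ?T (\<lambda>x. f x - trig_poly (F \<union> G) c x) = L2norm ?T (\<lambda>x. (f x - trig_poly F a x) - trig_poly G b x)"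
      unfolding c[symmetric] by (simp add: diff_diff_eq)
    also note G(3)
    also have "r * L2norm ?T (\<lambda>x. f x - trig_poly F a x) \<le> r * (r ^ k * L2norm ?T f)"
      using F(3) r(1) by (rule mult_left_mono)
    finally show ?case using F G by (intro exI[of _ "F \<union> G"] exI[of _ c]) simp
  qed
  have "(\<lambda>k. r ^ k * L2norm ?T f) \<longlonglongrightarrow> 0 * L2norm ?T f"
    using r by (intro tendsto_intros LIMSEQ_power_zero) auto
  then have "(\<lambda>k. r ^ k * L2norm ?T f) \<longlonglongrightarrow> 0" by simp
  from order_tendstoD(2)[OF this e] obtain k where k: "r ^ k * L2norm ?T f < e"
    by (auto simp: eventually_sequentially)
  from it[of k] obtain F a where F: "finite F" "F \<subseteq> L" "L2norm ?T (\<lambda>x. f x - trig_poly F a x) \<le> r ^ k * L2norm ?T f"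
    by (elim exE conjE)
  show ?thesis by (intro exI[of _ F] exI[of _ a] conjI F(1,2) le_less_trans[OF F(3) k])
qed

text \<open>For finite sums the lower bound is the Riesz sequence property and the upper one is
  Parseval on the whole circle; both pass to the limit with the norms.\<close>

lemma riesz_split_series:
  assumes S: "S \<in> sets borel" and rb: "riesz_split S L"
  obtains c where "0 < c" "c \<le> 1" "\<And>a. (\<lambda>n. (cmod (a n))^2) summable_on L \<Longrightarrow>
    \<exists>g\<in>L2 (S \<inter> {0..<1}).
      (\<forall>e>0. \<exists>F0. finite F0 \<and> F0 \<subseteq> L \<and> (\<forall>F. finite F \<and> F0 \<subseteq> F \<and> F \<subseteq> L \<longrightarrow> L2norm (S \<inter> {0..<1}) (\<lambda>x. g x - trig_poly F a x) < e)) \<and>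
      c * (\<Sum>\<^sub>\<infinity>n\<in>L. (cmod (a n))^2) \<le> (L2norm (S \<inter> {0..<1}) g)^2 \<and>
      (L2norm (S \<inter> {0..<1}) g)^2 \<le> (\<Sum>\<^sub>\<infinity>n\<in>L. (cmod (a n))^2)"
proof -
  let ?I = "{0..<1::real}"
  let ?T = "S \<inter> ?I"
  have Tm: "?T \<in> lmeasurable" by (rule lmeasurable_Int_unit[OF S])
  have Tl: "?T \<in> sets lebesgue" using S by auto
  obtain c0 where c0: "0 < c0" "\<And>F a. finite F \<Longrightarrow> F \<subseteq> L \<Longrightarrow> c0 * (\<Sum>n\<in>F. (cmod (a n))^2) \<le> (L2norm ?T (trig_poly F a))^2"
    using rb unfolding riesz_split_def riesz_seq_def by blast
  define c where "c = min c0 1"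
  have c: "0 < c" "c \<le> 1" using c0(1) by (auto simp: c_def)
  have cl: "c * (\<Sum>n\<in>F. (cmod (a n))^2) \<le> (L2norm ?T (trig_poly F a))^2" if F: "finite F" "F \<subseteq> L" for F a
  proof -
    have "c * (\<Sum>n\<in>F. (cmod (a n))^2) \<le> c0 * (\<Sum>n\<in>F. (cmod (a n))^2)"
      by (intro mult_right_mono sum_nonneg) (auto simp: c_def)
    also note c0(2)[OF F]
    finally show ?thesis .
  qed
  have cu: "(L2norm ?T (trig_poly F a))^2 \<le> (\<Sum>n\<in>F. (cmod (a n))^2)" if F: "finite F" for F a
  proof -
    have U: "?I = ?T \<union> (- S \<inter> ?I)" by auto
    have "(L2norm ?I (trig_poly F a))^2 = (L2norm ?T (trig_poly F a))^2 + (L2norm (- S \<inter> ?I) (trig_poly F a))^2"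
      by (subst U, rule L2norm_sq_Un) (use Tl S U trig_poly_L2[OF lmeasurable_Ico, of F a 0 1] in auto)
    then show ?thesis unfolding L2norm_trig_poly[OF F] by simp
  qed
  have tL: "trig_poly H b \<in> L2 ?T" for H b by (rule trig_poly_L2[OF Tm])
  show thesis
  proof (rule that[OF c])
    fix a :: "int \<Rightarrow> complex" assume sm: "(\<lambda>n. (cmod (a n))^2) summable_on L"
    let ?f = "\<lambda>n. (cmod (a n))^2"
    define s where "s = infsum ?f L"
    have hs: "(?f has_sum s) L" unfolding s_def by (rule has_sum_infsum[OF sm])
    have le_s: "sum ?f F \<le> s" if "finite F" "F \<subseteq> L" for F
      unfolding s_def using that by (intro finite_sum_le_infsum sm) auto
    \<comment> \<open>Tails below 4^(-k) give the geometric rate that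
      \<open>Riesz_Fischer_fast\<close> asks for; the unions taken next make the sections
      increasing.\<close>
    have "\<exists>H. finite H \<and> H \<subseteq> L \<and> s - ((1/2) ^ k)^2 < sum ?f H" for k
    proof -
      have "eventually (\<lambda>F. s - ((1/2) ^ k)^2 < sum ?f F) (finite_subsets_at_top L)"
        using hs unfolding has_sum_def by (rule order_tendstoD(1)) simp
      then show ?thesis unfolding eventually_finite_subsets_at_top by blast
    qed
    then obtain H0 where H0: "\<And>k. finite (H0 k)" "\<And>k. H0 k \<subseteq> L" "\<And>k. s - ((1/2) ^ k)^2 < sum ?f (H0 k)" by metis
    define H where "H k = (\<Union>i\<le>k. H0 i)" for k
    have Hf: "finite (H k)" "H k \<subseteq> L" for k using H0(1,2) by (auto simp: H_def)
    have Hm: "H m \<subseteq> H n" if "m \<le> n" for m n using that unfolding H_def by fastforce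
    have Hs: "s - ((1/2) ^ k)^2 < sum ?f (H k)" for k
    proof -
      have "sum ?f (H0 k) \<le> sum ?f (H k)" using Hf by (intro sum_mono2) (auto simp: H_def)
      then show ?thesis using H0(3)[of k] by linarith
    qed
    have tail: "L2norm ?T (\<lambda>x. trig_poly F a x - trig_poly (H m) a x) \<le> (1/2) ^ m" if F: "finite F" "H m \<subseteq> F" "F \<subseteq> L" for F m
    proof -
      have "sum ?f F = sum ?f (F - H m) + sum ?f (H m)" using F by (intro sum.subset_diff) auto
      then have t: "sum ?f (F - H m) \<le> ((1/2) ^ m)^2" using Hs[of m] le_s[OF F(1,3)] by linarith
      have "trig_poly F a x - trig_poly (H m) a x = trig_poly (F - H m) a x" for x
        unfolding trig_poly_def using sum.subset_diff[OF F(2,1), of "\<lambda>n. a n * e1 (of_int n * x)"] by simp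
      then have "(L2norm ?T (\<lambda>x. trig_poly F a x - trig_poly (H m) a x))^2 = (L2norm ?T (trig_poly (F - H m) a))^2" by simp
      also have "\<dots> \<le> sum ?f (F - H m)" using F(1) by (intro cu) simp
      also note t
      finally show ?thesis by (rule power2_le_imp_le) simp
    qed
    obtain g where g: "g \<in> L2 ?T" and gl: "\<And>m. L2norm ?T (\<lambda>t. g t - trig_poly (H m) a t) \<le> (1/2) ^ m"
      by (rule Riesz_Fischer_fast[OF Tm, of "\<lambda>m. trig_poly (H m) a"]) (use tL tail[OF Hf(1) Hm Hf(2)] in auto)
    have half0: "(\<lambda>m. (1/2::real) ^ m) \<longlonglongrightarrow> 0" by (rule LIMSEQ_power_zero) simp
    have conv: "\<exists>F0. finite F0 \<and> F0 \<subseteq> L \<and> (\<forall>F. finite F \<and> F0 \<subseteq> F \<and> F \<subseteq> L \<longrightarrow> L2norm ?T (\<lambda>x. g x - trig_poly F a x) < e)" if e: "0 < e" for e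
    proof -
      from order_tendstoD(2)[OF half0, of "e/2"] e obtain m where m: "(1/2::real) ^ m < e/2"
        by (auto simp: eventually_sequentially)
      show ?thesis
      proof (intro exI[of _ "H m"] conjI Hf allI impI)
        fix F assume F: "finite F \<and> H m \<subseteq> F \<and> F \<subseteq> L"
        have "L2norm ?T (\<lambda>x. g x - trig_poly F a x) \<le> L2norm ?T (\<lambda>x. g x - trig_poly (H m) a x) + L2norm ?T (\<lambda>x. trig_poly (H m) a x - trig_poly F a x)"
          by (rule L2norm_triangle_mid[OF g tL tL])
        also have "L2norm ?T (\<lambda>x. trig_poly (H m) a x - trig_poly F a x) = L2norm ?T (\<lambda>x. trig_poly F a x - trig_poly (H m) a x)"
          by (rule L2norm_minus_commute)
        also have "L2norm ?T (\<lambda>x. g x - trig_poly (H m) a x) + \<dots> \<le> (1/2) ^ m + (1/2) ^ m"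
          using F by (intro add_mono gl tail) auto
        finally show "L2norm ?T (\<lambda>x. g x - trig_poly F a x) < e" using m by linarith
      qed
    qed
    have "(\<lambda>m. L2norm ?T (trig_poly (H m) a)) \<longlonglongrightarrow> L2norm ?T g"
    proof (rule LIM_zero_cancel, rule tendsto_rabs_zero_cancel, rule tendsto_sandwich[OF _ _ tendsto_const half0])
      show "\<forall>\<^sub>F m in sequentially. \<bar>L2norm ?T (trig_poly (H m) a) - L2norm ?T g\<bar> \<le> (1/2) ^ m"
      proof (rule always_eventually, rule allI)
        fix m
        show "\<bar>L2norm ?T (trig_poly (H m) a) - L2norm ?T g\<bar> \<le> (1/2) ^ m"
          using L2norm_le_add_diff[OF g tL[of "H m" a]] L2norm_le_add_diff[OF tL[of "H m" a] g] gl[of m]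
          unfolding L2norm_minus_commute[of ?T "trig_poly (H m) a" g] by linarith
      qed
    qed simp
    then have lim: "(\<lambda>m. (L2norm ?T (trig_poly (H m) a))^2) \<longlonglongrightarrow> (L2norm ?T g)^2" by (intro tendsto_intros)
    have up: "(L2norm ?T g)^2 \<le> s"
    proof (rule LIMSEQ_le_const2[OF lim], intro exI[of _ 0] allI impI)
      fix m
      show "(L2norm ?T (trig_poly (H m) a))^2 \<le> s" by (rule order.trans[OF cu[OF Hf(1)] le_s[OF Hf]])
    qed
    have "(\<lambda>m. c * (s - ((1/2) ^ m)^2)) \<longlonglongrightarrow> c * (s - 0^2)"
      by (intro tendsto_mult tendsto_const tendsto_diff tendsto_power half0)
    then have "(\<lambda>m. c * (s - ((1/2) ^ m)^2)) \<longlonglongrightarrow> c * s" by simp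
    then have low: "c * s \<le> (L2norm ?T g)^2"
    proof (rule LIMSEQ_le[OF _ lim], intro exI[of _ 0] allI impI)
      fix m
      have "c * (s - ((1/2) ^ m)^2) \<le> c * sum ?f (H m)" using Hs[of m] c by (intro mult_left_mono) auto
      also have "\<dots> \<le> (L2norm ?T (trig_poly (H m) a))^2" by (rule cl[OF Hf])
      finally show "c * (s - ((1/2) ^ m)^2) \<le> (L2norm ?T (trig_poly (H m) a))^2" .
    qed
    show "\<exists>g\<in>L2 ?T. (\<forall>e>0. \<exists>F0. finite F0 \<and> F0 \<subseteq> L \<and> (\<forall>F. finite F \<and> F0 \<subseteq> F \<and> F \<subseteq> L \<longrightarrow> L2norm ?T (\<lambda>x. g x - trig_poly F a x) < e)) \<and>
      c * (\<Sum>\<^sub>\<infinity>n\<in>L. (cmod (a n))^2) \<le> (L2norm ?T g)^2 \<and> (L2norm ?T g)^2 \<le> (\<Sum>\<^sub>\<infinity>n\<in>L. (cmod (a n))^2)"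
      by (rule bexI[OF _ g], intro conjI allI impI conv low[unfolded s_def] up[unfolded s_def])
  qed
qed

section \<open>Transfer from the circle to an interval of length w\<close>

text \<open>The end points of the given intervals may or may not belong to them, while step sets
  consist of half-open arcs; a null set absorbs the difference.\<close>

lemma L2_spike_set:
  assumes f: "f \<in> L2 U" and neg: "negligible ((U - V) \<union> (V - U))" and UV: "U \<in> sets lebesgue" "V \<in> sets lebesgue"
  shows "f \<in> L2 V" "L2norm V f = L2norm U f"
proof -
  have "f measurable_on U" using L2_measurable[OF f] UV by (simp add: measurable_on_iff_borel_measurable)
  then have "f measurable_on V" by (rule measurable_on_spike_set[OF _ neg])
  then have fV: "f \<in> borel_measurable (lebesgue_on V)" using UV by (simp add: measurable_on_iff_borel_measurable)
  have m: "(\<lambda>t. indicator W t *\<^sub>R (cmod (f t))^2) \<in> borel_measurable lebesgue"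
    if "f \<in> borel_measurable (lebesgue_on W)" "W \<in> sets lebesgue" for W
  proof -
    have "(\<lambda>t. (cmod (f t))^2) \<in> borel_measurable (lebesgue_on W)" using that(1) by measurable
    then show ?thesis using that(2) by (subst (asm) borel_measurable_restrict_space_iff) auto
  qed
  note mU = m[OF L2_measurable[OF f] UV(1)] and mV = m[OF fV UV(2)]
  have "AE t in lebesgue. t \<notin> (U - V) \<union> (V - U)" using neg by (intro AE_not_in) (simp add: negligible_iff_null_sets)
  then have AE: "AE t in lebesgue. indicator V t *\<^sub>R (cmod (f t))^2 = indicator U t *\<^sub>R (cmod (f t))^2"
    by eventually_elim (auto simp: indicator_def)
  have "integrable lebesgue (\<lambda>t. indicator U t *\<^sub>R (cmod (f t))^2)"
    using L2_integrable[OF f] UV by (simp add: integrable_restrict_space)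
  then have "integrable lebesgue (\<lambda>t. indicator V t *\<^sub>R (cmod (f t))^2)"
    using integrable_cong_AE[OF mV mU AE] by blast
  then show "f \<in> L2 V" using fV UV by (intro L2_I) (simp_all add: integrable_restrict_space)
  have "(\<integral>t. indicator V t *\<^sub>R (cmod (f t))^2 \<partial>lebesgue) = (\<integral>t. indicator U t *\<^sub>R (cmod (f t))^2 \<partial>lebesgue)"
    by (rule integral_cong_AE[OF mV mU AE])
  then show "L2norm V f = L2norm U f" unfolding L2norm_def using UV by (simp add: integral_restrict_space)
qed

lemma sets_lebesgue_affine_vimage:
  assumes "S \<in> sets lebesgue" "w \<noteq> 0"
  shows "{x::real. A + w * x \<in> S} \<in> sets lebesgue"
proof -
  have "(\<lambda>t. indicator S t :: real) \<in> borel_measurable lebesgue" using assms by simp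
  from borel_measurable_affine[OF this assms(2), of A]
  have "(\<lambda>x. indicator S (A + w * x) :: real) \<in> borel_measurable lebesgue" by simp
  moreover have "(\<lambda>x. indicator S (A + w * x) :: real) = indicator {x. A + w * x \<in> S}" by (auto simp: indicator_def)
  ultimately have "(indicator {x. A + w * x \<in> S} :: real \<Rightarrow> real) \<in> borel_measurable lebesgue" by simp
  then show ?thesis by (simp add: borel_measurable_indicator_iff)
qed

lemma L2_affine:
  assumes f: "f \<in> L2 S" and S: "S \<in> sets lebesgue" and w: "0 < w"
  shows "(\<lambda>x. f (A + w * x)) \<in> L2 {x. A + w * x \<in> S}"
    and "L2norm S f = sqrt w * L2norm {x. A + w * x \<in> S} (\<lambda>x. f (A + w * x))"
proof -
  let ?T = "{x. A + w * x \<in> S}"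
  have T: "?T \<in> sets lebesgue" using S w by (intro sets_lebesgue_affine_vimage) auto
  have "(\<lambda>t. if t \<in> S then f t else 0) \<in> borel_measurable lebesgue"
    by (rule borel_measurable_if_I[OF L2_measurable[OF f] S])
  from borel_measurable_affine[OF this, of w A] w
  have "(\<lambda>x. if x \<in> ?T then f (A + w * x) else 0) \<in> borel_measurable lebesgue"
    unfolding real_scaleR_def mem_Collect_eq by blast
  then have m: "(\<lambda>x. f (A + w * x)) \<in> borel_measurable (lebesgue_on ?T)" by (rule borel_measurable_if_D)
  have ind: "indicator S (A + w * x) = (indicator ?T x :: real)" for x by (simp add: indicator_def)
  have "integrable lebesgue (\<lambda>t. indicator S t *\<^sub>R (cmod (f t))^2)"
    using L2_integrable[OF f] S by (simp add: integrable_restrict_space)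
  from lebesgue_integrable_real_affine[OF this, of w A] w
  have "integrable lebesgue (\<lambda>x. indicator ?T x *\<^sub>R (cmod (f (A + w * x)))^2)" by (simp add: ind)
  then show "(\<lambda>x. f (A + w * x)) \<in> L2 ?T" using m T by (intro L2_I) (simp_all add: integrable_restrict_space)
  have "(\<integral>t. indicator S t *\<^sub>R (cmod (f t))^2 \<partial>lebesgue) = \<bar>w\<bar> *\<^sub>R (\<integral>x. indicator S (A + w * x) *\<^sub>R (cmod (f (A + w * x)))^2 \<partial>lebesgue)"
    using w by (intro lebesgue_integral_real_affine) auto
  also have "\<dots> = w * (\<integral>x. indicator ?T x *\<^sub>R (cmod (f (A + w * x)))^2 \<partial>lebesgue)" using w by (simp add: ind)
  finally show "L2norm S f = sqrt w * L2norm ?T (\<lambda>x. f (A + w * x))"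
    unfolding L2norm_def using S T by (simp add: integral_restrict_space real_sqrt_mult)
qed

text \<open>Under t = A + w x the exponential of frequency 2 pi n / w becomes e1(n x) times a
  constant phase, which is absorbed into the coefficients. Norms scale by sqrt w, so the Riesz
  bounds c and 1 become w c and w.\<close>

lemma exp_riesz_basis_of_riesz_split:
  fixes A w :: real
  assumes w: "0 < w" and S: "S \<in> sets lebesgue" and C: "C \<in> sets borel" and rb: "riesz_split C L"
    and neg: "negligible (({x. A + w * x \<in> S} - C \<inter> {0..<1}) \<union> (C \<inter> {0..<1} - {x. A + w * x \<in> S}))"
  shows "exp_riesz_basis S ((\<lambda>n. 2 * pi * of_int n / w) ` L)"
proof -
  let ?V = "{x. A + w * x \<in> S}" and ?T = "C \<inter> {0..<1::real}"
  define \<kappa> where "\<kappa> n = 2 * pi * of_int n / w" for n :: int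
  define ph where "ph n = e1 (of_int n * A / w)" for n :: int
  have T0: "?V \<in> sets lebesgue" using S w by (intro sets_lebesgue_affine_vimage) auto
  have T: "?T \<in> sets lebesgue" using C by auto
  have Tm: "?T \<in> lmeasurable" by (rule lmeasurable_Int_unit[OF C])
  have inj: "inj \<kappa>" using w by (auto simp: inj_def \<kappa>_def)
  have injF: "inj_on \<kappa> F" for F using inj by (rule inj_on_subset) simp
  have up: "(\<lambda>x. f (A + w * x)) \<in> L2 ?T" "L2norm S f = sqrt w * L2norm ?T (\<lambda>x. f (A + w * x))" if "f \<in> L2 S" for f
    using L2_affine[OF that S w, of A] L2_spike_set[OF L2_affine(1)[OF that S w, of A] neg T0 T] by auto
  have down: "(\<lambda>t. g ((t - A) / w)) \<in> L2 S" if g: "g \<in> L2 ?T" for g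
  proof -
    have "g \<in> L2 ?V" by (rule L2_spike_set(1)[OF g _ T T0]) (use neg in \<open>simp add: Un_commute\<close>)
    from L2_affine(1)[OF this T0, of "1 / w" "- A / w"] w
    have "(\<lambda>t. g (- A / w + 1 / w * t)) \<in> L2 {t. A + w * (- A / w + 1 / w * t) \<in> S}" by simp
    moreover have "A + w * (- A / w + 1 / w * t) = t" for t using w by (simp add: field_simps)
    moreover have "- A / w + 1 / w * t = (t - A) / w" for t using w by (simp add: field_simps)
    ultimately show ?thesis by simp
  qed
  have expo: "expo (\<kappa> n) (A + w * x) = ph n * e1 (of_int n * x)" for n x
  proof -
    have "\<kappa> n * (A + w * x) = 2 * pi * (of_int n * A / w + of_int n * x)" using w by (simp add: \<kappa>_def field_simps)
    then have "expo (\<kappa> n) (A + w * x) = e1 (of_int n * A / w + of_int n * x)"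
      by (simp add: expo_def e1_def cis_conv_exp)
    then show ?thesis by (simp add: e1_add ph_def)
  qed
  have poly: "(\<Sum>l\<in>\<kappa> ` F. a l * expo l (A + w * x)) = trig_poly F (\<lambda>n. a (\<kappa> n) * ph n) x" for F a x
    by (simp add: sum.reindex[OF injF] trig_poly_def expo mult.assoc)
  have polyL: "(\<lambda>t. \<Sum>l\<in>\<kappa> ` F. a l * expo l t) \<in> L2 S" for F a
  proof -
    have "(\<lambda>t. trig_poly F (\<lambda>n. a (\<kappa> n) * ph n) ((t - A) / w)) \<in> L2 S" by (rule down[OF trig_poly_L2[OF Tm]])
    then show ?thesis using w by (simp flip: poly)
  qed
  have sw: "0 < sqrt w" using w by simp
  have diff: "L2norm S (\<lambda>t. f t - (\<Sum>l\<in>\<kappa> ` F. a l * expo l t)) = sqrt w * L2norm ?T (\<lambda>x. f (A + w * x) - trig_poly F (\<lambda>n. a (\<kappa> n) * ph n) x)"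
    if "f \<in> L2 S" for f F a
    using up(2)[OF L2_diff[OF that polyL[where F=F and a=a]]] by (simp only: poly)
  have complete: "\<exists>F a. finite F \<and> F \<subseteq> \<kappa> ` L \<and> L2norm S (\<lambda>t. f t - (\<Sum>l\<in>F. a l * expo l t)) < e" if f: "f \<in> L2 S" and e: "0 < e" for f e
  proof -
    obtain F b where F: "finite F" "F \<subseteq> L" "L2norm ?T (\<lambda>x. f (A + w * x) - trig_poly F b x) < e / sqrt w"
      using riesz_split_complete[OF C rb up(1)[OF f], of "e / sqrt w"] e sw by auto
    \<comment> \<open>The conjugate of the unimodular phase undoes it, so that the polynomial on the
      circle has the prescribed coefficients \<open>b\<close>.\<close>
    define a where "a l = b (inv \<kappa> l) * cnj (ph (inv \<kappa> l))" for l
    have "a (\<kappa> n) * ph n = b n" for n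
    proof -
      have "cnj (ph n) * ph n = 1" unfolding ph_def by (metis complex_norm_square mult.commute norm_e1 of_real_1 one_power2)
      then show ?thesis using inj by (simp add: a_def mult.assoc)
    qed
    then have "L2norm S (\<lambda>t. f t - (\<Sum>l\<in>\<kappa> ` F. a l * expo l t)) = sqrt w * L2norm ?T (\<lambda>x. f (A + w * x) - trig_poly F b x)"
      by (simp add: diff[OF f])
    also have "\<dots> < e" using F(3) sw by (simp add: pos_less_divide_eq mult.commute)
    finally show ?thesis using F(1,2) by (intro exI[of _ "\<kappa> ` F"] exI[of _ a]) auto
  qed
  obtain c where c: "0 < c" "c \<le> 1" and ser: "\<And>a. (\<lambda>n. (cmod (a n))^2) summable_on L \<Longrightarrow>
    \<exists>g\<in>L2 ?T. (\<forall>e>0. \<exists>F0. finite F0 \<and> F0 \<subseteq> L \<and> (\<forall>F. finite F \<and> F0 \<subseteq> F \<and> F \<subseteq> L \<longrightarrow> L2norm ?T (\<lambda>x. g x - trig_poly F a x) < e)) \<and>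
      c * (\<Sum>\<^sub>\<infinity>n\<in>L. (cmod (a n))^2) \<le> (L2norm ?T g)^2 \<and> (L2norm ?T g)^2 \<le> (\<Sum>\<^sub>\<infinity>n\<in>L. (cmod (a n))^2)"
    by (rule riesz_split_series[OF C rb]) (rule that)
  have series: "\<exists>g\<in>L2 S. exp_series_converges S (\<kappa> ` L) a g \<and>
       (w * c) * (\<Sum>\<^sub>\<infinity>l\<in>\<kappa> ` L. (cmod (a l))^2) \<le> (L2norm S g)^2 \<and> (L2norm S g)^2 \<le> w * (\<Sum>\<^sub>\<infinity>l\<in>\<kappa> ` L. (cmod (a l))^2)"
    if sm: "(\<lambda>l. (cmod (a l))^2) summable_on \<kappa> ` L" for a
  proof -
    define b where "b n = a (\<kappa> n) * ph n" for n
    have nb: "(cmod (b n))^2 = (cmod (a (\<kappa> n)))^2" for n by (simp add: b_def ph_def norm_mult)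
    have smb: "(\<lambda>n. (cmod (b n))^2) summable_on L"
      unfolding nb using sm summable_on_reindex[OF injF[of L], of "\<lambda>l. (cmod (a l))^2"] by (simp add: o_def)
    have sb: "(\<Sum>\<^sub>\<infinity>n\<in>L. (cmod (b n))^2) = (\<Sum>\<^sub>\<infinity>l\<in>\<kappa> ` L. (cmod (a l))^2)"
      unfolding nb using infsum_reindex[OF injF[of L], of "\<lambda>l. (cmod (a l))^2"] by (simp add: o_def)
    from ser[OF smb] obtain g where g: "g \<in> L2 ?T"
      and conv: "\<And>e. e > 0 \<Longrightarrow> \<exists>F0. finite F0 \<and> F0 \<subseteq> L \<and> (\<forall>F. finite F \<and> F0 \<subseteq> F \<and> F \<subseteq> L \<longrightarrow> L2norm ?T (\<lambda>x. g x - trig_poly F b x) < e)"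
      and lo: "c * (\<Sum>\<^sub>\<infinity>l\<in>\<kappa> ` L. (cmod (a l))^2) \<le> (L2norm ?T g)^2"
      and hi: "(L2norm ?T g)^2 \<le> (\<Sum>\<^sub>\<infinity>l\<in>\<kappa> ` L. (cmod (a l))^2)"
      unfolding sb by (elim bexE conjE) (rule that, auto)
    define G where "G t = g ((t - A) / w)" for t
    have GL: "G \<in> L2 S" unfolding G_def[abs_def] by (rule down[OF g])
    have Gg: "G (A + w * x) = g x" for x using w by (simp add: G_def)
    have Gn: "(L2norm S G)^2 = w * (L2norm ?T g)^2"
      using up(2)[OF GL] w unfolding Gg by (simp add: power_mult_distrib)
    have "exp_series_converges S (\<kappa> ` L) a G"
      unfolding exp_series_converges_def
    proof (intro allI impI)
      fix e :: real assume e: "0 < e"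
      then obtain F0 where F0: "finite F0" "F0 \<subseteq> L" "\<And>F. finite F \<Longrightarrow> F0 \<subseteq> F \<Longrightarrow> F \<subseteq> L \<Longrightarrow> L2norm ?T (\<lambda>x. g x - trig_poly F b x) < e / sqrt w"
        using conv[of "e / sqrt w"] sw by auto
      show "\<exists>F0. finite F0 \<and> F0 \<subseteq> \<kappa> ` L \<and> (\<forall>F. finite F \<and> F0 \<subseteq> F \<and> F \<subseteq> \<kappa> ` L \<longrightarrow> L2norm S (\<lambda>t. G t - (\<Sum>l\<in>F. a l * expo l t)) < e)"
      proof (intro exI[of _ "\<kappa> ` F0"] conjI allI impI)
        fix F assume F: "finite F \<and> \<kappa> ` F0 \<subseteq> F \<and> F \<subseteq> \<kappa> ` L"
        define F' where "F' = \<kappa> -` F"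
        have F': "F = \<kappa> ` F'" "finite F'" "F0 \<subseteq> F'" "F' \<subseteq> L"
          using F inj by (auto simp: F'_def finite_vimageI dest: injD)
        have "L2norm S (\<lambda>t. G t - (\<Sum>l\<in>F. a l * expo l t)) = sqrt w * L2norm ?T (\<lambda>x. g x - trig_poly F' b x)"
          unfolding F'(1) diff[OF GL] Gg b_def ..
        also have "\<dots> < e" using F0(3)[OF F'(2-4)] sw by (simp add: pos_less_divide_eq mult.commute)
        finally show "L2norm S (\<lambda>t. G t - (\<Sum>l\<in>F. a l * expo l t)) < e" .
      qed (use F0 in auto)
    qed
    moreover have "(w * c) * (\<Sum>\<^sub>\<infinity>l\<in>\<kappa> ` L. (cmod (a l))^2) \<le> (L2norm S G)^2"
      unfolding Gn mult.assoc using lo w by (intro mult_left_mono) auto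
    moreover have "(L2norm S G)^2 \<le> w * (\<Sum>\<^sub>\<infinity>l\<in>\<kappa> ` L. (cmod (a l))^2)"
      unfolding Gn using hi w by (intro mult_left_mono) auto
    ultimately show ?thesis using GL by blast
  qed
  have "exp_riesz_basis S (\<kappa> ` L)"
    unfolding exp_riesz_basis_def
  proof (rule conjI, intro ballI allI impI complete, assumption, assumption,
      rule exI[of _ "w * c"], rule exI[of _ w], intro conjI)
    show "0 < w * c" "w * c \<le> w" using w c by (auto simp: mult_left_le)
    show "\<forall>a. (\<lambda>l. (cmod (a l))^2) summable_on \<kappa> ` L \<longrightarrow>
       (\<exists>g\<in>L2 S. exp_series_converges S (\<kappa> ` L) a g \<and>
          w * c * (\<Sum>\<^sub>\<infinity>l\<in>\<kappa> ` L. (cmod (a l))^2) \<le> (L2norm S g)^2 \<and>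
          (L2norm S g)^2 \<le> w * (\<Sum>\<^sub>\<infinity>l\<in>\<kappa> ` L. (cmod (a l))^2))"
      by (intro allI impI series)
  qed
  then show ?thesis unfolding \<kappa>_def[abs_def] .
qed

text \<open>The intervals may overlap, so the step function built from their end points counts how
  many of them cover a point, and the union is its superlevel set at 1.\<close>

lemma exp_riesz_basis_finite_union:
  assumes fin: "finite \<I>" and int: "\<forall>I\<in>\<I>. bounded_interval_pos I" and S: "S = \<Union>\<I>"
    and w: "0 < w" and sub: "S \<subseteq> {A..A + w}"
  shows "\<exists>L. exp_riesz_basis S ((\<lambda>n. 2 * pi * of_int n / w) ` L)"
proof -
  have "\<forall>I\<in>\<I>. \<exists>p. fst p < snd p \<and> {fst p<..<snd p} \<subseteq> I \<and> I \<subseteq> {fst p..snd p}"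
    using int unfolding bounded_interval_pos_def by simp
  from bchoice[OF this] obtain p where p: "\<forall>I\<in>\<I>. fst (p I) < snd (p I) \<and> {fst (p I)<..<snd (p I)} \<subseteq> I \<and> I \<subseteq> {fst (p I)..snd (p I)}"
    by (elim exE)
  define a b where "a I = fst (p I)" and "b I = snd (p I)" for I
  have ab: "a I < b I" "{a I<..<b I} \<subseteq> I" "I \<subseteq> {a I..b I}" if "I \<in> \<I>" for I
    using p that by (auto simp: a_def b_def)
  have rng: "A \<le> a I" "b I \<le> A + w" if "I \<in> \<I>" for I
  proof -
    have "{a I<..<b I} \<subseteq> {A..A + w}" using ab(2)[OF that] sub that unfolding S by blast
    \<comment> \<open>The end points need not lie in \<open>S\<close>, but they lie in the closure
      of the open interval.\<close>
    then have "closure {a I<..<b I} \<subseteq> {A..A + w}" by (rule closure_minimal) simp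
    then have "{a I..b I} \<subseteq> {A..A + w}" using ab(1)[OF that] by simp
    then show "A \<le> a I" "b I \<le> A + w" using ab(1)[OF that] by auto
  qed
  have Ib: "I \<in> sets borel" if "I \<in> \<I>" for I
  proof -
    have "I = {a I<..<b I} \<union> (I \<inter> {a I, b I})"
    proof (intro equalityI subsetI)
      fix x assume x: "x \<in> I"
      then have "a I \<le> x" "x \<le> b I" using subsetD[OF ab(3)[OF that] x] by auto
      then show "x \<in> {a I<..<b I} \<union> (I \<inter> {a I, b I})"
        using x by (cases "x = a I"; cases "x = b I") auto
    next
      fix x assume "x \<in> {a I<..<b I} \<union> (I \<inter> {a I, b I})"
      then show "x \<in> I" using ab(2)[OF that] by blast
    qed
    moreover have "I \<inter> {a I, b I} \<in> sets borel" by (intro borel_closed finite_imp_closed) auto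
    ultimately show ?thesis using sets.Un[of "{a I<..<b I}" borel "I \<inter> {a I, b I}"] by simp
  qed
  have Sb: "S \<in> sets borel" unfolding S using fin Ib by (intro sets.finite_Union) auto
  \<comment> \<open>End points in the rescaled variable: the flag True marks a left end, which gets
    jump 1, and False a right end, which gets jump -1.\<close>
  define \<phi> where "\<phi> x = ((if snd x then a (fst x) else b (fst x)) - A) / w" for x :: "real set \<times> bool"
  define \<epsilon> where "\<epsilon> x = (if snd x then 1 else -1 :: int)" for x :: "real set \<times> bool"
  let ?X = "\<I> \<times> (UNIV :: bool set)"
  have X: "finite ?X" using fin by simp
  define Y where "Y = (\<lambda>x. frac (\<phi> x)) ` ?X"
  define \<epsilon>' where "\<epsilon>' p = (\<Sum>x\<in>{x\<in>?X. frac (\<phi> x) = p}. \<epsilon> x)" for p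
  define c where "c = 0 - (\<Sum>x\<in>?X. \<epsilon> x * \<lfloor>\<phi> x\<rfloor>)"
  have bool_sum: "(\<Sum>x\<in>?X. f x) = (\<Sum>I\<in>\<I>. f (I, True) + f (I, False))" for f :: "real set \<times> bool \<Rightarrow> int"
  proof -
    have "(\<Sum>x\<in>?X. f x) = (\<Sum>I\<in>\<I>. \<Sum>t\<in>UNIV. f (I, t))" by (simp add: sum.cartesian_product)
    also have "\<dots> = (\<Sum>I\<in>\<I>. f (I, True) + f (I, False))" by (simp add: UNIV_bool add.commute)
    finally show ?thesis .
  qed
  have hY: "stepf c Y \<epsilon>' y = (\<Sum>I\<in>\<I>. \<lfloor>y - \<phi> (I, True)\<rfloor> - \<lfloor>y - \<phi> (I, False)\<rfloor>)" for y
  proof -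
    have "stepf c Y \<epsilon>' y = 0 + (\<Sum>x\<in>?X. \<epsilon> x * \<lfloor>y - \<phi> x\<rfloor>)"
      unfolding c_def Y_def \<epsilon>'_def[abs_def] by (rule stepf_normalize(1)[OF X, symmetric])
    also have "\<dots> = (\<Sum>I\<in>\<I>. \<lfloor>y - \<phi> (I, True)\<rfloor> - \<lfloor>y - \<phi> (I, False)\<rfloor>)"
      unfolding bool_sum by (simp add: \<epsilon>_def)
    finally show ?thesis .
  qed
  have Yp: "finite Y" "Y \<subseteq> {0..<1}" using X by (auto simp: Y_def frac_lt_1)
  have Ys: "sum \<epsilon>' Y = 0"
  proof -
    have "sum \<epsilon>' Y = sum \<epsilon> ?X" unfolding Y_def \<epsilon>'_def[abs_def] by (rule stepf_normalize(2)[OF X])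
    also have "\<dots> = 0" unfolding bool_sum by (simp add: \<epsilon>_def)
    finally show ?thesis .
  qed
  define C where "C = {y. 1 \<le> stepf c Y \<epsilon>' y}"
  have st: "step_set (card {p \<in> Y. (1 \<le> stepf c Y \<epsilon>' p) \<noteq> (1 \<le> stepf c Y \<epsilon>' p - \<epsilon>' p)}) C"
    unfolding C_def by (rule superlevel_step_set[OF Yp Ys])
  have Cb: "C \<in> sets borel" by (rule step_set_borel[OF st])
  obtain L where L: "riesz_split C L" using riesz_split_step_set[OF st] by blast
  have phi: "0 \<le> \<phi> (I, True)" "\<phi> (I, True) < \<phi> (I, False)" "\<phi> (I, False) \<le> 1" if "I \<in> \<I>" for I
    using rng[OF that] ab(1)[OF that] w by (auto simp: \<phi>_def divide_strict_right_mono)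
  have fl: "\<lfloor>y - \<phi> (I, True)\<rfloor> - \<lfloor>y - \<phi> (I, False)\<rfloor> = (if \<phi> (I, True) \<le> y \<and> y < \<phi> (I, False) then 1 else 0)"
    if I: "I \<in> \<I>" and y: "0 \<le> y" "y < 1" for I y
  proof -
    have "\<lfloor>y - q\<rfloor> = (if y < q then -1 else 0)" if "0 \<le> q" "q \<le> 1" for q
      using that y by (auto simp: floor_eq_iff)
    then show ?thesis using phi[OF I] by auto
  qed
  have inC: "y \<in> C \<longleftrightarrow> (\<exists>I\<in>\<I>. \<phi> (I, True) \<le> y \<and> y < \<phi> (I, False))" if y: "0 \<le> y" "y < 1" for y
  proof -
    have "stepf c Y \<epsilon>' y = (\<Sum>I\<in>\<I>. if \<phi> (I, True) \<le> y \<and> y < \<phi> (I, False) then 1 else 0)"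
      unfolding hY using fl y by (intro sum.cong) auto
    also have "\<dots> = int (card {I\<in>\<I>. \<phi> (I, True) \<le> y \<and> y < \<phi> (I, False)})"
      using fin by (simp add: sum.If_cases Int_def)
    finally have "y \<in> C \<longleftrightarrow> card {I\<in>\<I>. \<phi> (I, True) \<le> y \<and> y < \<phi> (I, False)} \<noteq> 0" unfolding C_def by auto
    then show ?thesis using fin by auto
  qed
  \<comment> \<open>Away from this finite set it makes no difference whether the intervals are open,
    closed or half-open.\<close>
  let ?E = "insert 1 (\<phi> ` ?X)"
  have agree: "A + w * x \<in> S \<longleftrightarrow> x \<in> C \<inter> {0..<1}" if x: "x \<notin> ?E" for x
  proof -
    have br: "\<phi> (I, True) < x \<and> x < \<phi> (I, False) \<longleftrightarrow> A + w * x \<in> I" if I: "I \<in> \<I>" for I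
    proof -
      have e: "\<phi> (I, True) < x \<longleftrightarrow> a I < A + w * x" "x < \<phi> (I, False) \<longleftrightarrow> A + w * x < b I"
        using w by (auto simp: \<phi>_def field_simps)
      have "x \<noteq> \<phi> (I, True)" "x \<noteq> \<phi> (I, False)" using x I by auto
      then have "A + w * x \<noteq> a I" "A + w * x \<noteq> b I" using w by (auto simp: \<phi>_def field_simps)
      then show ?thesis unfolding e using subsetD[OF ab(2)[OF I], of "A + w * x"] subsetD[OF ab(3)[OF I], of "A + w * x"]
        by auto
    qed
    show ?thesis
    proof
      assume "A + w * x \<in> S"
      then obtain I where I: "I \<in> \<I>" "A + w * x \<in> I" unfolding S by blast
      then have b: "\<phi> (I, True) < x \<and> x < \<phi> (I, False)" using br by blast
      then have "0 \<le> x" "x < 1" using phi[OF I(1)] by auto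
      then show "x \<in> C \<inter> {0..<1}" using inC[of x] b I(1) by force
    next
      assume "x \<in> C \<inter> {0..<1}"
      then obtain I where I: "I \<in> \<I>" "\<phi> (I, True) \<le> x" "x < \<phi> (I, False)" using inC[of x] by auto
      moreover have "x \<noteq> \<phi> (I, True)" using x I(1) by auto
      ultimately have "A + w * x \<in> I" using br[of I] by auto
      then show "A + w * x \<in> S" unfolding S using I(1) by blast
    qed
  qed
  have "negligible ?E" using X by (intro negligible_finite) auto
  then have neg: "negligible (({x. A + w * x \<in> S} - C \<inter> {0..<1}) \<union> (C \<inter> {0..<1} - {x. A + w * x \<in> S}))"
    by (rule negligible_subset) (use agree in auto)
  have "exp_riesz_basis S ((\<lambda>n. 2 * pi * of_int n / w) ` L)"
    by (rule exp_riesz_basis_of_riesz_split[OF w _ Cb L neg]) (use Sb in simp)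
  then show ?thesis by (rule exI)
qed

theorem mainTheorem1:
  fixes \<I> :: "real set set" and S :: "real set"
  assumes "finite \<I>"
    and "\<forall>I\<in>\<I>. bounded_interval_pos I"
    and "S = \<Union>\<I>"
  shows "(\<exists>\<Lambda>. exp_riesz_basis S \<Lambda>) \<and>
         (S \<subseteq> {0..2*pi} \<longrightarrow> (\<exists>\<Lambda>. \<Lambda> \<subseteq> \<int> \<and> exp_riesz_basis S \<Lambda>))"
proof (intro conjI impI)
  have "bounded S"
    unfolding assms(3)
  proof (rule bounded_Union[OF assms(1)], rule ballI)
    fix I assume "I \<in> \<I>"
    then obtain a b where "I \<subseteq> {a..b}" using assms(2) unfolding bounded_interval_pos_def by blast
    then show "bounded I" by (rule bounded_subset[OF bounded_closed_interval])
  qed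
  then obtain M where M: "M > 0" "\<And>x. x \<in> S \<Longrightarrow> norm x \<le> M" unfolding bounded_pos by blast
  \<comment> \<open>Any window around \<open>S\<close> serves; this one has length 2 M, so the
    frequencies are integer multiples of pi / M.\<close>
  have "S \<subseteq> {- M..- M + 2 * M}" using M(2) by (auto simp: abs_le_iff) force
  with exp_riesz_basis_finite_union[OF assms, of "2 * M" "- M"] M(1)
  show "\<exists>\<Lambda>. exp_riesz_basis S \<Lambda>" by auto
next
  assume "S \<subseteq> {0..2*pi}"
  \<comment> \<open>A window of length exactly 2 pi turns the frequencies into the integers
    themselves.\<close>
  then obtain L where "exp_riesz_basis S ((\<lambda>n. 2 * pi * of_int n / (2 * pi)) ` L)"
    using exp_riesz_basis_finite_union[OF assms, of "2 * pi" 0] by auto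
  moreover have "(\<lambda>n. 2 * pi * of_int n / (2 * pi)) ` L \<subseteq> \<int>" by auto
  ultimately show "\<exists>\<Lambda>. \<Lambda> \<subseteq> \<int> \<and> exp_riesz_basis S \<Lambda>" by blast
qed

end
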